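(* Let $\mathcal S$ be a (finite) real number and consider all Schrödinger L-systems $\Theta_{\mu,h}$ ($\operatorname{Im}h>0$, $\mu\in\mathbb R\cup\{\infty\}$) that have c-entropy $\mathcal S$ and whose impedance function $V_{\Theta_{\mu,h}}(z)$ belongs to the generalized Donoghue class $\mathfrak M_\kappa^{-1}$ with $\kappa=e^{-\mathcal S}$. Within this class the minimum coefficient of dissipation is $$\mathcal D_{min}=\operatorname{Im}h=-\left(\frac{e^{\mathcal S}-1}{e^{\mathcal S}+1}\right)\operatorname{Im}m_\infty(i)=-\tanh\left(\frac{\mathcal S}{2}\right)\operatorname{Im}m_\infty(i),$$ and the L-system $\Theta_{\mu,h}$ of this class with the minimum coefficient of dissipation is uniquely determined by the parameters $$h=-\operatorname{Re}m_\infty(i)-i\tanh\left(\frac{\mathcal S}{2}\right)\operatorname{Im}m_\infty(i)\quad\text{and}\quad \mu=-\operatorname{Re}m_\infty(i).$$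
   Context: Setting. Let $\ell\in\mathbb R$, let $q$ be a (fixed) real locally summable function on $[\ell,+\infty)$, $l(y)=-y''+q(x)y$, $\mathcal H=L_2(\ell,+\infty)$. Let $D^*$ be the set of $y\in\mathcal H$ that are locally absolutely continuous together with $y'$ and satisfy $l(y)\in\mathcal H$. The minimal symmetric operator $\dot A y=l(y)$ with boundary conditions $y(\ell)=y'(\ell)=0$ is assumed to have deficiency indices $(1,1)$; $\operatorname{Dom}(\dot A^* )=D^*$, $\dot A^*y=l(y)$. For $h\in\mathbb C$ with $\operatorname{Im}h>0$, $T_h y=l(y)$ with domain $\{y\in D^*: y'(\ell)=hy(\ell)\}$. Weyl function. Let $\varphi_1,\varphi_2$ solve $l(\varphi_k)=\lambda\varphi_k$ with $\varphi_1(\ell,\lambda)=0,\varphi_1'(\ell,\lambda)=1$, $\varphi_2(\ell,\lambda)=-1,\varphi_2'(\ell,\lambda)=0$. The Weyl function $m_\infty(\lambda)$ is such that $\varphi_2(\cdot,\lambda)+m_\infty(\lambda)\varphi_1(\cdot,\lambda)\in L_2(\ell,+\infty)$. One has $\operatorname{Im}m_\infty(i)<0$. Schrödinger L-systems. $\mathcal H_+=D^*$ with $(y,z)_+=\int_\ell^\infty (y\bar z+l(y)\overline{l(z)})dx$, and $\mathcal H_+\subset\mathcal H\subset\mathcal H_-$ is the corresponding rigged triplet; $\delta(x-\ell),\delta'(x-\ell)\in\mathcal H_-$ act by $(y,\delta)=y(\ell)$, $(y,\delta')=-y'(\ell)$. For $\mu\in\mathbb R\cup\{\infty\}$ put $\mathbb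 A_{\mu,h}y=-y''+q y-\frac1{\mu-h}[y'(\ell)-hy(\ell)][\mu\delta(x-\ell)+\delta'(x-\ell)]$ and $g=\frac{(\operatorname{Im}h)^{1/2}}{|\mu-h|}[\mu\delta(x-\ell)+\delta'(x-\ell)]$ (limits as $\mu\to\infty$ if $\mu=\infty$), $Kc=cg$ for $c\in\mathbb C$; then $\operatorname{Im}\mathbb A_{\mu,h}=KK^*$. The array $\Theta_{\mu,h}=(\mathbb A_{\mu,h},K,1;\ \mathcal H_+\subset\mathcal H\subset\mathcal H_-,\mathbb C)$ is the Schrödinger L-system with main operator $T_h$ and state-space operator $\mathbb A_{\mu,h}$. Its transfer function is $W_{\Theta_{\mu,h}}(z)=I-2iK^*(\mathbb A_{\mu,h}-zI)^{-1}K=\frac{\mu-h}{\mu-\bar h}\cdot\frac{m_\infty(z)+\bar h}{m_\infty(z)+h}$ and its impedance function is $V_{\Theta_{\mu,h}}(z)=K^*(\operatorname{Re}\mathbb A_{\mu,h}-zI)^{-1}K=\frac{(m_\infty(z)+\mu)\operatorname{Im}h}{(\mu-\operatorname{Re}h)m_\infty(z)+\mu\operatorname{Re}h-|h|^2}$ (limits as $\mu\to\infty$ if $\mu=\infty$). The coefficient of dissipation of $\Theta_{\mu,h}$ (and of $T_h$) is $\mathcal D=\operatorname{Im}h$. The c-entropy of $\Theta_{\mu,h}$ is $\mathcal S=-\ln|W_{\Theta_{\mu,h}}(-i)|$; it equals $-\ln|\kappa|$ where $|\kappa|=\left|\frac{m_\infty(i)+h}{m_\infty(i)+\bar h}\right|<1$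 is the modulus of von Neumann's parameter of $T_h$. Generalized Donoghue class. For $0\le\kappa<1$, $\mathfrak M_\kappa^{-1}$ is the class of all Herglotz-Nevanlinna functions $M(z)=\int_{\mathbb R}\left(\frac1{\lambda-z}-\frac{\lambda}{1+\lambda^2}\right)d\sigma(\lambda)$, $\sigma$ an infinite Borel measure with $\int_{\mathbb R}\frac{d\sigma(\lambda)}{1+\lambda^2}=\frac{1+\kappa}{1-\kappa}$ (equivalently, $M(i)=i\frac{1+\kappa}{1-\kappa}$). *)

theory Defs
  imports "HOL-Analysis.Analysis" "HOL-Library.Function_Algebras"
begin

section \<open>The differential expression on the half-line\<close>

definition locally_summable :: "real \<Rightarrow> (real \<Rightarrow> real) \<Rightarrow> bool" where
  "locally_summable l q \<longleftrightarrow> (\<forall>b. q absolutely_integrable_on {l..b})"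

text \<open>Local absolute continuity on \<open>[l, \<infinity>)\<close> in its Lebesgue form: \<open>f\<close> is an indefinite integral
  of a locally summable function \<open>g\<close>. Such a \<open>g\<close> is unique up to null sets and is the
  almost-everywhere derivative of \<open>f\<close>.\<close>

definition has_ac_derivative :: "real \<Rightarrow> (real \<Rightarrow> complex) \<Rightarrow> (real \<Rightarrow> complex) \<Rightarrow> bool" where
  "has_ac_derivative l f g \<longleftrightarrow>
     (\<forall>b. g absolutely_integrable_on {l..b}) \<and>
     (\<forall>x\<ge>l. f x = f l + (LINT t:{l..x}|lebesgue. g t))"

definition locally_AC :: "real \<Rightarrow> (real \<Rightarrow> complex) \<Rightarrow> bool" where
  "locally_AC l f \<longleftrightarrow> (\<exists>g. has_ac_derivative l f g)"

definition ac_derivative :: "real \<Rightarrow> (real \<Rightarrow> complex) \<Rightarrow> real \<Rightarrow> complex" where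
  "ac_derivative l f = (SOME g. has_ac_derivative l f g)"

text \<open>The pointwise derivative, one-sided at the endpoint \<open>l\<close>.\<close>

definition D1 :: "real \<Rightarrow> (real \<Rightarrow> complex) \<Rightarrow> real \<Rightarrow> complex" where
  "D1 l y x = vector_derivative y (at x within {l..})"

definition AC2 :: "real \<Rightarrow> (real \<Rightarrow> complex) \<Rightarrow> bool" where
  "AC2 l y \<longleftrightarrow> locally_AC l y \<and> (\<forall>x\<ge>l. y differentiable (at x within {l..})) \<and>
     locally_AC l (D1 l y)"

text \<open>\<open>- y'' + q y\<close>; since \<open>y'\<close> is merely locally absolutely continuous, this is determined
  almost everywhere on \<open>[l, \<infinity>)\<close>, and everything below only depends on it up to null sets.\<close>

definition diff_expr :: "real \<Rightarrow> (real \<Rightarrow> real) \<Rightarrow> (real \<Rightarrow> complex) \<Rightarrow> real \<Rightarrow> complex" where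
  "diff_expr l q y x = - ac_derivative l (D1 l y) x + of_real (q x) * y x"

definition L2 :: "real \<Rightarrow> (real \<Rightarrow> complex) set" where
  "L2 l = {f. set_borel_measurable lebesgue {l..} f \<and>
              set_integrable lebesgue {l..} (\<lambda>x. (cmod (f x))\<^sup>2)}"

definition inner_L2 :: "real \<Rightarrow> (real \<Rightarrow> complex) \<Rightarrow> (real \<Rightarrow> complex) \<Rightarrow> complex" where
  "inner_L2 l f g = (LINT x:{l..}|lebesgue. f x * cnj (g x))"

text \<open>The domain of the adjoint of the minimal operator, where that adjoint acts as \<open>diff_expr\<close>.
  An element of this space has exactly one representative that is continuous on \<open>[l, \<infinity>)\<close>;
  setting it to 0 to the left of \<open>l\<close> makes equality in the space equality of functions.\<close>

definition Dstar :: "real \<Rightarrow> (real \<Rightarrow> real) \<Rightarrow> (real \<Rightarrow> complex) set" where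
  "Dstar l q = {y. (\<forall>x<l. y x = 0) \<and> AC2 l y \<and> y \<in> L2 l \<and> diff_expr l q y \<in> L2 l}"

definition solves :: "real \<Rightarrow> (real \<Rightarrow> real) \<Rightarrow> complex \<Rightarrow> (real \<Rightarrow> complex) \<Rightarrow> bool" where
  "solves l q \<zeta> y \<longleftrightarrow> AC2 l y \<and> (AE x in lebesgue. x \<ge> l \<longrightarrow> diff_expr l q y x = \<zeta> * y x)"

text \<open>Dimension over the complex numbers of the kernel of the adjoint minus \<open>\<zeta>\<close>.\<close>

definition defect_number :: "real \<Rightarrow> (real \<Rightarrow> real) \<Rightarrow> complex \<Rightarrow> nat" where
  "defect_number l q \<zeta> =
     vector_space.dim (\<lambda>(c::complex) (f::real \<Rightarrow> complex) x. c * f x)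
       {y \<in> Dstar l q. solves l q \<zeta> y}"

definition deficiency_indices_1_1 :: "real \<Rightarrow> (real \<Rightarrow> real) \<Rightarrow> bool" where
  "deficiency_indices_1_1 l q \<longleftrightarrow> defect_number l q \<i> = 1 \<and> defect_number l q (- \<i>) = 1"

definition weyl_function :: "real \<Rightarrow> (real \<Rightarrow> real) \<Rightarrow> (complex \<Rightarrow> complex) \<Rightarrow> bool" where
  "weyl_function l q m \<longleftrightarrow> (\<forall>\<zeta>. Im \<zeta> \<noteq> 0 \<longrightarrow> (\<exists>\<phi>1 \<phi>2.
     solves l q \<zeta> \<phi>1 \<and> \<phi>1 l = 0 \<and> D1 l \<phi>1 l = 1 \<and>
     solves l q \<zeta> \<phi>2 \<and> \<phi>2 l = -1 \<and> D1 l \<phi>2 l = 0 \<and>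
     (\<lambda>x. \<phi>2 x + m \<zeta> * \<phi>1 x) \<in> L2 l))"


section \<open>L-systems with one-dimensional input-output space\<close>

text \<open>An element \<open>f\<close> of the negative space is represented by the conjugate-linear functional
  \<open>w \<mapsto> (f, w)\<close> on the positive space, so \<open>(w, f)\<close> is \<open>cnj (f w)\<close>; equality in the negative
  space is equality of functionals on the positive space. The space \<open>H\<close> enters only through
  its inner product on the positive space, by which \<open>x\<close> is identified with \<open>w \<mapsto> (x, w)\<close>.
  The input-output space is the complex numbers and the directing operator is 1.\<close>

type_synonym functional = "(real \<Rightarrow> complex) \<Rightarrow> complex"

record L_system =
  Hplus :: "(real \<Rightarrow> complex) set"
  Hinner :: "(real \<Rightarrow> complex) \<Rightarrow> (real \<Rightarrow> complex) \<Rightarrow> complex"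
  state_op :: "(real \<Rightarrow> complex) \<Rightarrow> functional"
  channel :: "complex \<Rightarrow> functional"

text \<open>\<open>(B - z I)\<^sup>-\<^sup>1 f\<close> for an operator \<open>B\<close> from the positive to the negative space.\<close>

definition resolvent ::
    "L_system \<Rightarrow> ((real \<Rightarrow> complex) \<Rightarrow> functional) \<Rightarrow> complex \<Rightarrow> functional \<Rightarrow> real \<Rightarrow> complex" where
  "resolvent \<Theta> B z f =
     (THE x. x \<in> Hplus \<Theta> \<and> (\<forall>w\<in>Hplus \<Theta>. B x w - z * Hinner \<Theta> x w = f w))"

text \<open>\<open>(B\<^sup>* y, w)\<close> is the conjugate of \<open>(B w, y)\<close>.\<close>

definition adjoint_op ::
    "((real \<Rightarrow> complex) \<Rightarrow> functional) \<Rightarrow> (real \<Rightarrow> complex) \<Rightarrow> functional" where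
  "adjoint_op B y w = cnj (B w y)"

definition real_part_op ::
    "((real \<Rightarrow> complex) \<Rightarrow> functional) \<Rightarrow> (real \<Rightarrow> complex) \<Rightarrow> functional" where
  "real_part_op B y w = (B y w + adjoint_op B y w) / 2"

text \<open>The adjoint channel operator, determined by \<open>(y, K c) = (K\<^sup>* y) * cnj c\<close>.\<close>

definition channel_adj :: "L_system \<Rightarrow> functional" where
  "channel_adj \<Theta> y = cnj (channel \<Theta> 1 y)"

definition transfer_function :: "L_system \<Rightarrow> complex \<Rightarrow> complex" where
  "transfer_function \<Theta> z =
     1 - 2 * \<i> * channel_adj \<Theta> (resolvent \<Theta> (state_op \<Theta>) z (channel \<Theta> 1))"

definition impedance_function :: "L_system \<Rightarrow> complex \<Rightarrow> complex" where
  "impedance_function \<Theta> z =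
     channel_adj \<Theta> (resolvent \<Theta> (real_part_op (state_op \<Theta>)) z (channel \<Theta> 1))"

text \<open>Extended-valued, since the transfer function may vanish at \<open>-\<i>\<close>
  (recall \<open>ln 0 = 0\<close> on type real).\<close>

definition c_entropy :: "L_system \<Rightarrow> ereal" where
  "c_entropy \<Theta> = (if transfer_function \<Theta> (- \<i>) = 0 then \<infinity>
                   else ereal (- ln (cmod (transfer_function \<Theta> (- \<i>)))))"


section \<open>Schroedinger L-systems\<close>

text \<open>The parameter \<open>\<mu>\<close> ranges over the real line with a single point at infinity.\<close>

datatype mu_param = Fin_mu real | Inf_mu

definition delta :: "real \<Rightarrow> functional" where
  "delta l w = cnj (w l)"

definition delta' :: "real \<Rightarrow> functional" where
  "delta' l w = cnj (- D1 l w l)"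

text \<open>The limits as \<open>\<mu> \<rightarrow> \<infinity>\<close> of \<open>(\<mu> \<delta> + \<delta>') / (\<mu> - h)\<close> and of \<open>(\<mu> \<delta> + \<delta>') / |\<mu> - h|\<close> are \<open>\<delta>\<close>
  (the latter up to an irrelevant sign when \<open>\<mu> \<rightarrow> -\<infinity>\<close>).\<close>

fun S_state_op ::
    "real \<Rightarrow> (real \<Rightarrow> real) \<Rightarrow> mu_param \<Rightarrow> complex \<Rightarrow> (real \<Rightarrow> complex) \<Rightarrow> functional" where
  "S_state_op l q (Fin_mu \<mu>) h y w =
     inner_L2 l (diff_expr l q y) w
     - 1 / (of_real \<mu> - h) * (D1 l y l - h * y l) * (of_real \<mu> * delta l w + delta' l w)"
| "S_state_op l q Inf_mu h y w =
     inner_L2 l (diff_expr l q y) w - (D1 l y l - h * y l) * delta l w"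

fun S_channel_vector :: "real \<Rightarrow> mu_param \<Rightarrow> complex \<Rightarrow> functional" where
  "S_channel_vector l (Fin_mu \<mu>) h w =
     of_real (sqrt (Im h) / cmod (of_real \<mu> - h)) * (of_real \<mu> * delta l w + delta' l w)"
| "S_channel_vector l Inf_mu h w = of_real (sqrt (Im h)) * delta l w"

definition S_system :: "real \<Rightarrow> (real \<Rightarrow> real) \<Rightarrow> mu_param \<Rightarrow> complex \<Rightarrow> L_system" where
  "S_system l q \<mu> h =
     \<lparr> Hplus = Dstar l q, Hinner = inner_L2 l, state_op = S_state_op l q \<mu> h,
       channel = (\<lambda>c w. c * S_channel_vector l \<mu> h w) \<rparr>"

definition dissipation_coeff :: "mu_param \<times> complex \<Rightarrow> real" where
  "dissipation_coeff = (\<lambda>(\<mu>, h). Im h)"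


section \<open>Generalized Donoghue class\<close>

definition gen_donoghue_inv :: "real \<Rightarrow> (complex \<Rightarrow> complex) set" where
  "gen_donoghue_inv \<kappa> = {M. 0 \<le> \<kappa> \<and> \<kappa> < 1 \<and> (\<exists>\<sigma> :: real measure.
     sets \<sigma> = sets borel \<and> emeasure \<sigma> UNIV = \<infinity> \<and>
     (\<integral>\<^sup>+ t. ennreal (1 / (1 + t\<^sup>2)) \<partial>\<sigma>) = ennreal ((1 + \<kappa>) / (1 - \<kappa>)) \<and>
     (\<forall>z. Im z \<noteq> 0 \<longrightarrow>
        M z = (LINT t|\<sigma>. 1 / (of_real t - z) - of_real (t / (1 + t\<^sup>2)))))}"

text \<open>Parameters of the Schroedinger L-systems with c-entropy \<open>S\<close> and impedance function in the
  generalized Donoghue class with \<open>\<kappa> = exp (- S)\<close>.\<close>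

definition entropy_class :: "real \<Rightarrow> (real \<Rightarrow> real) \<Rightarrow> real \<Rightarrow> (mu_param \<times> complex) set" where
  "entropy_class l q S = {(\<mu>, h). Im h > 0 \<and> c_entropy (S_system l q \<mu> h) = ereal S \<and>
     impedance_function (S_system l q \<mu> h) \<in> gen_donoghue_inv (exp (- S))}"

end

theory Submission
  imports Defs "HOL-Complex_Analysis.Complex_Analysis" "HOL-Probability.Probability"
begin

text \<open>Put \<open>M = - m\<close> and let \<open>\<gamma>\<^sub>z\<close> be the square integrable solution of \<open>- y'' + q y = z y\<close> with \<open>\<gamma>\<^sub>z(l) = 1\<close>,
so that \<open>\<gamma>\<^sub>z'(l) = M(z)\<close>.

The first half of the argument turns the L-systems into formulas in \<open>m\<close>. Everything there rests on
Green's formula on \<open>Dstar\<close> without a boundary term at infinity. The deficiency indices speak only about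
\<open>\<plusminus>\<i>\<close>: they provide a solution \<open>\<phi>\<close> at \<open>\<i>\<close> that is not square integrable. Its energy is unbounded, and the
Pluecker relation between \<open>\<phi>\<close>, \<open>\<gamma>\<close> and their conjugates then forces the Wronskian of \<open>\<gamma>\<close> and its
conjugate to vanish at infinity. Hence variation of constants at \<open>\<i>\<close> is a contraction of \<open>L\<^sub>2\<close>; every
element of \<open>Dstar\<close> is such an image plus a multiple of \<open>\<gamma>\<close>, and cutting off the right-hand side kills the
boundary form (\<open>limit_point\<close>). Given Green's formula, \<open>A\<^sub>\<mu>\<^sub>,\<^sub>h\<close> and its real part are the
differential expression plus a rank-one boundary term, the resolvent applied to the channel vector is a
multiple of \<open>\<gamma>\<^sub>z\<close> (\<open>rank_one_resolvent\<close>), and the transfer and impedance functions are the stated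
linear fractional expressions in \<open>m\<close>.

The extremal problem is then plane geometry. Fixing the c-entropy puts \<open>h\<close> on a circle symmetric about the
line \<open>Re h = - Re m(\<i>)\<close>; its lowest point has height \<open>- tanh(S/2) Im m(\<i>)\<close> (\<open>entropy_circle\<close>). This gives
the lower bound and fixes \<open>h\<close> for a minimizer. Membership in the Donoghue class prescribes the impedance
at \<open>\<i>\<close>, and at the lowest point this leaves only \<open>\<mu> = - Re m(\<i>)\<close>.

The second half shows that the minimum is attained. For this \<open>\<mu>\<close> and \<open>h\<close> the impedance is
\<open>(M - Re M(\<i>)) / Im h\<close>, so the claim is that the Nevanlinna representation of \<open>M\<close> has no linear term and
an infinite measure (\<open>weyl_measure\<close>). Green's formula gives
\<open>M(z) - cnj (M(w)) = (z - cnj w) \<langle>\<gamma>\<^sub>z, \<gamma>\<^sub>w\<rangle>\<close>, which makes \<open>M\<close> holomorphic in the upper half-plane with positive imaginary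
part, and \<open>Nevanlinna_representation\<close> applies; it comes from the Schwarz formula on circles of radius
less than 1 and Helly's selection theorem. A linear term would keep the norm of \<open>\<gamma>\<close> at \<open>\<i> y\<close> bounded below while
\<open>\<gamma>'(l)\<close> grows like \<open>y\<close>, and a finite measure would let this norm decay like \<open>1/y\<close> while \<open>\<gamma>'(l)\<close> stays bounded.
Both contradict the size of \<open>\<gamma>\<close> near \<open>l\<close>, where \<open>\<gamma>(l) = 1\<close> and the equation controls the growth.\<close>

section \<open>Indefinite Lebesgue integrals on a half-line\<close>

text \<open>Local statements use the Henstock-Kurzweil integral over compact intervals, for which the
fundamental theorem and interval additivity are at hand; global ones use the Lebesgue integral.\<close>

lemma has_ac_derivative_integral:
  assumes "has_ac_derivative l f g"
  shows "g absolutely_integrable_on {l..b}" "x \<ge> l \<Longrightarrow> f x = f l + integral {l..x} g"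
proof -
  show i: "g absolutely_integrable_on {l..b}" for b
    using assms unfolding has_ac_derivative_def by blast
  assume "x \<ge> l"
  then have "f x = f l + (LINT t:{l..x}|lebesgue. g t)"
    using assms unfolding has_ac_derivative_def by blast
  then show "f x = f l + integral {l..x} g"
    using set_lebesgue_integral_eq_integral(2)[OF i[of x]] by simp
qed

lemma has_ac_derivativeI:
  assumes "\<And>b. g absolutely_integrable_on {l..b}" "\<And>x. x \<ge> l \<Longrightarrow> f x = f l + integral {l..x} g"
  shows "has_ac_derivative l f g"
  unfolding has_ac_derivative_def
proof (intro conjI allI impI)
  fix x assume "x \<ge> l"
  with assms(2)[of x] show "f x = f l + (LINT t:{l..x}|lebesgue. g t)"
    using set_lebesgue_integral_eq_integral(2)[OF assms(1)[of x]] by simp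
qed (rule assms(1))

text \<open>One-sided derivatives at the endpoint on \<open>[l, \<infinity>)\<close> and on a compact interval agree, so the
fundamental theorem on compact intervals transfers to the half-line.\<close>

lemma half_line_at_within:
  fixes x :: real
  assumes "l \<le> x" "x < b"
  shows "at x within {l..b} = at x within {l..}"
proof (rule at_within_nhd[where S="{..<b}"])
  show "{l..b} \<inter> {..<b} - {x} = {l..} \<inter> {..<b} - {x}" by auto
qed (use assms in auto)

lemma half_line_nontrivial: "l \<le> x \<Longrightarrow> at (x::real) within {l..} \<noteq> bot"
  using islimpt_subset[of x "{l..x+1}" "{l..}"] islimpt_Icc[of l "x+1" x] by (simp add: trivial_limit_within subset_iff)

lemma continuous_on_half_lineI:
  fixes f :: "real \<Rightarrow> 'a::topological_space"
  assumes "\<And>b. continuous_on {l..b} f"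
  shows "continuous_on {l..} f"
  unfolding continuous_on_def
proof
  fix x assume "x \<in> {l..}"
  then have "(f \<longlongrightarrow> f x) (at x within {l..x+1})"
    using assms[of "x+1"] by (auto simp: continuous_on_def)
  then show "(f \<longlongrightarrow> f x) (at x within {l..})"
    using half_line_at_within[of l x "x+1"] \<open>x \<in> {l..}\<close> by simp
qed

lemma has_ac_derivative_continuous:
  assumes "has_ac_derivative l f g"
  shows "continuous_on {l..} f"
proof (rule continuous_on_half_lineI)
  fix b
  have "continuous_on {l..b} (\<lambda>x. f l + integral {l..x} g)"
    by (intro continuous_intros indefinite_integral_continuous_1
        set_lebesgue_integral_eq_integral(1)[OF has_ac_derivative_integral(1)[OF assms]])
  then show "continuous_on {l..b} f"
    by (rule continuous_on_eq) (auto intro: has_ac_derivative_integral(2)[OF assms, symmetric])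
qed

lemma has_ac_derivative_cong:
  assumes "has_ac_derivative l f g" "\<And>x. x \<ge> l \<Longrightarrow> f x = f' x" "AE x in lebesgue. x \<ge> l \<longrightarrow> g x = g' x"
  shows "has_ac_derivative l f' g'"
proof (rule has_ac_derivativeI)
  obtain N where N: "negligible N" "{x. \<not> (x \<ge> l \<longrightarrow> g x = g' x)} \<subseteq> N"
    using assms(3) by (auto simp: eventually_ae_filter_negligible)
  show "g' absolutely_integrable_on {l..b}" for b
    by (rule absolutely_integrable_spike[OF has_ac_derivative_integral(1)[OF assms(1)] N(1)]) (use N(2) in auto)
  fix x assume "x \<ge> l"
  have "integral {l..x} g = integral {l..x} g'"
    by (rule integral_spike[OF N(1)]) (use N(2) in auto)
  then show "f' x = f' l + integral {l..x} g'"
    using has_ac_derivative_integral(2)[OF assms(1) \<open>x \<ge> l\<close>] assms(2)[of x] assms(2)[of l] \<open>x \<ge> l\<close> by simp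
qed

lemma has_ac_derivative_cnj:
  assumes "has_ac_derivative l f g"
  shows "has_ac_derivative l (\<lambda>x. cnj (f x)) (\<lambda>x. cnj (g x))"
proof (rule has_ac_derivativeI)
  fix b show "(\<lambda>x. cnj (g x)) absolutely_integrable_on {l..b}"
    using absolutely_integrable_linear[OF has_ac_derivative_integral(1)[OF assms] bounded_linear_cnj]
    by (simp add: o_def)
next
  fix x assume "x \<ge> l"
  show "cnj (f x) = cnj (f l) + integral {l..x} (\<lambda>x. cnj (g x))"
    using integral_linear[OF set_lebesgue_integral_eq_integral(1)[OF has_ac_derivative_integral(1)[OF assms]] bounded_linear_cnj, of x]
      has_ac_derivative_integral(2)[OF assms \<open>x \<ge> l\<close>]
    by (simp add: o_def)
qed

lemma has_ac_derivative_add: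
  assumes "has_ac_derivative l f f'" "has_ac_derivative l g g'"
  shows "has_ac_derivative l (\<lambda>x. f x + g x) (\<lambda>x. f' x + g' x)"
proof (rule has_ac_derivativeI)
  fix b show "(\<lambda>x. f' x + g' x) absolutely_integrable_on {l..b}"
    by (intro set_integral_add has_ac_derivative_integral(1)[OF assms(1)] has_ac_derivative_integral(1)[OF assms(2)])
next
  fix x assume "x \<ge> l"
  show "f x + g x = f l + g l + integral {l..x} (\<lambda>x. f' x + g' x)"
    using Henstock_Kurzweil_Integration.integral_add[OF set_lebesgue_integral_eq_integral(1)[OF has_ac_derivative_integral(1)[OF assms(1)]]
        set_lebesgue_integral_eq_integral(1)[OF has_ac_derivative_integral(1)[OF assms(2)]], of x]
      has_ac_derivative_integral(2)[OF assms(1) \<open>x \<ge> l\<close>] has_ac_derivative_integral(2)[OF assms(2) \<open>x \<ge> l\<close>]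
    by (simp add: algebra_simps)
qed

lemma has_ac_derivative_cmult:
  assumes "has_ac_derivative l f f'"
  shows "has_ac_derivative l (\<lambda>x. c * f x) (\<lambda>x. c * f' x)"
proof (rule has_ac_derivativeI)
  fix b show "(\<lambda>x. c * f' x) absolutely_integrable_on {l..b}"
    by (intro set_integrable_mult_right has_ac_derivative_integral(1)[OF assms(1)])
next
  fix x assume "x \<ge> l"
  show "c * f x = c * f l + integral {l..x} (\<lambda>x. c * f' x)"
    using has_ac_derivative_integral(2)[OF assms(1) \<open>x \<ge> l\<close>]
    by (simp add: algebra_simps)
qed

lemma has_ac_derivative_diff:
  assumes "has_ac_derivative l f f'" "has_ac_derivative l g g'"
  shows "has_ac_derivative l (\<lambda>x. f x - g x) (\<lambda>x. f' x - g' x)"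
  using has_ac_derivative_add[OF assms(1) has_ac_derivative_cmult[OF assms(2), of "-1"]] by simp

lemma has_ac_derivative_const: "has_ac_derivative l (\<lambda>x. c) (\<lambda>x. 0)"
  by (rule has_ac_derivativeI) auto

section \<open>Product rule, uniqueness and pointwise derivatives\<close>

text \<open>Integration by parts for two functions that are merely integrable: split the square
\<open>[a, b] \<times> [a, b]\<close> along its diagonal and integrate \<open>f(s) g(t)\<close> over the two triangles.\<close>

lemma triangle_Fubini:
  fixes f g :: "real \<Rightarrow> complex"
  assumes f: "f absolutely_integrable_on {a..b}" and g: "g absolutely_integrable_on {a..b}"
  defines "M \<equiv> lebesgue_on {a..b}"
  shows "integrable M (\<lambda>s. f s * integral {a..s} g)" "integrable M (\<lambda>s. integral {a..s} f * g s)"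
    "integral {a..b} f * integral {a..b} g =
     (LINT s|M. f s * integral {a..s} g) + (LINT s|M. integral {a..s} f * g s)"
proof -
  have lm: "{a..b} \<in> lmeasurable" using lmeasurable_cbox[of a b] by simp
  have sl: "{a..b} \<in> sets lebesgue" by simp
  interpret finite_measure M unfolding M_def by (rule finite_measure_lebesgue_on[OF lm])
  interpret P: pair_sigma_finite M M ..
  have sp: "space M = {a..b}" by (simp add: M_def)
  have [measurable]: "f \<in> borel_measurable M" "g \<in> borel_measurable M"
    unfolding M_def using absolutely_integrable_imp_borel_measurable[OF f sl] absolutely_integrable_imp_borel_measurable[OF g sl]
    by - assumption+
  have fi: "integrable M f" and gi: "integrable M g"
    unfolding M_def using absolutely_integrable_imp_integrable[OF f sl] absolutely_integrable_imp_integrable[OF g sl]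
    by - assumption+
  have idm: "(\<lambda>x. x) \<in> borel_measurable M"
    using id_borel_measurable_lebesgue_on[of "{a..b}"] by (simp add: M_def id_def)
  have [measurable]: "(\<lambda>p. fst p) \<in> borel_measurable (M \<Otimes>\<^sub>M M)" "(\<lambda>p. snd p) \<in> borel_measurable (M \<Otimes>\<^sub>M M)"
    using measurable_compose[OF measurable_fst idm] measurable_compose[OF measurable_snd idm] by auto
  have ind[measurable]: "(\<lambda>s. indicator {..t} s :: real) \<in> borel_measurable M" for t
    using measurable_compose[OF idm borel_measurable_indicator[of "{..t}" borel]] by simp
  have ind'[measurable]: "(\<lambda>s. indicator {..<t} s :: real) \<in> borel_measurable M" for t
    using measurable_compose[OF idm borel_measurable_indicator[of "{..<t}" borel]] by simp
  have ig: "(LINT t|M. indicator {..s} t *\<^sub>R h t) = integral {a..s} h"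
    if "h absolutely_integrable_on {a..b}" "s \<in> {a..b}" for h :: "real \<Rightarrow> complex" and s
  proof -
    have "(LINT t|M. indicator {..s} t *\<^sub>R h t) = (LINT t|lebesgue. indicator {a..b} t *\<^sub>R indicator {..s} t *\<^sub>R h t)"
      unfolding M_def by (rule integral_restrict_space) auto
    also have "\<dots> = (LINT t:{a..s}|lebesgue. h t)"
      unfolding set_lebesgue_integral_def
      by (rule Bochner_Integration.integral_cong) (use that in \<open>auto simp: indicator_def\<close>)
    also have "\<dots> = integral {a..s} h"
      by (rule set_lebesgue_integral_eq_integral(2))
         (rule absolutely_integrable_on_subinterval[OF that(1)], use that in auto)
    finally show ?thesis .
  qed
  have igb: "(LINT t|M. h t) = integral {a..b} h"
    if "h absolutely_integrable_on {a..b}" for h :: "real \<Rightarrow> complex"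
    unfolding M_def using set_lebesgue_integral_eq_integral(2)[OF that]
    by (simp add: integral_restrict_space set_lebesgue_integral_def)
  \<comment> \<open>the integrand cut off to the triangle above the diagonal\<close>
  define H where "H = (\<lambda>s t. of_bool (s < t) *\<^sub>R (f s * g t))"
  have [measurable]: "(\<lambda>p. of_bool (fst p < snd p) :: real) \<in> borel_measurable (M \<Otimes>\<^sub>M M)"
    unfolding of_bool_def by measurable
  have cm: "(\<lambda>s. integral {a..s} h) \<in> borel_measurable M"
    if "h absolutely_integrable_on {a..b}" for h :: "real \<Rightarrow> complex"
    unfolding M_def
    by (intro continuous_imp_measurable_on_sets_lebesgue indefinite_integral_continuous_1 
        set_lebesgue_integral_eq_integral(1)[OF that]) auto
  have bnd: "norm (integral {a..s} h) \<le> integral {a..b} (\<lambda>x. norm (h x))"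
    if "h absolutely_integrable_on {a..b}" "s \<in> {a..b}" for h :: "real \<Rightarrow> complex" and s
  proof -
    have 1: "h absolutely_integrable_on {a..s}"
      by (rule absolutely_integrable_on_subinterval[OF that(1)]) (use that in auto)
    have "norm (integral {a..s} h) \<le> integral {a..s} (\<lambda>x. norm (h x))"
      using 1 by (intro integral_norm_bound_integral) (auto simp: absolutely_integrable_on_def)
    also have "\<dots> \<le> integral {a..b} (\<lambda>x. norm (h x))"
      using 1 that by (intro integral_subset_le) (auto simp: absolutely_integrable_on_def)
    finally show ?thesis .
  qed
  show i1: "integrable M (\<lambda>s. f s * integral {a..s} g)"
    by (rule Bochner_Integration.integrable_bound[where f="\<lambda>s. f s * of_real (integral {a..b} (\<lambda>x. norm (g x)))"])
       (use fi cm[OF g] order_trans[OF bnd[OF g] abs_ge_self] in \<open>auto simp: norm_mult sp intro!: AE_I2 mult_left_mono\<close>)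
  show i2: "integrable M (\<lambda>s. integral {a..s} f * g s)"
    by (rule Bochner_Integration.integrable_bound[where f="\<lambda>s. of_real (integral {a..b} (\<lambda>x. norm (f x))) * g s"])
       (use gi cm[OF f] order_trans[OF bnd[OF f] abs_ge_self] in \<open>auto simp: norm_mult sp intro!: AE_I2 mult_right_mono\<close>)
  have Hm: "case_prod H \<in> borel_measurable (M \<Otimes>\<^sub>M M)"
    unfolding H_def by (simp add: split_beta)
  have Hi: "integrable (M \<Otimes>\<^sub>M M) (case_prod H)"
  proof (rule Bochner_Integration.integrable_bound[OF _ Hm])
    show "integrable (M \<Otimes>\<^sub>M M) (\<lambda>p. f (fst p) * g (snd p))"
    proof (rule P.Fubini_integrable)
      show "integrable M (\<lambda>x. LINT y|M. norm (f (fst (x, y)) * g (snd (x, y))))"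
        using fi by (simp add: norm_mult)
      show "AE x in M. integrable M (\<lambda>y. f (fst (x, y)) * g (snd (x, y)))"
        using gi by simp
    qed simp
  qed (auto simp: H_def indicator_def)
  have sw: "(LINT t|M. (LINT s|M. H s t)) = (LINT s|M. (LINT t|M. H s t))"
    using P.Fubini_integral[OF Hi] .
  have gI: "integrable M (\<lambda>t. indicator {..s} t *\<^sub>R g t)" for s
  proof (rule Bochner_Integration.integrable_bound[OF gi])
    show "(\<lambda>t. indicator {..s} t *\<^sub>R g t) \<in> borel_measurable M"
      by (intro borel_measurable_scaleR ind) simp
  qed (auto simp: indicator_def)
  have A: "(LINT t|M. H s t) = f s * (integral {a..b} g - integral {a..s} g)" if "s \<in> {a..b}" for s
  proof -
    have "(LINT t|M. H s t) = (LINT t|M. f s * (g t - indicator {..s} t *\<^sub>R g t))"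
      by (rule Bochner_Integration.integral_cong) (auto simp: H_def indicator_def)
    also have "\<dots> = f s * ((LINT t|M. g t) - (LINT t|M. indicator {..s} t *\<^sub>R g t))"
      using Bochner_Integration.integral_diff[OF gi gI[of s]] by simp
    finally show ?thesis using ig[OF g that] igb[OF g] by simp
  qed
  have B: "(LINT s|M. H s t) = integral {a..t} f * g t" if "t \<in> {a..b}" for t
  proof -
    have ne: "AE s in M. s \<noteq> t"
    proof -
      have "AE s in lebesgue. s \<noteq> t"
        by (rule AE_completion) (rule AE_lborel_singleton)
      then show ?thesis unfolding M_def by (subst AE_restrict_space_iff) auto
    qed
    have "(LINT s|M. H s t) = (LINT s|M. (indicator {..t} s *\<^sub>R f s) * g t)"
    proof (rule integral_cong_AE)
      show "(\<lambda>s. H s t) \<in> borel_measurable M" using ind'[of t] by (simp add: H_def indicator_def of_bool_def)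
      show "AE s in M. H s t = indicator {..t} s *\<^sub>R f s * g t"
        using ne by eventually_elim (auto simp: H_def indicator_def)
    qed measurable
    also have "\<dots> = (LINT s|M. (indicator {..t} s *\<^sub>R f s)) * g t"
      by (simp only: integral_mult_left_zero)
    finally show ?thesis using ig[OF f that] by simp
  qed
  have "(LINT s|M. integral {a..s} f * g s) = (LINT t|M. (LINT s|M. H s t))"
    by (rule Bochner_Integration.integral_cong) (simp_all add: B sp)
  also have "\<dots> = (LINT s|M. f s * integral {a..b} g - f s * integral {a..s} g)"
    unfolding sw by (rule Bochner_Integration.integral_cong) (simp_all add: A sp algebra_simps)
  also have "\<dots> = integral {a..b} f * integral {a..b} g - (LINT s|M. f s * integral {a..s} g)"
    using fi i1 igb[OF f] by simp
  finally show "integral {a..b} f * integral {a..b} g =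
     (LINT s|M. f s * integral {a..s} g) + (LINT s|M. integral {a..s} f * g s)" by simp
qed

lemma has_ac_derivative_mult:
  assumes f: "has_ac_derivative l f f'" and g: "has_ac_derivative l g g'"
  shows "has_ac_derivative l (\<lambda>x. f x * g x) (\<lambda>x. f' x * g x + f x * g' x)"
proof -
  note fi = has_ac_derivative_integral(1)[OF f] and gi = has_ac_derivative_integral(1)[OF g]
  have int: "h absolutely_integrable_on {l..b}" "integral {l..b} h = (LINT s|lebesgue_on {l..b}. h s)"
    if "integrable (lebesgue_on {l..b}) h" for h :: "real \<Rightarrow> complex" and b
  proof -
    show h: "h absolutely_integrable_on {l..b}"
      using that by (simp add: set_integrable_def integrable_restrict_space)
    show "integral {l..b} h = (LINT s|lebesgue_on {l..b}. h s)"
      using set_lebesgue_integral_eq_integral(2)[OF h] by (simp add: integral_restrict_space set_lebesgue_integral_def)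
  qed
  let ?F = "\<lambda>x. integral {l..x} f'" and ?G = "\<lambda>x. integral {l..x} g'"
  have 1: "(\<lambda>s. f' s * ?G s) absolutely_integrable_on {l..b}" "(\<lambda>s. ?F s * g' s) absolutely_integrable_on {l..b}" 
    "?F b * ?G b = integral {l..b} (\<lambda>s. f' s * ?G s) + integral {l..b} (\<lambda>s. ?F s * g' s)" for b
    using triangle_Fubini[OF fi[of b] gi[of b]] int[of b] by simp_all
  have pr: "has_ac_derivative l (\<lambda>x. ?F x * ?G x) (\<lambda>x. f' x * ?G x + ?F x * g' x)"
  proof (rule has_ac_derivativeI)
    show "(\<lambda>x. f' x * ?G x + ?F x * g' x) absolutely_integrable_on {l..b}" for b
      by (intro set_integral_add 1)
    fix x assume "x \<ge> l"
    show "?F x * ?G x = ?F l * ?G l + integral {l..x} (\<lambda>x. f' x * ?G x + ?F x * g' x)"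
      using 1(3)[of x] Henstock_Kurzweil_Integration.integral_add[OF set_lebesgue_integral_eq_integral(1)[OF 1(1)]
         set_lebesgue_integral_eq_integral(1)[OF 1(2)], of x] by simp
  qed
  have F: "has_ac_derivative l ?F f'" and G: "has_ac_derivative l ?G g'"
    by (rule has_ac_derivativeI; use fi gi in simp)+
  have "has_ac_derivative l (\<lambda>x. f l * g l + (f l * ?G x + (g l * ?F x + ?F x * ?G x)))
      (\<lambda>x. 0 + (f l * g' x + (g l * f' x + (f' x * ?G x + ?F x * g' x))))"
    by (intro has_ac_derivative_add has_ac_derivative_cmult pr F G has_ac_derivative_const)
  then show ?thesis
  proof (rule has_ac_derivative_cong)
    fix x assume x: "x \<ge> l"
    show "f l * g l + (f l * ?G x + (g l * ?F x + ?F x * ?G x)) = f x * g x"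
      unfolding has_ac_derivative_integral(2)[OF f x] has_ac_derivative_integral(2)[OF g x] by (simp add: algebra_simps)
  next
    have "0 + (f l * g' x + (g l * f' x + (f' x * ?G x + ?F x * g' x))) = f' x * g x + f x * g' x" if x: "x \<ge> l" for x
      unfolding has_ac_derivative_integral(2)[OF f x] has_ac_derivative_integral(2)[OF g x] by (simp add: algebra_simps)
    then show "AE x in lebesgue. x \<ge> l \<longrightarrow> 0 + (f l * g' x + (g l * f' x + (f' x * ?G x + ?F x * g' x))) = f' x * g x + f x * g' x"
      by simp
  qed
qed

text \<open>By Lebesgue differentiation: an integrable function whose indefinite integral vanishes is zero
almost everywhere.\<close>

lemma has_ac_derivative_unique:
  assumes "has_ac_derivative l f g" "has_ac_derivative l f g'"
  shows "AE x in lebesgue. x \<ge> l \<longrightarrow> g x = g' x"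
proof -
  define h where "h = (\<lambda>x. if x \<in> {l..} then g x - g' x else 0)"
  have d: "has_ac_derivative l (\<lambda>x. f x - f x) (\<lambda>x. g x - g' x)"
    by (rule has_ac_derivative_diff[OF assms])
  have z: "integral {l..x} (\<lambda>x. g x - g' x) = 0" if "l \<le> x" for x
    using has_ac_derivative_integral(2)[OF d that] by simp
  have i: "(\<lambda>x. g x - g' x) integrable_on {l..b}" for b
    by (rule set_lebesgue_integral_eq_integral(1)[OF has_ac_derivative_integral(1)[OF d]])
  have hi: "h integrable_on cbox a b" for a b
  proof -
    have "(\<lambda>x. if x \<in> {l..b} then g x - g' x else 0) integrable_on {min a l..b}"
      by (rule integrable_on_superset[OF integrable_eq[OF i[of b]]]) auto
    then have "(\<lambda>x. if x \<in> {l..b} then g x - g' x else 0) integrable_on {a..b}"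
      by (rule integrable_on_subinterval) auto
    then show ?thesis
      using integrable_cong[of "{a..b}" "\<lambda>x. if x \<in> {l..b} then g x - g' x else 0" h] by (simp add: h_def)
  qed
  \<comment> \<open>outside a null set, the value of h is the limit of its averages over \<open>[x, x + t]\<close>\<close>
  obtain N where N: "negligible N"
    "\<And>x e. \<lbrakk>x \<notin> N; 0 < e\<rbrakk> \<Longrightarrow> \<exists>d>0. \<forall>t. 0 < t \<and> t < d \<longrightarrow>
       norm (integral (cbox x (x + t *\<^sub>R One)) h /\<^sub>R t ^ DIM(real) - h x) < e"
    using integrable_ccontinuous_explicit[of h, OF hi] by blast
  have 0: "h x = 0" if xN: "x \<notin> N" and xl: "x \<ge> l" for x
  proof (rule ccontr)
    assume "h x \<noteq> 0"
    then obtain d where d: "d > 0" "\<And>t. 0 < t \<Longrightarrow> t < d \<Longrightarrow>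
       norm (integral (cbox x (x + t *\<^sub>R One)) h /\<^sub>R t ^ DIM(real) - h x) < norm (h x)"
      using N(2)[OF xN, of "norm (h x)"] by auto
    have "integral {x..x + d/2} h = integral {x..x+d/2} (\<lambda>x. g x - g' x)"
      by (rule Henstock_Kurzweil_Integration.integral_cong) (use xl in \<open>auto simp: h_def\<close>)
    also have "\<dots> = 0"
      using Henstock_Kurzweil_Integration.integral_combine[of l x "x+d/2" "\<lambda>x. g x - g' x"] i[of "x+d/2"] z[of x] z[of "x+d/2"] xl d(1)
      by simp
    finally show False using d(2)[of "d/2"] d(1) by simp
  qed
  show ?thesis
    unfolding eventually_ae_filter_negligible
    by (rule exI[of _ N]) (use N(1) 0 in \<open>auto simp: h_def\<close>)
qed

lemma has_ac_derivative_vector_derivative: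
  assumes f: "has_ac_derivative l f g" and g: "continuous_on {l..} g" and x: "x \<ge> l"
  shows "(f has_vector_derivative g x) (at x within {l..})" "D1 l f x = g x"
proof -
  have "((\<lambda>u. f l + integral {l..u} g) has_vector_derivative g x) (at x within {l..x+1})"
    using has_vector_derivative_add[OF has_vector_derivative_const integral_has_vector_derivative[of l "x+1" g x]]
      continuous_on_subset[OF g, of "{l..x+1}"] x by auto
  then have "(f has_vector_derivative g x) (at x within {l..x+1})"
    by (rule has_vector_derivative_transform[rotated 2])
       (use x has_ac_derivative_integral(2)[OF f, symmetric] in auto)
  then show 1: "(f has_vector_derivative g x) (at x within {l..})"
    using half_line_at_within[of l x "x+1"] x by simp
  show "D1 l f x = g x"
    unfolding D1_def by (rule vector_derivative_within[OF half_line_nontrivial[OF x] 1])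
qed

section \<open>The Sturm-Liouville equation as a first-order system\<close>

text \<open>The equation \<open>- y'' + q y = f\<close> with the derivative \<open>y1\<close> carried along as a second unknown. Unlike
\<open>diff_expr\<close>, which goes through a choice of almost-everywhere derivative, this is stable under
algebraic operations on the nose.\<close>

definition sturm_liouville ::
  "real \<Rightarrow> (real \<Rightarrow> real) \<Rightarrow> (real \<Rightarrow> complex) \<Rightarrow> (real \<Rightarrow> complex) \<Rightarrow> (real \<Rightarrow> complex) \<Rightarrow> bool" where
  "sturm_liouville l q y y1 f \<longleftrightarrow>
     has_ac_derivative l y y1 \<and> has_ac_derivative l y1 (\<lambda>x. of_real (q x) * y x - f x)"

lemma sturm_liouvilleD:
  assumes "sturm_liouville l q y y1 f"
  shows "has_ac_derivative l y y1" "has_ac_derivative l y1 (\<lambda>x. of_real (q x) * y x - f x)"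
    "continuous_on {l..} y" "continuous_on {l..} y1"
  using assms has_ac_derivative_continuous by (auto simp: sturm_liouville_def)

lemma sturm_liouville_cong:
  assumes "sturm_liouville l q y y1 f" "\<And>x. x \<ge> l \<Longrightarrow> y x = z x" "\<And>x. x \<ge> l \<Longrightarrow> y1 x = z1 x"
    "AE x in lebesgue. x \<ge> l \<longrightarrow> f x = g x"
  shows "sturm_liouville l q z z1 g"
  unfolding sturm_liouville_def
proof
  show "has_ac_derivative l z z1"
    by (rule has_ac_derivative_cong[OF sturm_liouvilleD(1)[OF assms(1)]]) (use assms(2,3) in auto)
  show "has_ac_derivative l z1 (\<lambda>x. of_real (q x) * z x - g x)"
    by (rule has_ac_derivative_cong[OF sturm_liouvilleD(2)[OF assms(1)]]) (use assms in auto)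
qed

lemma sturm_liouville_add:
  assumes "sturm_liouville l q y y1 f" "sturm_liouville l q z z1 g"
  shows "sturm_liouville l q (\<lambda>x. y x + z x) (\<lambda>x. y1 x + z1 x) (\<lambda>x. f x + g x)"
  using has_ac_derivative_add[OF sturm_liouvilleD(1)[OF assms(1)] sturm_liouvilleD(1)[OF assms(2)]]
    has_ac_derivative_add[OF sturm_liouvilleD(2)[OF assms(1)] sturm_liouvilleD(2)[OF assms(2)]]
  by (simp add: sturm_liouville_def algebra_simps)

lemma sturm_liouville_cmult:
  assumes "sturm_liouville l q y y1 f"
  shows "sturm_liouville l q (\<lambda>x. c * y x) (\<lambda>x. c * y1 x) (\<lambda>x. c * f x)"
  using has_ac_derivative_cmult[OF sturm_liouvilleD(1)[OF assms], of c]
    has_ac_derivative_cmult[OF sturm_liouvilleD(2)[OF assms], of c]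
  by (simp add: sturm_liouville_def algebra_simps)

lemma sturm_liouville_cnj:
  assumes "sturm_liouville l q y y1 f"
  shows "sturm_liouville l q (\<lambda>x. cnj (y x)) (\<lambda>x. cnj (y1 x)) (\<lambda>x. cnj (f x))"
  using has_ac_derivative_cnj[OF sturm_liouvilleD(1)[OF assms]]
    has_ac_derivative_cnj[OF sturm_liouvilleD(2)[OF assms]]
  by (simp add: sturm_liouville_def)

text \<open>Lagrange's identity. The potential cancels, so the Wronskian has an integrable derivative even
though \<open>q y z\<close> need not be integrable at infinity.\<close>

lemma sturm_liouville_wronskian:
  assumes "sturm_liouville l q y y1 f" "sturm_liouville l q z z1 g"
  shows "has_ac_derivative l (\<lambda>x. y x * z1 x - y1 x * z x) (\<lambda>x. f x * z x - y x * g x)"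
  using has_ac_derivative_diff[OF has_ac_derivative_mult[OF sturm_liouvilleD(1)[OF assms(1)] sturm_liouvilleD(2)[OF assms(2)]]
      has_ac_derivative_mult[OF sturm_liouvilleD(2)[OF assms(1)] sturm_liouvilleD(1)[OF assms(2)]]]
  by (simp add: algebra_simps)

lemma AC2_imp_sturm_liouville:
  assumes "AC2 l y"
  shows "sturm_liouville l q y (D1 l y) (diff_expr l q y)"
proof -
  have ac: "has_ac_derivative l (D1 l y) (ac_derivative l (D1 l y))"
    unfolding ac_derivative_def by (rule someI_ex[where P="has_ac_derivative l (D1 l y)"]) (use assms in \<open>auto simp: AC2_def locally_AC_def\<close>)
  have cont: "continuous_on {l..} (D1 l y)" by (rule has_ac_derivative_continuous[OF ac])
  have vd: "(y has_vector_derivative D1 l y x) (at x within {l..})" if "x \<ge> l" for x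
    using assms that unfolding AC2_def D1_def by (simp add: vector_derivative_works)
  have "has_ac_derivative l y (D1 l y)"
  proof (rule has_ac_derivativeI)
    show "D1 l y absolutely_integrable_on {l..b}" for b
      by (intro absolutely_integrable_continuous_real continuous_on_subset[OF cont]) auto
    fix x assume "x \<ge> l"
    have "(D1 l y has_integral (y x - y l)) {l..x}"
      by (rule fundamental_theorem_of_calculus[OF \<open>x \<ge> l\<close> has_vector_derivative_within_subset[OF vd]]) auto
    then show "y x = y l + integral {l..x} (D1 l y)"
      by (simp add: integral_unique)
  qed
  with ac show ?thesis
    by (simp add: sturm_liouville_def diff_expr_def)
qed

lemma sturm_liouville_imp_AC2:
  assumes sl: "sturm_liouville l q y y1 f"
  shows "AC2 l y" "x \<ge> l \<Longrightarrow> D1 l y x = y1 x" "AE x in lebesgue. x \<ge> l \<longrightarrow> diff_expr l q y x = f x"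
proof -
  note vd = has_ac_derivative_vector_derivative[OF sturm_liouvilleD(1)[OF sl] sturm_liouvilleD(4)[OF sl]]
  show D: "x \<ge> l \<Longrightarrow> D1 l y x = y1 x" for x by (rule vd(2))
  have 1: "has_ac_derivative l (D1 l y) (\<lambda>x. of_real (q x) * y x - f x)"
    by (rule has_ac_derivative_cong[OF sturm_liouvilleD(2)[OF sl]]) (simp_all add: D)
  show AC2: "AC2 l y"
    unfolding AC2_def locally_AC_def
    using 1 sturm_liouvilleD(1)[OF sl] differentiableI_vector[OF vd(1)] by blast
  have "has_ac_derivative l (D1 l y) (\<lambda>x. of_real (q x) * y x - diff_expr l q y x)"
    by (rule sturm_liouvilleD(2)[OF AC2_imp_sturm_liouville[OF AC2]])
  from has_ac_derivative_unique[OF 1 this]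
  show "AE x in lebesgue. x \<ge> l \<longrightarrow> diff_expr l q y x = f x"
    by eventually_elim simp
qed

section \<open>Square integrable functions\<close>

abbreviation half_line :: "real \<Rightarrow> real measure" where
  "half_line l \<equiv> lebesgue_on {l..}"

lemma AE_half_line: "(AE x in half_line l. P x) \<longleftrightarrow> (AE x in lebesgue. x \<ge> l \<longrightarrow> P x)"
  by (subst AE_restrict_space_iff) auto

lemma L2_iff:
  "f \<in> L2 l \<longleftrightarrow> f \<in> borel_measurable (half_line l) \<and> integrable (half_line l) (\<lambda>x. (cmod (f x))\<^sup>2)"
  by (auto simp: L2_def set_borel_measurable_def set_integrable_def integrable_restrict_space
      borel_measurable_restrict_space_iff)

lemma inner_L2_eq: "inner_L2 l f g = (LINT x|half_line l. f x * cnj (g x))"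
  by (simp add: inner_L2_def set_lebesgue_integral_def integral_restrict_space)

lemma L2_measurable: "f \<in> L2 l \<Longrightarrow> f \<in> borel_measurable (half_line l)"
  by (simp add: L2_iff)

lemma L2_mult_integrable:
  assumes "f \<in> L2 l" "g \<in> L2 l"
  shows "integrable (half_line l) (\<lambda>x. f x * g x)"
proof (rule Bochner_Integration.integrable_bound)
  show "integrable (half_line l) (\<lambda>x. (cmod (f x))\<^sup>2 + (cmod (g x))\<^sup>2)"
    using assms by (simp add: L2_iff)
  show "(\<lambda>x. f x * g x) \<in> borel_measurable (half_line l)"
    by (intro borel_measurable_times L2_measurable assms)
  have "cmod (f x) * cmod (g x) \<le> (cmod (f x))\<^sup>2 + (cmod (g x))\<^sup>2" for x
    using sum_squares_bound[of "cmod (f x)" "cmod (g x)"] mult_nonneg_nonneg[OF norm_ge_zero[of "f x"] norm_ge_zero[of "g x"]]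
    by linarith
  then show "AE x in half_line l. norm (f x * g x) \<le> norm ((cmod (f x))\<^sup>2 + (cmod (g x))\<^sup>2)"
    by (intro AE_I2) (simp add: norm_mult)
qed

lemma L2_cnj [simp]: "(\<lambda>x. cnj (f x)) \<in> L2 l \<longleftrightarrow> f \<in> L2 l"
proof -
  have *: "(\<lambda>x. cnj (f x)) \<in> borel_measurable (half_line l)" if "f \<in> borel_measurable (half_line l)" for f
    using that by (rule borel_measurable_continuous_on[OF continuous_on_cnj[OF continuous_on_id]])
  show ?thesis
  proof
    assume "f \<in> L2 l"
    then show "(\<lambda>x. cnj (f x)) \<in> L2 l"
      using *[OF L2_measurable] by (simp add: L2_iff)
  next
    assume "(\<lambda>x. cnj (f x)) \<in> L2 l"
    moreover from this have "(\<lambda>x. cnj (cnj (f x))) \<in> borel_measurable (half_line l)"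
      by (rule *[OF L2_measurable])
    ultimately show "f \<in> L2 l"
      by (simp add: L2_iff)
  qed
qed

lemma L2_cmult: "f \<in> L2 l \<Longrightarrow> (\<lambda>x. c * f x) \<in> L2 l"
  using borel_measurable_times[OF borel_measurable_const[of c] L2_measurable[of f l]]
  by (simp add: L2_iff norm_mult power_mult_distrib)

lemma L2_add:
  assumes "f \<in> L2 l" "g \<in> L2 l"
  shows "(\<lambda>x. f x + g x) \<in> L2 l"
proof -
  have "integrable (half_line l) (\<lambda>x. (cmod (f x + g x))\<^sup>2)"
  proof (rule Bochner_Integration.integrable_bound)
    show "integrable (half_line l) (\<lambda>x. 2 * (cmod (f x))\<^sup>2 + 2 * (cmod (g x))\<^sup>2)"
      using assms by (simp add: L2_iff)
    show "(\<lambda>x. (cmod (f x + g x))\<^sup>2) \<in> borel_measurable (half_line l)"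
      by (intro borel_measurable_power measurable_compose[OF _ borel_measurable_norm] borel_measurable_add L2_measurable assms)
    have "(cmod (f x + g x))\<^sup>2 \<le> 2 * (cmod (f x))\<^sup>2 + 2 * (cmod (g x))\<^sup>2" for x
    proof -
      have "(cmod (f x + g x))\<^sup>2 \<le> (cmod (f x) + cmod (g x))\<^sup>2"
        by (simp add: norm_triangle_ineq power_mono)
      also have "\<dots> \<le> 2 * (cmod (f x))\<^sup>2 + 2 * (cmod (g x))\<^sup>2"
        using sum_squares_bound[of "cmod (f x)" "cmod (g x)"] by (simp add: power2_sum)
      finally show ?thesis .
    qed
    then show "AE x in half_line l. norm ((cmod (f x + g x))\<^sup>2) \<le> norm (2 * (cmod (f x))\<^sup>2 + 2 * (cmod (g x))\<^sup>2)"
      by (intro AE_I2) simp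
  qed
  then show ?thesis
    using borel_measurable_add[OF L2_measurable[OF assms(1)] L2_measurable[OF assms(2)]] by (simp add: L2_iff)
qed

lemma L2_diff: "f \<in> L2 l \<Longrightarrow> g \<in> L2 l \<Longrightarrow> (\<lambda>x. f x - g x) \<in> L2 l"
  using L2_add[OF _ L2_cmult[of g l "-1"], of f] by simp

lemma measurable_cong_AE_half_line:
  fixes f g :: "real \<Rightarrow> complex"
  assumes "f \<in> borel_measurable (half_line l)" "AE x in half_line l. f x = g x"
  shows "g \<in> borel_measurable (half_line l)"
proof -
  obtain N where N: "negligible N" "{x. \<not> (x \<ge> l \<longrightarrow> f x = g x)} \<subseteq> N"
    using assms(2) by (auto simp: eventually_ae_filter_negligible AE_half_line)
  show ?thesis
    using measurable_on_spike[of f "{l..}" N g] assms(1) N(1) subsetD[OF N(2)]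
    by (force simp: measurable_on_iff_borel_measurable)
qed

lemma L2_cong_AE:
  assumes "f \<in> L2 l" "AE x in half_line l. f x = g x"
  shows "g \<in> L2 l"
proof -
  have m: "g \<in> borel_measurable (half_line l)"
    using measurable_cong_AE_half_line[of f l g] assms by (auto simp: L2_iff)
  have ae: "AE x in half_line l. (cmod (f x))\<^sup>2 = (cmod (g x))\<^sup>2"
    using assms(2) by eventually_elim simp
  have mf: "(\<lambda>x. (cmod (f x))\<^sup>2) \<in> borel_measurable (half_line l)" and mg: "(\<lambda>x. (cmod (g x))\<^sup>2) \<in> borel_measurable (half_line l)"
    by (intro borel_measurable_power measurable_compose[OF _ borel_measurable_norm] m L2_measurable[OF assms(1)])+
  from integrable_cong_AE[OF mf mg ae] m show ?thesis
    using assms(1) by (simp add: L2_iff)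
qed

definition norm_sq :: "real \<Rightarrow> (real \<Rightarrow> complex) \<Rightarrow> real" where
  "norm_sq l f = (LINT x|half_line l. (cmod (f x))\<^sup>2)"

lemma norm_sq_nonneg: "0 \<le> norm_sq l f"
  unfolding norm_sq_def by (rule Bochner_Integration.integral_nonneg) simp

lemma norm_sq_cnj [simp]: "norm_sq l (\<lambda>x. cnj (f x)) = norm_sq l f"
  by (simp add: norm_sq_def)

text \<open>The discriminant of \<open>t \<mapsto> \<parallel>|f| + t |g|\<parallel>\<^sup>2\<close> is not positive. The bilinear form without conjugate
is what Wronskians produce.\<close>

lemma L2_Cauchy_Schwarz:
  assumes "f \<in> L2 l" "g \<in> L2 l"
  shows "(cmod (LINT x|half_line l. f x * g x))\<^sup>2 \<le> norm_sq l f * norm_sq l g"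
proof -
  let ?I = "LINT x|half_line l. cmod (f x) * cmod (g x)"
  have fi: "integrable (half_line l) (\<lambda>x. (cmod (f x))\<^sup>2)" and gi: "integrable (half_line l) (\<lambda>x. (cmod (g x))\<^sup>2)"
    using assms by (auto simp: L2_iff)
  have fg: "integrable (half_line l) (\<lambda>x. cmod (f x) * cmod (g x))"
    using integrable_norm[OF L2_mult_integrable[OF assms]] by (simp add: norm_mult)
  have quad: "0 \<le> norm_sq l f + 2 * t * ?I + t\<^sup>2 * norm_sq l g" for t :: real
  proof -
    have "0 \<le> (LINT x|half_line l. (cmod (f x) + t * cmod (g x))\<^sup>2)"
      by (rule Bochner_Integration.integral_nonneg) simp
    also have "(\<lambda>x. (cmod (f x) + t * cmod (g x))\<^sup>2) =
        (\<lambda>x. (cmod (f x))\<^sup>2 + 2 * t * (cmod (f x) * cmod (g x)) + t\<^sup>2 * (cmod (g x))\<^sup>2)"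
      by (auto simp: power2_eq_square algebra_simps)
    finally show ?thesis
      using fi gi fg by (simp add: norm_sq_def)
  qed
  have I2: "?I\<^sup>2 \<le> norm_sq l f * norm_sq l g"
  proof (cases "norm_sq l g = 0")
    case True
    have "?I = 0"
    proof (rule ccontr)
      assume "?I \<noteq> 0"
      then show False using quad[of "- (norm_sq l f + 1) / (2 * ?I)"] True by (simp add: field_simps)
    qed
    then show ?thesis using True by simp
  next
    case False
    then have pos: "norm_sq l g > 0" using norm_sq_nonneg[of l g] by simp
    have "0 \<le> norm_sq l f - ?I\<^sup>2 / norm_sq l g"
      using quad[of "- ?I / norm_sq l g"] pos by (simp add: power2_eq_square field_simps)
    then show ?thesis using pos by (simp add: field_simps)
  qed
  have "cmod (LINT x|half_line l. f x * g x) \<le> ?I"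
    using integral_norm_bound[of "half_line l" "\<lambda>x. f x * g x"] by (simp add: norm_mult)
  then have "(cmod (LINT x|half_line l. f x * g x))\<^sup>2 \<le> ?I\<^sup>2"
    by (rule power_mono) simp
  with I2 show ?thesis by (rule order_trans[rotated])
qed

lemma integrable_half_line_Icc:
  fixes h :: "real \<Rightarrow> 'a::euclidean_space"
  assumes "integrable (half_line l) h"
  shows "h absolutely_integrable_on {l..b}"
proof -
  have "h absolutely_integrable_on {l..}"
    using assms by (simp add: set_integrable_def integrable_restrict_space)
  then show ?thesis by (rule set_integrable_subset) auto
qed

lemma half_line_integral_limit:
  fixes h :: "real \<Rightarrow> 'a::euclidean_space"
  assumes "integrable (half_line l) h"
  shows "((\<lambda>b. integral {l..b} h) \<longlongrightarrow> (LINT x|half_line l. h x)) at_top"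
proof -
  have "h absolutely_integrable_on {l..}"
    using assms by (simp add: set_integrable_def integrable_restrict_space)
  then have "((\<lambda>b. LINT x:{l..b}|lebesgue. h x) \<longlongrightarrow> (LINT x:{l..}|lebesgue. h x)) at_top"
    by (intro tendsto_set_lebesgue_integral_at_top) auto
  then show ?thesis
    using set_lebesgue_integral_eq_integral(2)[OF integrable_half_line_Icc[OF assms]]
    by (simp add: set_lebesgue_integral_def integral_restrict_space)
qed

lemma has_ac_derivative_limit:
  assumes "has_ac_derivative l W w" "integrable (half_line l) w"
  shows "(W \<longlongrightarrow> W l + (LINT x|half_line l. w x)) at_top"
proof -
  have "((\<lambda>b. W l + integral {l..b} w) \<longlongrightarrow> W l + (LINT x|half_line l. w x)) at_top"
    by (intro tendsto_intros half_line_integral_limit assms)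
  moreover have "eventually (\<lambda>b. W l + integral {l..b} w = W b) at_top"
    using eventually_ge_at_top[of l] by eventually_elim (rule has_ac_derivative_integral(2)[OF assms(1), symmetric])
  ultimately show ?thesis
    by (rule Lim_transform_eventually)
qed

lemma continuous_measurable_half_line:
  fixes h :: "real \<Rightarrow> complex"
  shows "continuous_on {l..} h \<Longrightarrow> h \<in> borel_measurable (half_line l)"
  by (rule continuous_imp_measurable_on_sets_lebesgue) auto

text \<open>The right-hand sides of the equation are only square integrable; on a compact interval
\<open>|F| \<le> 1 + |F|\<^sup>2\<close> makes them integrable.\<close>

lemma L2_imp_locally_integrable:
  assumes "F \<in> L2 l" "continuous_on {l..} h"
  shows "(\<lambda>x. h x * F x) absolutely_integrable_on {l..b}"
proof -
  have bdd: "bounded (h ` {l..b})"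
    by (intro compact_imp_bounded compact_continuous_image continuous_on_subset[OF assms(2)]) auto
  have m: "h \<in> borel_measurable (lebesgue_on {l..b})"
    by (intro continuous_imp_measurable_on_sets_lebesgue continuous_on_subset[OF assms(2)]) auto
  have mF: "F \<in> borel_measurable (lebesgue_on {l..b})"
    using L2_measurable[OF assms(1)] by (rule measurable_restrict_mono) auto 
  have "F absolutely_integrable_on {l..b}"
  proof (rule measurable_bounded_by_integrable_imp_absolutely_integrable[OF mF])
    show "(\<lambda>x. 1 + (cmod (F x))\<^sup>2) integrable_on {l..b}"
      using integrable_half_line_Icc[of l "\<lambda>x. (cmod (F x))\<^sup>2" b] assms(1)
      by (intro Henstock_Kurzweil_Integration.integrable_add set_lebesgue_integral_eq_integral(1)) (auto simp: L2_iff)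
    show "norm (F x) \<le> 1 + (cmod (F x))\<^sup>2" for x
    proof -
      have "2 * cmod (F x) \<le> 1 + (cmod (F x))\<^sup>2"
        using sum_squares_bound[of 1 "cmod (F x)"] by simp
      then show ?thesis using norm_ge_zero[of "F x"] by linarith
    qed
  qed simp
  from absolutely_integrable_bounded_measurable_product[OF bilinear_times m _ bdd this]
  show ?thesis by simp
qed

lemma continuous_compact_support_L2:
  assumes "continuous_on {l..} h" "\<And>x. x \<ge> n \<Longrightarrow> h x = 0"
  shows "h \<in> L2 l"
proof -
  have m: "h \<in> borel_measurable (half_line l)"
    by (rule continuous_measurable_half_line[OF assms(1)])
  have "(\<lambda>x. (cmod (h x))\<^sup>2) absolutely_integrable_on {l..n}"
    by (intro absolutely_integrable_continuous_real continuous_intros continuous_on_subset[OF assms(1)]) auto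
  then have "integrable lebesgue (\<lambda>x. indicator {l..n} x *\<^sub>R (cmod (h x))\<^sup>2)"
    by (simp add: set_integrable_def)
  moreover have "(\<lambda>x. indicator {l..n} x *\<^sub>R (cmod (h x))\<^sup>2) = (\<lambda>x. indicator {l..} x *\<^sub>R (cmod (h x))\<^sup>2)"
    using assms(2) by (auto simp: indicator_def fun_eq_iff)
  ultimately have "integrable (half_line l) (\<lambda>x. (cmod (h x))\<^sup>2)"
    by (simp add: integrable_restrict_space)
  with m show ?thesis by (simp add: L2_iff)
qed

lemma L2_mult_indicator:
  assumes "f \<in> L2 l" "A \<in> sets lebesgue"
  shows "(\<lambda>x. indicator A x *\<^sub>R f x) \<in> L2 l" "norm_sq l (\<lambda>x. indicator A x *\<^sub>R f x) \<le> norm_sq l f"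
proof -
  have A: "(\<lambda>x. indicator A x :: real) \<in> borel_measurable (half_line l)"
    by (rule measurable_restrict_space1) (use assms(2) in simp)
  have m: "(\<lambda>x. indicator A x *\<^sub>R f x) \<in> borel_measurable (half_line l)"
    by (intro borel_measurable_scaleR A L2_measurable assms)
  have m2: "(\<lambda>x. (cmod (indicator A x *\<^sub>R f x))\<^sup>2) \<in> borel_measurable (half_line l)"
    by (intro borel_measurable_power measurable_compose[OF _ borel_measurable_norm] m)
  have i: "integrable (half_line l) (\<lambda>x. (cmod (indicator A x *\<^sub>R f x))\<^sup>2)"
    by (rule Bochner_Integration.integrable_bound[OF _ m2, where f="\<lambda>x. (cmod (f x))\<^sup>2"])
       (use assms(1) in \<open>auto simp: L2_iff indicator_def\<close>)
  with m show "(\<lambda>x. indicator A x *\<^sub>R f x) \<in> L2 l" by (simp add: L2_iff)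
  show "norm_sq l (\<lambda>x. indicator A x *\<^sub>R f x) \<le> norm_sq l f"
    unfolding norm_sq_def by (rule integral_mono) (use i assms(1) in \<open>auto simp: L2_iff indicator_def\<close>)
qed

lemma norm_sq_tail:
  assumes "f \<in> L2 l" and r: "filterlim r at_top sequentially"
  shows "(\<lambda>n. norm_sq l (\<lambda>x. indicator {r n<..} x *\<^sub>R f x)) \<longlonglongrightarrow> 0"
proof -
  have "(\<lambda>n. LINT x|half_line l. (cmod (indicator {r n<..} x *\<^sub>R f x))\<^sup>2) \<longlonglongrightarrow> (LINT x|half_line l. 0)"
  proof (rule integral_dominated_convergence[where w="\<lambda>x. (cmod (f x))\<^sup>2"])
    show "(\<lambda>x. (cmod (indicator {r n<..} x *\<^sub>R f x))\<^sup>2) \<in> borel_measurable (half_line l)" for n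
      using L2_mult_indicator(1)[OF assms(1), of "{r n<..}"]
      by (intro borel_measurable_power measurable_compose[OF _ borel_measurable_norm] L2_measurable) simp
    show "AE x in half_line l. (\<lambda>n. (cmod (indicator {r n<..} x *\<^sub>R f x))\<^sup>2) \<longlonglongrightarrow> 0"
    proof (rule AE_I2)
      fix x :: real
      have "eventually (\<lambda>n. x \<le> r n) sequentially"
        using r by (simp add: filterlim_at_top)
      then have "eventually (\<lambda>n. 0 = (cmod (indicator {r n<..} x *\<^sub>R f x))\<^sup>2) sequentially"
        by eventually_elim simp
      then show "(\<lambda>n. (cmod (indicator {r n<..} x *\<^sub>R f x))\<^sup>2) \<longlonglongrightarrow> 0"
        by (rule Lim_transform_eventually[OF tendsto_const])
    qed
  qed (use assms(1) in \<open>auto simp: L2_iff indicator_def\<close>)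
  then show ?thesis by (simp add: norm_sq_def)
qed

text \<open>For solutions of the inhomogeneous equation, which are obtained as pointwise limits.\<close>

lemma L2_Fatou:
  assumes u: "\<And>n. u n \<in> L2 l" "\<And>n::nat. norm_sq l (u n) \<le> C"
    and lim: "\<And>x. x \<ge> l \<Longrightarrow> (\<lambda>n. u n x) \<longlonglongrightarrow> v x" and v: "v \<in> borel_measurable (half_line l)"
  shows "v \<in> L2 l" "norm_sq l v \<le> C"
proof -
  have um: "(\<lambda>x. ennreal ((cmod (u n x))\<^sup>2)) \<in> borel_measurable (half_line l)" for n
    by (intro measurable_compose[OF _ measurable_ennreal] borel_measurable_power measurable_compose[OF _ borel_measurable_norm] L2_measurable u)
  have vm: "(\<lambda>x. (cmod (v x))\<^sup>2) \<in> borel_measurable (half_line l)"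
    by (intro borel_measurable_power measurable_compose[OF _ borel_measurable_norm] v)
  have C: "0 \<le> C" using norm_sq_nonneg[of l "u 0"] u(2)[of 0] by linarith
  have "(\<integral>\<^sup>+x. ennreal ((cmod (v x))\<^sup>2) \<partial>half_line l) = (\<integral>\<^sup>+x. liminf (\<lambda>n. ennreal ((cmod (u n x))\<^sup>2)) \<partial>half_line l)"
  proof (rule nn_integral_cong)
    fix x assume "x \<in> space (half_line l)"
    then have "(\<lambda>n. ennreal ((cmod (u n x))\<^sup>2)) \<longlonglongrightarrow> ennreal ((cmod (v x))\<^sup>2)"
      by (intro tendsto_intros lim) auto
    then show "ennreal ((cmod (v x))\<^sup>2) = liminf (\<lambda>n. ennreal ((cmod (u n x))\<^sup>2))"
      by (rule lim_imp_Liminf[OF trivial_limit_sequentially, symmetric])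
  qed
  also have "\<dots> \<le> liminf (\<lambda>n. \<integral>\<^sup>+x. ennreal ((cmod (u n x))\<^sup>2) \<partial>half_line l)"
    by (rule nn_integral_liminf[OF um])
  also have "\<dots> \<le> liminf (\<lambda>n::nat. ennreal C)"
  proof (rule Liminf_mono[OF always_eventually], rule allI)
    fix n
    have "(\<integral>\<^sup>+x. ennreal ((cmod (u n x))\<^sup>2) \<partial>half_line l) = ennreal (norm_sq l (u n))"
      unfolding norm_sq_def by (rule nn_integral_eq_integral) (use u(1)[of n] in \<open>auto simp: L2_iff\<close>)
    then show "(\<integral>\<^sup>+x. ennreal ((cmod (u n x))\<^sup>2) \<partial>half_line l) \<le> ennreal C"
      using u(2)[of n] by (simp add: ennreal_leI)
  qed
  also have "\<dots> = ennreal C" by (simp add: Liminf_const)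
  finally have le: "(\<integral>\<^sup>+x. ennreal ((cmod (v x))\<^sup>2) \<partial>half_line l) \<le> ennreal C" .
  have int: "integrable (half_line l) (\<lambda>x. (cmod (v x))\<^sup>2)"
    by (rule integrableI_bounded[OF vm]) (use le in \<open>auto intro: le_less_trans\<close>)
  then show "v \<in> L2 l" using v by (simp add: L2_iff)
  show "norm_sq l v \<le> C"
    using le nn_integral_eq_integral[OF int] C by (simp add: norm_sq_def)
qed

section \<open>The maximal domain\<close>

lemma DstarD:
  assumes "y \<in> Dstar l q"
  shows "sturm_liouville l q y (D1 l y) (diff_expr l q y)" "y \<in> L2 l" "diff_expr l q y \<in> L2 l" "x < l \<Longrightarrow> y x = 0"
  using assms AC2_imp_sturm_liouville by (auto simp: Dstar_def)

lemma DstarI: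
  assumes "sturm_liouville l q y y1 f" "y \<in> L2 l" "f \<in> L2 l" "\<And>x. x < l \<Longrightarrow> y x = 0"
  shows "y \<in> Dstar l q" 
proof -
  have "diff_expr l q y \<in> L2 l"
  proof (rule L2_cong_AE[OF assms(3)])
    show "AE x in half_line l. f x = diff_expr l q y x"
      using sturm_liouville_imp_AC2(3)[OF assms(1)] unfolding AE_half_line by eventually_elim simp
  qed
  with assms sturm_liouville_imp_AC2(1)[OF assms(1)] show ?thesis by (simp add: Dstar_def)
qed

section \<open>The boundary form of the defect element at infinity\<close>

text \<open>By monotone convergence: bounded partial energies would make the function square integrable.\<close>

lemma not_L2_unbounded:
  assumes c: "continuous_on {l..} h" and n: "h \<notin> L2 l"
  shows "\<exists>b\<ge>l. \<forall>x\<ge>b. integral {l..x} (\<lambda>t. (cmod (h t))\<^sup>2) > K"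
proof (rule ccontr)
  assume no: "\<not> ?thesis"
  have ai: "(\<lambda>t. (cmod (h t))\<^sup>2) absolutely_integrable_on {l..x}" for x
    by (intro absolutely_integrable_continuous_real continuous_intros continuous_on_subset[OF c]) auto
  have mono: "integral {l..x} (\<lambda>t. (cmod (h t))\<^sup>2) \<le> integral {l..y} (\<lambda>t. (cmod (h t))\<^sup>2)" if "x \<le> y" for x y
    by (rule integral_subset_le) (use that set_lebesgue_integral_eq_integral(1)[OF ai] in auto)
  have bd: "integral {l..x} (\<lambda>t. (cmod (h t))\<^sup>2) \<le> K" for x
  proof -
    from no obtain y where "y \<ge> max l x" "integral {l..y} (\<lambda>t. (cmod (h t))\<^sup>2) \<le> K"
      by (meson max.cobounded1 not_less)
    then show ?thesis using mono[of x y] by simp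
  qed
  let ?f = "\<lambda>n x. indicator {..l + real n} x *\<^sub>R (cmod (h x))\<^sup>2"
  have m: "h \<in> borel_measurable (half_line l)"
    by (rule continuous_measurable_half_line[OF c])
  have m2: "(\<lambda>x. (cmod (h x))\<^sup>2) \<in> borel_measurable (half_line l)"
    by (intro borel_measurable_power measurable_compose[OF _ borel_measurable_norm] m)
  have fi: "integrable (half_line l) (?f n)" "(LINT x|half_line l. ?f n x) = integral {l..l + real n} (\<lambda>t. (cmod (h t))\<^sup>2)" for n
  proof -
    have e: "(\<lambda>x. indicator {l..} x *\<^sub>R ?f n x) = (\<lambda>x. indicator {l..l + real n} x *\<^sub>R (cmod (h x))\<^sup>2)"
      by (auto simp: indicator_def fun_eq_iff)
    show "integrable (half_line l) (?f n)"
      using ai[of "l + real n"] integrable_restrict_space[of "{l..}" lebesgue "?f n"]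
      unfolding set_integrable_def e by simp
    show "(LINT x|half_line l. ?f n x) = integral {l..l + real n} (\<lambda>t. (cmod (h t))\<^sup>2)"
      using set_lebesgue_integral_eq_integral(2)[OF ai[of "l + real n"]] integral_restrict_space[of "{l..}" lebesgue "?f n"]
      unfolding set_lebesgue_integral_def e by simp
  qed
  have "incseq (\<lambda>n. integral {l..l + real n} (\<lambda>t. (cmod (h t))\<^sup>2))"
    by (rule monoI) (rule mono, simp)
  then obtain L where L: "(\<lambda>n. integral {l..l + real n} (\<lambda>t. (cmod (h t))\<^sup>2)) \<longlonglongrightarrow> L"
    using incseq_convergent[of _ K] bd by blast
  have "integrable (half_line l) (\<lambda>x. (cmod (h x))\<^sup>2)"
  proof (rule integrable_monotone_convergence[where f="?f" and x=L])
    show "AE x in half_line l. mono (\<lambda>n. ?f n x)"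
      by (intro AE_I2 monoI) (auto simp: indicator_def)
    show "AE x in half_line l. (\<lambda>n. ?f n x) \<longlonglongrightarrow> (cmod (h x))\<^sup>2"
    proof (rule AE_I2)
      fix x :: real
      have "eventually (\<lambda>n. x \<le> l + real n) sequentially"
        by (rule eventually_sequentiallyI[of "nat \<lceil>x - l\<rceil>"]) linarith
      then have "eventually (\<lambda>n. (cmod (h x))\<^sup>2 = ?f n x) sequentially"
        by eventually_elim simp
      then show "(\<lambda>n. ?f n x) \<longlonglongrightarrow> (cmod (h x))\<^sup>2"
        by (rule Lim_transform_eventually[OF tendsto_const])
    qed
  qed (use fi L m2 in simp_all)
  with m n show False by (simp add: L2_iff)
qed

lemma has_ac_derivative_zero_const:
  assumes "has_ac_derivative l W (\<lambda>x. 0)" "x \<ge> l"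
  shows "W x = W l"
  using has_ac_derivative_integral(2)[OF assms] by simp

text \<open>The situation at the spectral point \<open>\<i>\<close> when the defect space is one-dimensional: a square integrable
solution \<open>\<gamma>\<close>, and the Dirichlet solution \<open>\<phi>\<close> outside \<open>L\<^sub>2\<close>.\<close>

locale limit_point_at =
  fixes l :: real and q :: "real \<Rightarrow> real" and \<gamma> \<gamma>1 \<phi> \<phi>1 :: "real \<Rightarrow> complex"
  assumes \<gamma>_sl: "sturm_liouville l q \<gamma> \<gamma>1 (\<lambda>x. \<i> * \<gamma> x)" and \<gamma>_L2: "\<gamma> \<in> L2 l" and \<gamma>_l: "\<gamma> l = 1"
    and \<phi>_sl: "sturm_liouville l q \<phi> \<phi>1 (\<lambda>x. \<i> * \<phi> x)" and \<phi>_nL2: "\<phi> \<notin> L2 l"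
    and \<phi>_l: "\<phi> l = 0" "\<phi>1 l = 1"
begin

lemma wronskian_1: "x \<ge> l \<Longrightarrow> \<gamma> x * \<phi>1 x - \<gamma>1 x * \<phi> x = 1"
  using has_ac_derivative_zero_const[of l "\<lambda>x. \<gamma> x * \<phi>1 x - \<gamma>1 x * \<phi> x" x]
    sturm_liouville_wronskian[OF \<gamma>_sl \<phi>_sl] by (simp add: \<gamma>_l \<phi>_l algebra_simps)

lemma tail_small:
  assumes "\<epsilon> > 0"
  obtains b0 where "b0 \<ge> l" "norm_sq l (\<lambda>x. indicator {b0<..} x *\<^sub>R \<gamma> x) < \<epsilon>"
proof -
  have "eventually (\<lambda>n. norm_sq l (\<lambda>x. indicator {real n<..} x *\<^sub>R \<gamma> x) < \<epsilon>) sequentially"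
    by (rule order_tendstoD(2)[OF norm_sq_tail[OF \<gamma>_L2 filterlim_real_sequentially] assms])
  moreover have "eventually (\<lambda>n. real n \<ge> l) sequentially"
    by (rule eventually_sequentiallyI[of "nat \<lceil>l\<rceil>"]) linarith
  ultimately obtain n where "norm_sq l (\<lambda>x. indicator {real n<..} x *\<^sub>R \<gamma> x) < \<epsilon>" "real n \<ge> l"
    using eventually_happens[OF eventually_conj] by (metis (no_types, lifting) trivial_limit_sequentially)
  then show ?thesis by (intro that)
qed

text \<open>Cauchy-Schwarz in which the \<open>\<gamma>\<close>-factor is the norm of a tail. As this factor is small for large \<open>b0\<close>,
the integral is of smaller order than the square root of the energy of \<open>\<phi>\<close>.\<close>

lemma integral_product_bound:
  assumes b: "l \<le> b0" "b0 \<le> b"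
  shows "(cmod (integral {b0..b} (\<lambda>x. \<phi> x * cnj (\<gamma> x))))\<^sup>2 \<le>
    integral {l..b} (\<lambda>t. (cmod (\<phi> t))\<^sup>2) * norm_sq l (\<lambda>x. indicator {b0<..} x *\<^sub>R \<gamma> x)"
proof -
  let ?f = "\<lambda>x. indicator {l..b} x *\<^sub>R \<phi> x" and ?g = "\<lambda>x. cnj (indicator {b0<..} x *\<^sub>R \<gamma> x)"
  have c: "continuous_on {l..} \<phi>" "continuous_on {l..} \<gamma>"
    using sturm_liouvilleD(3)[OF \<phi>_sl] sturm_liouvilleD(3)[OF \<gamma>_sl] .
  have ai: "(\<lambda>t. (cmod (\<phi> t))\<^sup>2) absolutely_integrable_on {l..b}"
    by (intro absolutely_integrable_continuous_real continuous_intros continuous_on_subset[OF c(1)]) auto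
  have ind: "(\<lambda>x. indicator {l..b} x :: real) \<in> borel_measurable (half_line l)"
    by (rule measurable_restrict_space1) (rule borel_measurable_indicator, simp)
  have mf: "?f \<in> borel_measurable (half_line l)"
    by (intro borel_measurable_scaleR ind continuous_measurable_half_line c)
  have e1: "(\<lambda>x. indicator {l..} x *\<^sub>R (cmod (?f x))\<^sup>2) = (\<lambda>x. indicator {l..b} x *\<^sub>R (cmod (\<phi> x))\<^sup>2)"
    by (auto simp: indicator_def fun_eq_iff)
  have fL: "?f \<in> L2 l"
    using mf ai by (simp add: L2_iff integrable_restrict_space set_integrable_def e1[simplified])
  have nf: "norm_sq l ?f = integral {l..b} (\<lambda>t. (cmod (\<phi> t))\<^sup>2)"
    unfolding norm_sq_def using set_lebesgue_integral_eq_integral(2)[OF ai]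
    by (simp add: integral_restrict_space set_lebesgue_integral_def e1[simplified])
  have gL: "?g \<in> L2 l"
    by (simp only: L2_cnj) (rule L2_mult_indicator(1)[OF \<gamma>_L2], simp)
  have ap: "(\<lambda>x. \<phi> x * cnj (\<gamma> x)) absolutely_integrable_on {b0<..b}"
  proof (rule set_integrable_subset)
    show "(\<lambda>x. \<phi> x * cnj (\<gamma> x)) absolutely_integrable_on {l..b}"
      by (intro absolutely_integrable_continuous_real continuous_intros continuous_on_subset[OF c(1)] continuous_on_subset[OF c(2)]) auto
  qed (use b in auto)
  have e2: "(\<lambda>x. indicator {l..} x *\<^sub>R (?f x * ?g x)) = (\<lambda>x. indicator {b0<..b} x *\<^sub>R (\<phi> x * cnj (\<gamma> x)))"
    using b by (auto simp: indicator_def fun_eq_iff)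
  have "(LINT x|half_line l. ?f x * ?g x) = (LINT x:{b0<..b}|lebesgue. \<phi> x * cnj (\<gamma> x))"
    unfolding set_lebesgue_integral_def e2[symmetric] by (rule integral_restrict_space) simp
  also have "\<dots> = integral {b0<..b} (\<lambda>x. \<phi> x * cnj (\<gamma> x))"
    by (rule set_lebesgue_integral_eq_integral(2)[OF ap])
  also have "\<dots> = integral {b0..b} (\<lambda>x. \<phi> x * cnj (\<gamma> x))"
    by (rule integral_subset_negligible[symmetric, THEN sym]) (auto intro: negligible_subset[of "{b0}"])
  finally have e3: "(LINT x|half_line l. ?f x * ?g x) = integral {b0..b} (\<lambda>x. \<phi> x * cnj (\<gamma> x))" .
  show ?thesis
    using L2_Cauchy_Schwarz[OF fL gL] unfolding e3 nf norm_sq_cnj .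
qed

text \<open>Let \<open>A\<close>, \<open>P\<close>, \<open>c\<close> be the Wronskians of \<open>\<phi>\<close> with its conjugate, of \<open>\<gamma>\<close> with its conjugate, and of \<open>\<phi>\<close> with
the conjugate of \<open>\<gamma>\<close>. The Pluecker relation reads \<open>A P = 1 - |c|\<^sup>2\<close>. Here \<open>A\<close> grows like twice the energy
\<open>a\<close> of \<open>\<phi>\<close>, which is unbounded, while \<open>|c|\<^sup>2\<close> is \<open>o(a)\<close> since only tails of \<open>\<gamma>\<close> matter; so \<open>P\<close> tends to 0.\<close>

lemma gamma_wronskian_limit:
  "((\<lambda>x. \<gamma> x * cnj (\<gamma>1 x) - \<gamma>1 x * cnj (\<gamma> x)) \<longlongrightarrow> 0) at_top"
proof -
  define P where "P = (\<lambda>x. \<gamma> x * cnj (\<gamma>1 x) - \<gamma>1 x * cnj (\<gamma> x))"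
  define A where "A = (\<lambda>x. \<phi> x * cnj (\<phi>1 x) - \<phi>1 x * cnj (\<phi> x))"
  define c where "c = (\<lambda>x. \<phi> x * cnj (\<gamma>1 x) - \<phi>1 x * cnj (\<gamma> x))"
  define a where "a = (\<lambda>b. integral {l..b} (\<lambda>t. (cmod (\<phi> t))\<^sup>2))"
  have P': "has_ac_derivative l P (\<lambda>x. \<i> * \<gamma> x * cnj (\<gamma> x) - \<gamma> x * cnj (\<i> * \<gamma> x))"
    unfolding P_def by (rule sturm_liouville_wronskian[OF \<gamma>_sl sturm_liouville_cnj[OF \<gamma>_sl]])
  have A': "has_ac_derivative l A (\<lambda>x. \<i> * \<phi> x * cnj (\<phi> x) - \<phi> x * cnj (\<i> * \<phi> x))"
    unfolding A_def by (rule sturm_liouville_wronskian[OF \<phi>_sl sturm_liouville_cnj[OF \<phi>_sl]])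
  have c': "has_ac_derivative l c (\<lambda>x. \<i> * \<phi> x * cnj (\<gamma> x) - \<phi> x * cnj (\<i> * \<gamma> x))"
    unfolding c_def by (rule sturm_liouville_wronskian[OF \<phi>_sl sturm_liouville_cnj[OF \<gamma>_sl]])
  have cont: "continuous_on {l..} \<phi>" "continuous_on {l..} \<gamma>"
    using sturm_liouvilleD(3)[OF \<phi>_sl] sturm_liouvilleD(3)[OF \<gamma>_sl] .
  have A_eq: "A x = A l + 2 * \<i> * of_real (a x)" if "x \<ge> l" for x
  proof -
    have "integral {l..x} (\<lambda>x. \<i> * \<phi> x * cnj (\<phi> x) - \<phi> x * cnj (\<i> * \<phi> x)) = integral {l..x} (\<lambda>x. 2 * \<i> * of_real ((cmod (\<phi> x))\<^sup>2))"
      by (rule Henstock_Kurzweil_Integration.integral_cong) (simp add: complex_norm_square algebra_simps del: of_real_power)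
    also have "\<dots> = 2 * \<i> * integral {l..x} (\<lambda>x. of_real ((cmod (\<phi> x))\<^sup>2))" by simp
    also have "integral {l..x} (\<lambda>x. of_real ((cmod (\<phi> x))\<^sup>2)) = complex_of_real (a x)"
      unfolding a_def
    proof (rule integral_unique[OF has_integral_of_real[OF integrable_integral]])
      show "(\<lambda>t. (cmod (\<phi> t))\<^sup>2) integrable_on {l..x}"
        by (intro integrable_continuous_real continuous_intros continuous_on_subset[OF cont(1)]) auto
    qed
    finally show ?thesis using has_ac_derivative_integral(2)[OF A' that] by simp
  qed
  have c_eq: "c b = c b0 + 2 * \<i> * integral {b0..b} (\<lambda>x. \<phi> x * cnj (\<gamma> x))" if "l \<le> b0" "b0 \<le> b" for b0 b
  proof -
    let ?h = "\<lambda>x. \<i> * \<phi> x * cnj (\<gamma> x) - \<phi> x * cnj (\<i> * \<gamma> x)"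
    have "c b - c b0 = integral {b0..b} ?h"
      using has_ac_derivative_integral(2)[OF c', of b] has_ac_derivative_integral(2)[OF c', of b0] that
        Henstock_Kurzweil_Integration.integral_combine[of l b0 b ?h] set_lebesgue_integral_eq_integral(1)[OF has_ac_derivative_integral(1)[OF c']]
      by (simp add: algebra_simps)
    also have "?h = (\<lambda>x. 2 * \<i> * (\<phi> x * cnj (\<gamma> x)))" by (auto simp: algebra_simps)
    finally have "c b - c b0 = 2 * \<i> * integral {b0..b} (\<lambda>x. \<phi> x * cnj (\<gamma> x))"
      by (simp only: Henstock_Kurzweil_Integration.integral_mult_right)
    then show ?thesis by (simp only: diff_eq_eq add.commute)
  qed
  have pluecker: "A x * P x = 1 - of_real ((cmod (c x))\<^sup>2)" if "x \<ge> l" for x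
  proof -
    have "A x * P x = (\<gamma> x * \<phi>1 x - \<gamma>1 x * \<phi> x) * cnj (\<gamma> x * \<phi>1 x - \<gamma>1 x * \<phi> x) - c x * cnj (c x)"
      unfolding A_def P_def c_def by (simp add: algebra_simps)
    then show ?thesis
      unfolding wronskian_1[OF that] complex_norm_square by simp
  qed
  define P0 where "P0 = P l + (LINT x|half_line l. \<i> * \<gamma> x * cnj (\<gamma> x) - \<gamma> x * cnj (\<i> * \<gamma> x))"
  have "integrable (half_line l) (\<lambda>x. 2 * \<i> * (\<gamma> x * cnj (\<gamma> x)))"
    using L2_mult_integrable[OF \<gamma>_L2, of "\<lambda>x. cnj (\<gamma> x)"] \<gamma>_L2 by simp
  also have "(\<lambda>x. 2 * \<i> * (\<gamma> x * cnj (\<gamma> x))) = (\<lambda>x. \<i> * \<gamma> x * cnj (\<gamma> x) - \<gamma> x * cnj (\<i> * \<gamma> x))"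
    by (auto simp: algebra_simps)
  finally have lim: "(P \<longlongrightarrow> P0) at_top"
    unfolding P0_def by (intro has_ac_derivative_limit P')
  have "P0 = 0"
  proof (rule ccontr)
    assume ne: "P0 \<noteq> 0"
    define p where "p = cmod P0"
    have p: "p > 0" using ne by (simp add: p_def)
    \<comment> \<open>then \<open>|c|\<^sup>2\<close> grows at most like \<open>8 a p / 16\<close>, half of the lower bound \<open>a p\<close> for \<open>|A P|\<close>\<close>
    obtain b0 where b0: "b0 \<ge> l" "norm_sq l (\<lambda>x. indicator {b0<..} x *\<^sub>R \<gamma> x) < p / 16"
      using tail_small[of "p/16"] p by auto
    have "((\<lambda>x. cmod (P x)) \<longlongrightarrow> p) at_top"
      unfolding p_def by (intro tendsto_intros lim)
    then have "eventually (\<lambda>x. cmod (P x) > p / 2) at_top"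
      by (rule order_tendstoD(1)) (use p in simp)
    then obtain b1 where b1: "\<And>x. x \<ge> b1 \<Longrightarrow> cmod (P x) > p / 2"
      by (auto simp: eventually_at_top_linorder)
    define C where "C = cmod (A l)"
    define D where "D = cmod (c b0)"
    have C: "C \<ge> 0" by (simp add: C_def)
    obtain b2 where b2: "b2 \<ge> l" "\<And>x. x \<ge> b2 \<Longrightarrow> a x > C + (1 + 2 * D\<^sup>2 + p * C) / (p / 2)"
      using not_L2_unbounded[OF cont(1) \<phi>_nL2] unfolding a_def by blast
    define x where "x = max b0 (max b1 b2)"
    have x: "x \<ge> l" "x \<ge> b0" "x \<ge> b1" "x \<ge> b2" using b0 b2 by (auto simp: x_def)
    have a0: "a x > C" "a x * (p/2) > 1 + 2 * D\<^sup>2 + p * C"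
    proof -
      have t: "(1 + 2 * D\<^sup>2 + p * C) / (p / 2) > 0"
        using p C by (intro divide_pos_pos add_pos_nonneg) auto
      then show "a x > C" using b2(2)[OF x(4)] by linarith
      have "a x > (1 + 2 * D\<^sup>2 + p * C) / (p / 2)" using b2(2)[OF x(4)] C by linarith
      then show "a x * (p/2) > 1 + 2 * D\<^sup>2 + p * C" using p by (simp add: field_simps)
    qed
    have "(cmod (c x))\<^sup>2 \<le> 2 * D\<^sup>2 + 8 * (a x * (p/16))"
    proof -
      let ?J = "integral {b0..x} (\<lambda>x. \<phi> x * cnj (\<gamma> x))"
      have "cmod (c x) \<le> D + 2 * cmod ?J"
        unfolding c_eq[OF b0(1) x(2)] D_def using norm_triangle_ineq[of "c b0" "2 * \<i> * ?J"] by (simp add: norm_mult)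
      then have "(cmod (c x))\<^sup>2 \<le> (D + 2 * cmod ?J)\<^sup>2" by (rule power_mono) simp
      also have "\<dots> \<le> 2 * D\<^sup>2 + 8 * (cmod ?J)\<^sup>2"
        using sum_squares_bound[of D "2 * cmod ?J"] by (simp add: power2_sum power_mult_distrib)
      also have "(cmod ?J)\<^sup>2 \<le> a x * (p/16)"
        using integral_product_bound[OF b0(1) x(2)] b0(2) a0(1) C unfolding a_def
        by (meson less_le_trans less_imp_le mult_left_mono order_trans)
      finally show ?thesis by simp
    qed
    moreover have "cmod (A x) * cmod (P x) \<le> 1 + (cmod (c x))\<^sup>2"
    proof -
      have "cmod (A x) * cmod (P x) = cmod (1 - of_real ((cmod (c x))\<^sup>2))"
        using pluecker[OF x(1)] by (metis norm_mult)
      also have "\<dots> \<le> 1 + (cmod (c x))\<^sup>2"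
        using norm_triangle_ineq4[of 1 "complex_of_real ((cmod (c x))\<^sup>2)"] by (simp add: norm_power)
      finally show ?thesis .
    qed
    moreover have "(2 * a x - C) * (p / 2) \<le> cmod (A x) * cmod (P x)"
    proof (rule mult_mono)
      have "cmod (2 * \<i> * of_real (a x)) - cmod (A l) \<le> cmod (A x)"
        unfolding A_eq[OF x(1)] using norm_diff_ineq[of "2 * \<i> * of_real (a x)" "A l"] by (simp add: add.commute)
      then show "2 * a x - C \<le> cmod (A x)" using a0(1) C by (simp add: norm_mult C_def)
      show "p / 2 \<le> cmod (P x)" using b1[OF x(3)] by simp
    qed (use p in auto)
    ultimately have "(2 * a x - C) * (p / 2) \<le> 1 + 2 * D\<^sup>2 + 8 * (a x * (p/16))" by linarith
    then have "a x * (p/2) \<le> 1 + 2 * D\<^sup>2 + C * p / 2" by (simp add: algebra_simps)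
    moreover have "C * p / 2 \<le> p * C" using p C by simp
    ultimately show False using a0(2) by linarith
  qed
  with lim show ?thesis unfolding P_def by simp
qed

section \<open>Variation of constants at the spectral point i\<close>

text \<open>Variation of constants for \<open>- y'' + q y - \<i> y = F\<close>: \<open>green_op F\<close> is the solution that
vanishes at \<open>l\<close> and is governed by \<open>\<gamma>\<close> at infinity; the first two functions are its coefficients at \<open>\<gamma>\<close>
and \<open>\<phi>\<close>.\<close>

definition left_coeff where "left_coeff F x = integral {l..x} (\<lambda>t. \<phi> t * F t)"
definition right_coeff where "right_coeff F x = (LINT t|half_line l. \<gamma> t * F t) - integral {l..x} (\<lambda>t. \<gamma> t * F t)"
definition green_op where "green_op F x = (if x < l then 0 else \<gamma> x * left_coeff F x + \<phi> x * right_coeff F x)"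
definition green_op_deriv where "green_op_deriv F x = \<gamma>1 x * left_coeff F x + \<phi>1 x * right_coeff F x"

lemma cont: "continuous_on {l..} \<phi>" "continuous_on {l..} \<gamma>" "continuous_on {l..} \<phi>1" "continuous_on {l..} \<gamma>1"
  using sturm_liouvilleD(3,4)[OF \<phi>_sl] sturm_liouvilleD(3,4)[OF \<gamma>_sl] by auto

lemma left_coeff_deriv: "F \<in> L2 l \<Longrightarrow> has_ac_derivative l (left_coeff F) (\<lambda>x. \<phi> x * F x)"
  by (rule has_ac_derivativeI) (auto simp: left_coeff_def intro: L2_imp_locally_integrable cont)

lemma right_coeff_deriv: "F \<in> L2 l \<Longrightarrow> has_ac_derivative l (right_coeff F) (\<lambda>x. - (\<gamma> x * F x))"
proof (rule has_ac_derivativeI)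
  assume F: "F \<in> L2 l"
  show "(\<lambda>x. - (\<gamma> x * F x)) absolutely_integrable_on {l..b}" for b
    using L2_imp_locally_integrable[OF F continuous_on_minus[OF cont(2)], of b] by simp
qed (simp add: right_coeff_def)

lemma green_op_sl:
  assumes F: "F \<in> L2 l"
  shows "sturm_liouville l q (green_op F) (green_op_deriv F) (\<lambda>x. \<i> * green_op F x + F x)"
proof -
  have "has_ac_derivative l (green_op F) (green_op_deriv F)"
  proof (rule has_ac_derivative_cong)
    show "has_ac_derivative l (\<lambda>x. \<gamma> x * left_coeff F x + \<phi> x * right_coeff F x)
      (\<lambda>x. (\<gamma>1 x * left_coeff F x + \<gamma> x * (\<phi> x * F x)) + (\<phi>1 x * right_coeff F x + \<phi> x * - (\<gamma> x * F x)))"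
      by (intro has_ac_derivative_add has_ac_derivative_mult left_coeff_deriv right_coeff_deriv F
          sturm_liouvilleD(1)[OF \<phi>_sl] sturm_liouvilleD(1)[OF \<gamma>_sl])
  qed (auto simp: green_op_def green_op_deriv_def)
  moreover have "has_ac_derivative l (green_op_deriv F) (\<lambda>x. of_real (q x) * green_op F x - (\<i> * green_op F x + F x))"
  proof (rule has_ac_derivative_cong)
    show "has_ac_derivative l (\<lambda>x. \<gamma>1 x * left_coeff F x + \<phi>1 x * right_coeff F x)
      (\<lambda>x. ((of_real (q x) * \<gamma> x - \<i> * \<gamma> x) * left_coeff F x + \<gamma>1 x * (\<phi> x * F x)) +
            ((of_real (q x) * \<phi> x - \<i> * \<phi> x) * right_coeff F x + \<phi>1 x * - (\<gamma> x * F x)))"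
      by (intro has_ac_derivative_add has_ac_derivative_mult left_coeff_deriv right_coeff_deriv F
          sturm_liouvilleD(2)[OF \<phi>_sl] sturm_liouvilleD(2)[OF \<gamma>_sl])
    have "((of_real (q x) * \<gamma> x - \<i> * \<gamma> x) * left_coeff F x + \<gamma>1 x * (\<phi> x * F x)) +
            ((of_real (q x) * \<phi> x - \<i> * \<phi> x) * right_coeff F x + \<phi>1 x * - (\<gamma> x * F x)) =
          of_real (q x) * green_op F x - (\<i> * green_op F x + F x)" if x: "x \<ge> l" for x
    proof -
      have "((of_real (q x) * \<gamma> x - \<i> * \<gamma> x) * left_coeff F x + \<gamma>1 x * (\<phi> x * F x)) +
            ((of_real (q x) * \<phi> x - \<i> * \<phi> x) * right_coeff F x + \<phi>1 x * - (\<gamma> x * F x)) =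
          of_real (q x) * green_op F x - (\<i> * green_op F x + (\<gamma> x * \<phi>1 x - \<gamma>1 x * \<phi> x) * F x)"
        using x by (simp add: green_op_def algebra_simps)
      then show ?thesis unfolding wronskian_1[OF x] by simp
    qed
    then show "AE x in lebesgue. x \<ge> l \<longrightarrow> ((of_real (q x) * \<gamma> x - \<i> * \<gamma> x) * left_coeff F x + \<gamma>1 x * (\<phi> x * F x)) +
            ((of_real (q x) * \<phi> x - \<i> * \<phi> x) * right_coeff F x + \<phi>1 x * - (\<gamma> x * F x)) =
          of_real (q x) * green_op F x - (\<i> * green_op F x + F x)" by simp
  qed (auto simp: green_op_deriv_def)
  ultimately show ?thesis by (simp add: sturm_liouville_def)
qed

lemma green_op_l: "green_op F l = 0" "green_op_deriv F l = (LINT t|half_line l. \<gamma> t * F t)"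
  by (simp_all add: green_op_def green_op_deriv_def left_coeff_def right_coeff_def \<phi>_l)

text \<open>The \<open>\<gamma>\<close>-part drops out of the Wronskian with \<open>\<gamma>\<close>; what remains is the tail integral, which tends to 0.\<close>

lemma green_op_gamma_wronskian:
  assumes x: "x \<ge> l"
  shows "green_op F x * \<gamma>1 x - green_op_deriv F x * \<gamma> x = - right_coeff F x"
proof -
  have "green_op F x * \<gamma>1 x - green_op_deriv F x * \<gamma> x = - right_coeff F x * (\<gamma> x * \<phi>1 x - \<gamma>1 x * \<phi> x)"
    using x by (simp add: green_op_def green_op_deriv_def algebra_simps)
  then show ?thesis unfolding wronskian_1[OF x] by simp
qed

lemma green_op_diff:
  assumes "F \<in> L2 l" "G \<in> L2 l"
  shows "green_op (\<lambda>x. F x - G x) x = green_op F x - green_op G x" "green_op_deriv (\<lambda>x. F x - G x) x = green_op_deriv F x - green_op_deriv G x"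
proof -
  have ii: "(\<lambda>t. h t * H t) integrable_on {l..x}" if "H \<in> L2 l" "continuous_on {l..} h" for h H x
    by (rule set_lebesgue_integral_eq_integral(1)[OF L2_imp_locally_integrable[OF that]])
  have A: "left_coeff (\<lambda>x. F x - G x) x = left_coeff F x - left_coeff G x"
    using Henstock_Kurzweil_Integration.integral_diff[OF ii[OF assms(1) cont(1)] ii[OF assms(2) cont(1)], of x]
    by (simp add: left_coeff_def algebra_simps)
  have B: "right_coeff (\<lambda>x. F x - G x) x = right_coeff F x - right_coeff G x"
    using Henstock_Kurzweil_Integration.integral_diff[OF ii[OF assms(1) cont(2)] ii[OF assms(2) cont(2)], of x]
      Bochner_Integration.integral_diff[OF L2_mult_integrable[OF \<gamma>_L2 assms(1)] L2_mult_integrable[OF \<gamma>_L2 assms(2)]]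
    by (simp add: right_coeff_def algebra_simps)
  show "green_op (\<lambda>x. F x - G x) x = green_op F x - green_op G x" "green_op_deriv (\<lambda>x. F x - G x) x = green_op_deriv F x - green_op_deriv G x"
    by (auto simp: green_op_def green_op_deriv_def A B algebra_simps)
qed

abbreviation trunc :: "nat \<Rightarrow> (real \<Rightarrow> complex) \<Rightarrow> real \<Rightarrow> complex" where
  "trunc n F \<equiv> (\<lambda>x. indicator {..l + real n} x *\<^sub>R F x)"

lemma trunc_L2: "F \<in> L2 l \<Longrightarrow> trunc n F \<in> L2 l" "F \<in> L2 l \<Longrightarrow> norm_sq l (trunc n F) \<le> norm_sq l F"
  using L2_mult_indicator[of F l "{..l + real n}"] by auto

lemma integral_gamma_trunc:
  assumes F: "F \<in> L2 l"
  shows "(LINT t|half_line l. \<gamma> t * trunc n F t) = integral {l..l + real n} (\<lambda>t. \<gamma> t * F t)"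
proof -
  have e: "(\<lambda>x. indicator {l..} x *\<^sub>R (\<gamma> x * trunc n F x)) = (\<lambda>x. indicator {l..l + real n} x *\<^sub>R (\<gamma> x * F x))"
    by (auto simp: indicator_def fun_eq_iff)
  show ?thesis
    using integral_restrict_space[of "{l..}" lebesgue "\<lambda>x. \<gamma> x * trunc n F x"]
      set_lebesgue_integral_eq_integral(2)[OF L2_imp_locally_integrable[OF F cont(2)], of "l + real n"]
    unfolding set_lebesgue_integral_def e by simp
qed

lemma green_op_trunc:
  assumes F: "F \<in> L2 l" 
  shows "x \<ge> l + real n \<Longrightarrow> right_coeff (trunc n F) x = 0" "x \<ge> l + real n \<Longrightarrow> left_coeff (trunc n F) x = left_coeff (trunc n F) (l + real n)"
    "x \<le> l + real n \<Longrightarrow> left_coeff (trunc n F) x = left_coeff F x"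
    "x \<le> l + real n \<Longrightarrow> right_coeff (trunc n F) x = integral {l..l + real n} (\<lambda>t. \<gamma> t * F t) - integral {l..x} (\<lambda>t. \<gamma> t * F t)"
proof -
  have ii: "(\<lambda>t. h t * trunc n F t) integrable_on {l..x}" if "continuous_on {l..} h" for h x
    by (rule set_lebesgue_integral_eq_integral(1)[OF L2_imp_locally_integrable[OF trunc_L2(1)[OF F] that]])
  have beyond: "integral {l..x} (\<lambda>t. h t * trunc n F t) = integral {l..l + real n} (\<lambda>t. h t * trunc n F t)"
    if "x \<ge> l + real n" "continuous_on {l..} h" for h x
  proof -
    have "integral {l + real n..x} (\<lambda>t. h t * trunc n F t) = integral {l + real n..x} (\<lambda>t. 0)"
      by (rule integral_spike[of "{l + real n}"]) (auto simp: indicator_def)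
    then show ?thesis
      using Henstock_Kurzweil_Integration.integral_combine[of l "l + real n" x "\<lambda>t. h t * trunc n F t"] ii[OF that(2), of x] that by simp
  qed
  have within: "integral {l..x} (\<lambda>t. h t * trunc n F t) = integral {l..x} (\<lambda>t. h t * F t)"
    if "x \<le> l + real n" for h x
    by (rule Henstock_Kurzweil_Integration.integral_cong) (use that in auto)
  show "x \<ge> l + real n \<Longrightarrow> left_coeff (trunc n F) x = left_coeff (trunc n F) (l + real n)"
    unfolding left_coeff_def by (rule beyond[OF _ cont(1)])
  show "x \<ge> l + real n \<Longrightarrow> right_coeff (trunc n F) x = 0"
    unfolding right_coeff_def integral_gamma_trunc[OF F] using trans[OF beyond[OF _ cont(2)] within[OF order_refl]] by simp
  show "x \<le> l + real n \<Longrightarrow> left_coeff (trunc n F) x = left_coeff F x"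
    unfolding left_coeff_def by (rule within)
  show "x \<le> l + real n \<Longrightarrow> right_coeff (trunc n F) x = integral {l..l + real n} (\<lambda>t. \<gamma> t * F t) - integral {l..x} (\<lambda>t. \<gamma> t * F t)"
    unfolding right_coeff_def integral_gamma_trunc[OF F] by (simp only: within)
qed

text \<open>If the right-hand side vanishes beyond a point, the solution is a multiple of \<open>\<gamma>\<close> there. So it is
square integrable, and its Wronskian with its conjugate tends to 0 at infinity and vanishes at \<open>l\<close>. The
imaginary part of Lagrange's identity becomes \<open>\<parallel>u\<parallel>\<^sup>2 = - Im \<langle>F, u\<rangle>\<close>, hence \<open>\<parallel>u\<parallel> \<le> \<parallel>F\<parallel>\<close>.\<close>

lemma green_op_trunc_L2:
  assumes F: "F \<in> L2 l"
  shows "green_op (trunc n F) \<in> L2 l" "norm_sq l (green_op (trunc n F)) \<le> norm_sq l F"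
    and green_op_trunc_tail: "\<And>x. x \<ge> l + real n \<Longrightarrow> green_op (trunc n F) x = left_coeff (trunc n F) (l + real n) * \<gamma> x \<and>
      green_op_deriv (trunc n F) x = left_coeff (trunc n F) (l + real n) * \<gamma>1 x"
proof -
  let ?G = "trunc n F" let ?u = "green_op ?G" let ?c = "left_coeff ?G (l + real n)"
  note G = trunc_L2(1)[OF F, of n]
  show tail: "?u x = ?c * \<gamma> x \<and> green_op_deriv ?G x = ?c * \<gamma>1 x" if "x \<ge> l + real n" for x
    using that green_op_trunc(1)[OF F that] green_op_trunc(2)[OF F that] unfolding green_op_def green_op_deriv_def by simp
  note sl = green_op_sl[OF G]
  have "(\<lambda>x. ?u x - ?c * \<gamma> x) \<in> L2 l"
    by (rule continuous_compact_support_L2[where n="l + real n"])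
       (use tail in \<open>auto intro!: continuous_intros sturm_liouvilleD(3)[OF sl] cont\<close>)
  from L2_add[OF this L2_cmult[OF \<gamma>_L2, of ?c]] show u: "?u \<in> L2 l" by simp
  let ?W = "\<lambda>x. ?u x * cnj (green_op_deriv ?G x) - green_op_deriv ?G x * cnj (?u x)"
  let ?w = "\<lambda>x. (\<i> * ?u x + ?G x) * cnj (?u x) - ?u x * cnj (\<i> * ?u x + ?G x)"
  have uc: "(\<lambda>x. cnj (?u x)) \<in> L2 l" using u by simp
  have W: "has_ac_derivative l ?W ?w"
    by (rule sturm_liouville_wronskian[OF sl sturm_liouville_cnj[OF sl]])
  have w: "?w = (\<lambda>x. 2 * \<i> * (?u x * cnj (?u x)) + (?G x * cnj (?u x) - cnj (?G x * cnj (?u x))))"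
    by (auto simp: algebra_simps)
  note i1 = L2_mult_integrable[OF u uc] and i2 = L2_mult_integrable[OF G uc]
  have i3: "integrable (half_line l) (\<lambda>x. cnj (?G x * cnj (?u x)))"
    using i2 by (rule integrable_cnj)
  have wi: "integrable (half_line l) ?w" unfolding w
    by (intro Bochner_Integration.integrable_add Bochner_Integration.integrable_diff integrable_mult_right i1 i2 i3)
  let ?I = "LINT x|half_line l. ?G x * cnj (?u x)"
  have wI: "(LINT x|half_line l. ?w x) = 2 * \<i> * of_real (norm_sq l ?u) + (?I - cnj ?I)"
  proof -
    have "(LINT x|half_line l. ?u x * cnj (?u x)) = of_real (norm_sq l ?u)"
      unfolding norm_sq_def complex_norm_square[symmetric] by (rule integral_of_real) (use u in \<open>simp add: L2_iff\<close>)
    moreover have "(LINT x|half_line l. ?w x) = (LINT x|half_line l. 2 * \<i> * (?u x * cnj (?u x)))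
        + (LINT x|half_line l. ?G x * cnj (?u x) - cnj (?G x * cnj (?u x)))"
      unfolding w by (intro Bochner_Integration.integral_add Bochner_Integration.integrable_diff integrable_mult_right i1 i2 i3)
    moreover have "(LINT x|half_line l. ?G x * cnj (?u x) - cnj (?G x * cnj (?u x))) = ?I - cnj ?I"
      using Bochner_Integration.integral_diff[OF i2 i3] unfolding Bochner_Integration.integral_cnj .
    ultimately show ?thesis by (simp only: integral_mult_right_zero)
  qed
  have Wl: "?W l = 0" by (simp add: green_op_l)
  have "(?W \<longlongrightarrow> ?W l + (LINT x|half_line l. ?w x)) at_top"
    by (rule has_ac_derivative_limit[OF W wi])
  moreover have "(?W \<longlongrightarrow> ?c * cnj ?c * 0) at_top"
  proof (rule Lim_transform_eventually)
    show "((\<lambda>x. ?c * cnj ?c * (\<gamma> x * cnj (\<gamma>1 x) - \<gamma>1 x * cnj (\<gamma> x))) \<longlongrightarrow> ?c * cnj ?c * 0) at_top"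
      by (intro tendsto_intros gamma_wronskian_limit)
    show "eventually (\<lambda>x. ?c * cnj ?c * (\<gamma> x * cnj (\<gamma>1 x) - \<gamma>1 x * cnj (\<gamma> x)) = ?W x) at_top"
      using eventually_ge_at_top[of "l + real n"]
    proof eventually_elim
      case (elim x)
      have t: "?u x = ?c * \<gamma> x" "green_op_deriv ?G x = ?c * \<gamma>1 x" using tail[OF elim] by auto
      show ?case unfolding t by (simp add: algebra_simps)
    qed
  qed
  ultimately have "?W l + (LINT x|half_line l. ?w x) = ?c * cnj ?c * 0"
    by (rule tendsto_unique[OF trivial_limit_at_top_linorder])
  then have "2 * \<i> * of_real (norm_sq l ?u) + (?I - cnj ?I) = 0"
    unfolding wI Wl by (simp only: add_0_left mult_zero_right)
  then have "norm_sq l ?u = - Im ?I"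
    by (simp add: complex_eq_iff)
  then have "norm_sq l ?u \<le> cmod ?I" using abs_Im_le_cmod[of ?I] by linarith
  then have "(norm_sq l ?u)\<^sup>2 \<le> (cmod ?I)\<^sup>2" by (rule power_mono) (rule norm_sq_nonneg)
  also have "\<dots> \<le> norm_sq l ?G * norm_sq l ?u"
    using L2_Cauchy_Schwarz[OF G uc] unfolding norm_sq_cnj .
  finally have "norm_sq l ?u * norm_sq l ?u \<le> norm_sq l ?G * norm_sq l ?u" by (simp add: power2_eq_square)
  then have "norm_sq l ?u \<le> norm_sq l ?G"
    using norm_sq_nonneg[of l ?u] norm_sq_nonneg[of l ?G] by (cases "norm_sq l ?u = 0") auto
  then show "norm_sq l ?u \<le> norm_sq l F" using trunc_L2(2)[OF F, of n] by simp
qed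

text \<open>The bound for truncated right-hand sides is uniform and the solutions converge pointwise.\<close>

lemma green_op_L2:
  assumes F: "F \<in> L2 l"
  shows "green_op F \<in> L2 l" "norm_sq l (green_op F) \<le> norm_sq l F"
proof -
  have lim: "(\<lambda>n. green_op (trunc n F) x) \<longlonglongrightarrow> green_op F x" if x: "x \<ge> l" for x
  proof -
    have B: "(\<lambda>n. integral {l..l + real n} (\<lambda>t. \<gamma> t * F t)) \<longlonglongrightarrow> (LINT t|half_line l. \<gamma> t * F t)"
      by (rule filterlim_compose[OF half_line_integral_limit[OF L2_mult_integrable[OF \<gamma>_L2 F]]])
         (rule filterlim_tendsto_add_at_top[OF tendsto_const filterlim_real_sequentially])
    have "(\<lambda>n. \<gamma> x * left_coeff F x + \<phi> x * (integral {l..l + real n} (\<lambda>t. \<gamma> t * F t) - integral {l..x} (\<lambda>t. \<gamma> t * F t))) \<longlonglongrightarrow> green_op F x"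
      unfolding green_op_def right_coeff_def using x by (auto intro!: tendsto_intros B)
    moreover have "eventually (\<lambda>n. x \<le> l + real n) sequentially"
      by (rule eventually_sequentiallyI[of "nat \<lceil>x - l\<rceil>"]) linarith
    then have "eventually (\<lambda>n. \<gamma> x * left_coeff F x + \<phi> x * (integral {l..l + real n} (\<lambda>t. \<gamma> t * F t) - integral {l..x} (\<lambda>t. \<gamma> t * F t)) = green_op (trunc n F) x) sequentially"
    proof eventually_elim
      case (elim n)
      then show ?case using green_op_trunc(3,4)[OF F elim] x unfolding green_op_def by simp
    qed
    ultimately show ?thesis by (rule Lim_transform_eventually)
  qed
  have m: "green_op F \<in> borel_measurable (half_line l)"
    by (rule continuous_measurable_half_line[OF sturm_liouvilleD(3)[OF green_op_sl[OF F]]])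
  show "green_op F \<in> L2 l" "norm_sq l (green_op F) \<le> norm_sq l F"
    using L2_Fatou[of "\<lambda>n. green_op (trunc n F)" l "norm_sq l F" "green_op F", OF green_op_trunc_L2(1)[OF F] green_op_trunc_L2(2)[OF F] lim m] by auto
qed

lemma green_op_Dstar: "F \<in> L2 l \<Longrightarrow> green_op F \<in> Dstar l q"
  using DstarI[OF green_op_sl green_op_L2(1) L2_add[OF L2_cmult[OF green_op_L2(1)]]] by (simp add: green_op_def)

section \<open>The limit-point property\<close>

text \<open>Any solution is a combination of \<open>\<gamma>\<close> and \<open>\<phi>\<close> with constant Wronskians as coefficients; a nonzero
\<open>\<phi>\<close>-coefficient would make \<open>\<phi>\<close> square integrable.\<close>

lemma homogeneous_L2:
  assumes v: "sturm_liouville l q v v1 (\<lambda>x. \<i> * v x)" "v \<in> L2 l"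
  shows "\<exists>c. \<forall>x\<ge>l. v x = c * \<gamma> x \<and> v1 x = c * \<gamma>1 x"
proof -
  define \<alpha> where "\<alpha> = v l * \<phi>1 l - v1 l * \<phi> l"
  define \<beta> where "\<beta> = v l * \<gamma>1 l - v1 l * \<gamma> l"
  have a: "v x * \<phi>1 x - v1 x * \<phi> x = \<alpha>" if "x \<ge> l" for x
    using has_ac_derivative_zero_const[of l "\<lambda>x. v x * \<phi>1 x - v1 x * \<phi> x" x]
      sturm_liouville_wronskian[OF v(1) \<phi>_sl] that by (simp add: \<alpha>_def algebra_simps)
  have b: "v x * \<gamma>1 x - v1 x * \<gamma> x = \<beta>" if "x \<ge> l" for x
    using has_ac_derivative_zero_const[of l "\<lambda>x. v x * \<gamma>1 x - v1 x * \<gamma> x" x]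
      sturm_liouville_wronskian[OF v(1) \<gamma>_sl] that by (simp add: \<beta>_def algebra_simps)
  have vx: "v x = \<alpha> * \<gamma> x - \<beta> * \<phi> x" "v1 x = \<alpha> * \<gamma>1 x - \<beta> * \<phi>1 x" if x: "x \<ge> l" for x
  proof -
    have "v x * (\<gamma> x * \<phi>1 x - \<gamma>1 x * \<phi> x) = \<alpha> * \<gamma> x - \<beta> * \<phi> x"
      unfolding a[OF x, symmetric] b[OF x, symmetric] by (simp add: algebra_simps)
    then show "v x = \<alpha> * \<gamma> x - \<beta> * \<phi> x" unfolding wronskian_1[OF x] by simp
    have "v1 x * (\<gamma> x * \<phi>1 x - \<gamma>1 x * \<phi> x) = \<alpha> * \<gamma>1 x - \<beta> * \<phi>1 x"
      unfolding a[OF x, symmetric] b[OF x, symmetric] by (simp add: algebra_simps)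
    then show "v1 x = \<alpha> * \<gamma>1 x - \<beta> * \<phi>1 x" unfolding wronskian_1[OF x] by simp
  qed
  have "\<beta> = 0"
  proof (rule ccontr)
    assume b0: "\<beta> \<noteq> 0"
    have "(\<lambda>x. (1/\<beta>) * (\<alpha> * \<gamma> x - v x)) \<in> L2 l"
      by (intro L2_cmult L2_diff \<gamma>_L2 v)
    then have "\<phi> \<in> L2 l"
      by (rule L2_cong_AE) (use vx(1) b0 in \<open>auto simp: AE_half_line\<close>)
    with \<phi>_nL2 show False by simp
  qed
  with vx show ?thesis by (intro exI[of _ \<alpha>]) simp
qed

lemma Dstar_decomposition:
  assumes f: "f \<in> Dstar l q"
  shows "\<exists>F c. F \<in> L2 l \<and> (\<forall>x\<ge>l. f x = green_op F x + c * \<gamma> x \<and> D1 l f x = green_op_deriv F x + c * \<gamma>1 x)"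
proof -
  define F where "F = (\<lambda>x. diff_expr l q f x - \<i> * f x)"
  have F: "F \<in> L2 l" unfolding F_def by (intro L2_diff L2_cmult DstarD[OF f])
  have "sturm_liouville l q (\<lambda>x. f x + (-1) * green_op F x) (\<lambda>x. D1 l f x + (-1) * green_op_deriv F x)
      (\<lambda>x. diff_expr l q f x + (-1) * (\<i> * green_op F x + F x))"
    by (intro sturm_liouville_add sturm_liouville_cmult DstarD[OF f] green_op_sl F)
  then have "sturm_liouville l q (\<lambda>x. f x + (-1) * green_op F x) (\<lambda>x. D1 l f x + (-1) * green_op_deriv F x) (\<lambda>x. \<i> * (f x + (-1) * green_op F x))"
    by (rule sturm_liouville_cong) (auto simp: F_def algebra_simps)
  moreover have "(\<lambda>x. f x + (-1) * green_op F x) \<in> L2 l"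
    by (intro L2_add L2_cmult DstarD[OF f] green_op_L2 F)
  ultimately obtain c where "\<forall>x\<ge>l. f x + (-1) * green_op F x = c * \<gamma> x \<and> D1 l f x + (-1) * green_op_deriv F x = c * \<gamma>1 x"
    using homogeneous_L2 by blast
  then have "\<forall>x\<ge>l. f x = green_op F x + c * \<gamma> x \<and> D1 l f x = green_op_deriv F x + c * \<gamma>1 x"
    by (auto simp: algebra_simps)
  with F show ?thesis by blast
qed

lemma wronskian_gamma_limit:
  assumes f: "f \<in> Dstar l q"
  shows "((\<lambda>x. f x * \<gamma>1 x - D1 l f x * \<gamma> x) \<longlongrightarrow> 0) at_top"
proof -
  obtain F c where F: "F \<in> L2 l" and fx: "\<And>x. x \<ge> l \<Longrightarrow> f x = green_op F x + c * \<gamma> x \<and> D1 l f x = green_op_deriv F x + c * \<gamma>1 x"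
    using Dstar_decomposition[OF f] by blast
  let ?I = "LINT t|half_line l. \<gamma> t * F t"
  have "((\<lambda>x. - (?I - integral {l..x} (\<lambda>t. \<gamma> t * F t))) \<longlongrightarrow> - (?I - ?I)) at_top"
    by (intro tendsto_intros half_line_integral_limit L2_mult_integrable \<gamma>_L2 F)
  moreover have "eventually (\<lambda>x. - (?I - integral {l..x} (\<lambda>t. \<gamma> t * F t)) = f x * \<gamma>1 x - D1 l f x * \<gamma> x) at_top"
    using eventually_ge_at_top[of l]
  proof eventually_elim
    case (elim x)
    have "f x * \<gamma>1 x - D1 l f x * \<gamma> x = green_op F x * \<gamma>1 x - green_op_deriv F x * \<gamma> x"
      using fx[OF elim] by (simp add: algebra_simps)
    then show ?case using green_op_gamma_wronskian[OF elim, of F] by (simp add: right_coeff_def)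
  qed
  ultimately have "((\<lambda>x. f x * \<gamma>1 x - D1 l f x * \<gamma> x) \<longlongrightarrow> - (?I - ?I)) at_top"
    by (rule Lim_transform_eventually)
  then show ?thesis by simp
qed

text \<open>The limit at infinity of the Wronskian of \<open>f\<close> and \<open>green_op H\<close>, expressed by quantities that are
continuous in \<open>H\<close> with respect to the \<open>L\<^sub>2\<close> norm.\<close>

definition boundary_form where
  "boundary_form f H = (f l * green_op_deriv H l - D1 l f l * green_op H l)
     + (LINT x|half_line l. diff_expr l q f x * green_op H x - f x * (\<i> * green_op H x + H x))"

lemma boundary_form_integrable:
  assumes f: "f \<in> Dstar l q" and H: "H \<in> L2 l"
  shows "integrable (half_line l) (\<lambda>x. diff_expr l q f x * green_op H x - f x * (\<i> * green_op H x + H x))"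
  by (intro Bochner_Integration.integrable_diff L2_mult_integrable L2_add L2_cmult green_op_L2 DstarD[OF f] H)

lemma boundary_form_limit:
  assumes f: "f \<in> Dstar l q" and H: "H \<in> L2 l"
  shows "((\<lambda>x. f x * green_op_deriv H x - D1 l f x * green_op H x) \<longlongrightarrow> boundary_form f H) at_top"
  unfolding boundary_form_def
  by (rule has_ac_derivative_limit[OF sturm_liouville_wronskian[OF DstarD(1)[OF f] green_op_sl[OF H]] boundary_form_integrable[OF f H]])

lemma boundary_form_diff:
  assumes f: "f \<in> Dstar l q" and H: "H \<in> L2 l" "G \<in> L2 l"
  shows "boundary_form f (\<lambda>x. H x - G x) = boundary_form f H - boundary_form f G"
  unfolding boundary_form_def green_op_diff[OF H] 
  using Bochner_Integration.integral_diff[OF boundary_form_integrable[OF f H(1)] boundary_form_integrable[OF f H(2)]]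
  by (simp add: algebra_simps)

lemma boundary_form_bound:
  assumes f: "f \<in> Dstar l q" and H: "H \<in> L2 l"
  shows "cmod (boundary_form f H) \<le> (cmod (f l) * sqrt (norm_sq l \<gamma>) + sqrt (norm_sq l (diff_expr l q f)) + 2 * sqrt (norm_sq l f)) * sqrt (norm_sq l H)"
proof -
  have cs: "cmod (LINT x|half_line l. g x * h x) \<le> sqrt (norm_sq l g) * sqrt (norm_sq l h)" if "g \<in> L2 l" "h \<in> L2 l" for g h
    using real_le_rsqrt[OF L2_Cauchy_Schwarz[OF that]] by (simp add: real_sqrt_mult)
  have tri: "cmod (a - \<i> * b - c) \<le> cmod a + cmod b + cmod c" for a b c
    using norm_triangle_ineq4[of "a - \<i> * b" c] norm_triangle_ineq4[of a "\<i> * b"] by (simp add: norm_mult)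
  note fD = DstarD[OF f] and RH = green_op_L2[OF H]
  have RH': "sqrt (norm_sq l (green_op H)) \<le> sqrt (norm_sq l H)" using RH(2) by simp
  have b1: "cmod (f l * green_op_deriv H l) \<le> cmod (f l) * sqrt (norm_sq l \<gamma>) * sqrt (norm_sq l H)"
    using cs[OF \<gamma>_L2 H] by (simp add: green_op_l norm_mult mult.assoc mult_left_mono)
  let ?A = "LINT x|half_line l. diff_expr l q f x * green_op H x" and ?B = "LINT x|half_line l. f x * green_op H x" and ?C = "LINT x|half_line l. f x * H x"
  have b2: "cmod ?A \<le> sqrt (norm_sq l (diff_expr l q f)) * sqrt (norm_sq l H)"
    by (rule order_trans[OF cs[OF fD(3) RH(1)]]) (intro mult_left_mono RH', simp add: norm_sq_nonneg)
  have b3: "cmod ?B \<le> sqrt (norm_sq l f) * sqrt (norm_sq l H)"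
    by (rule order_trans[OF cs[OF fD(2) RH(1)]]) (intro mult_left_mono RH', simp add: norm_sq_nonneg)
  have b4: "cmod ?C \<le> sqrt (norm_sq l f) * sqrt (norm_sq l H)"
    by (rule cs[OF fD(2) H])
  note i = L2_mult_integrable[OF fD(3) RH(1)] L2_mult_integrable[OF fD(2) RH(1)] L2_mult_integrable[OF fD(2) H]
  have e: "(\<lambda>x. diff_expr l q f x * green_op H x - f x * (\<i> * green_op H x + H x)) =
      (\<lambda>x. (diff_expr l q f x * green_op H x - \<i> * (f x * green_op H x)) - f x * H x)" by (auto simp: algebra_simps)
  have i': "integrable (half_line l) (\<lambda>x. \<i> * (f x * green_op H x))" by (intro integrable_mult_right i)
  have "(LINT x|half_line l. (diff_expr l q f x * green_op H x - \<i> * (f x * green_op H x)) - f x * H x) = (?A - \<i> * ?B) - ?C"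
    by (simp only: Bochner_Integration.integral_diff[OF Bochner_Integration.integrable_diff[OF i(1) i'] i(3)]
        Bochner_Integration.integral_diff[OF i(1) i'] integral_mult_right_zero)
  then have eq: "boundary_form f H = f l * green_op_deriv H l + ((?A - \<i> * ?B) - ?C)"
    unfolding boundary_form_def e green_op_l(1) by (simp only: mult_zero_right diff_zero)
  have "cmod (boundary_form f H) \<le> cmod (f l * green_op_deriv H l) + (cmod ?A + cmod ?B + cmod ?C)"
    unfolding eq by (rule order_trans[OF norm_triangle_ineq add_left_mono[OF tri]])
  also have "\<dots> \<le> (cmod (f l) * sqrt (norm_sq l \<gamma>) + sqrt (norm_sq l (diff_expr l q f)) + 2 * sqrt (norm_sq l f)) * sqrt (norm_sq l H)"
    using add_mono[OF b1 add_mono[OF add_mono[OF b2 b3] b4]] by (simp only: distrib_right mult_2 add.assoc)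
  finally show ?thesis .
qed

text \<open>Beyond the support of the right-hand side, \<open>green_op\<close> is a multiple of \<open>\<gamma>\<close>, whose Wronskian with any
element of \<open>Dstar\<close> tends to 0.\<close>

lemma boundary_form_trunc:
  assumes f: "f \<in> Dstar l q" and H: "H \<in> L2 l"
  shows "boundary_form f (trunc n H) = 0"
proof -
  let ?c = "left_coeff (trunc n H) (l + real n)"
  have "((\<lambda>x. ?c * (f x * \<gamma>1 x - D1 l f x * \<gamma> x)) \<longlongrightarrow> ?c * 0) at_top"
    by (intro tendsto_intros wronskian_gamma_limit f)
  moreover have "eventually (\<lambda>x. ?c * (f x * \<gamma>1 x - D1 l f x * \<gamma> x) = f x * green_op_deriv (trunc n H) x - D1 l f x * green_op (trunc n H) x) at_top"
    using eventually_ge_at_top[of "l + real n"]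
  proof eventually_elim
    case (elim x)
    have t: "green_op (trunc n H) x = ?c * \<gamma> x" "green_op_deriv (trunc n H) x = ?c * \<gamma>1 x" using green_op_trunc_tail[OF H elim] by auto
    show ?case unfolding t by (simp add: algebra_simps)
  qed
  ultimately have "((\<lambda>x. f x * green_op_deriv (trunc n H) x - D1 l f x * green_op (trunc n H) x) \<longlongrightarrow> ?c * 0) at_top"
    by (rule Lim_transform_eventually)
  from tendsto_unique[OF _ this boundary_form_limit[OF f trunc_L2(1)[OF H]]] show ?thesis by simp
qed

lemma norm_sq_trunc_tail:
  assumes H: "H \<in> L2 l"
  shows "(\<lambda>n. norm_sq l (\<lambda>x. H x - trunc n H x)) \<longlonglongrightarrow> 0"
proof -
  have "(\<lambda>x. H x - trunc n H x) = (\<lambda>x. indicator {l + real n<..} x *\<^sub>R H x)" for n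
    by (auto simp: indicator_def fun_eq_iff)
  then show ?thesis
    using norm_sq_tail[OF H filterlim_tendsto_add_at_top[OF tendsto_const filterlim_real_sequentially], of l]
    by (simp only:)
qed

text \<open>The form is bounded and vanishes on the truncations, which are dense.\<close>

lemma boundary_form_zero:
  assumes f: "f \<in> Dstar l q" and H: "H \<in> L2 l"
  shows "boundary_form f H = 0"
proof -
  let ?K = "cmod (f l) * sqrt (norm_sq l \<gamma>) + sqrt (norm_sq l (diff_expr l q f)) + 2 * sqrt (norm_sq l f)"
  have le: "cmod (boundary_form f H) \<le> ?K * sqrt (norm_sq l (\<lambda>x. H x - trunc n H x))" for n
    using boundary_form_bound[OF f L2_diff[OF H trunc_L2(1)[OF H, of n]]]
      boundary_form_diff[OF f H trunc_L2(1)[OF H, of n]] boundary_form_trunc[OF f H, of n] by simp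
  have "(\<lambda>n. ?K * sqrt (norm_sq l (\<lambda>x. H x - trunc n H x))) \<longlonglongrightarrow> ?K * sqrt 0"
    by (intro tendsto_intros norm_sq_trunc_tail H)
  from LIMSEQ_le_const[OF this] le have "cmod (boundary_form f H) \<le> ?K * sqrt 0" by blast
  then show ?thesis by simp
qed

theorem limit_point:
  assumes f: "f \<in> Dstar l q" and g: "g \<in> Dstar l q"
  shows "((\<lambda>x. f x * D1 l g x - D1 l f x * g x) \<longlongrightarrow> 0) at_top"
proof -
  obtain G c where G: "G \<in> L2 l" and gx: "\<And>x. x \<ge> l \<Longrightarrow> g x = green_op G x + c * \<gamma> x \<and> D1 l g x = green_op_deriv G x + c * \<gamma>1 x"
    using Dstar_decomposition[OF g] by blast
  have "((\<lambda>x. (f x * green_op_deriv G x - D1 l f x * green_op G x) + c * (f x * \<gamma>1 x - D1 l f x * \<gamma> x)) \<longlongrightarrow> boundary_form f G + c * 0) at_top"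
    by (intro tendsto_intros boundary_form_limit wronskian_gamma_limit f G)
  moreover have "eventually (\<lambda>x. (f x * green_op_deriv G x - D1 l f x * green_op G x) + c * (f x * \<gamma>1 x - D1 l f x * \<gamma> x) = f x * D1 l g x - D1 l f x * g x) at_top"
    using eventually_ge_at_top[of l] by eventually_elim (simp add: gx algebra_simps)
  ultimately have "((\<lambda>x. f x * D1 l g x - D1 l f x * g x) \<longlongrightarrow> boundary_form f G + c * 0) at_top"
    by (rule Lim_transform_eventually)
  then show ?thesis using boundary_form_zero[OF f G] by simp
qed

theorem Green:
  assumes f: "f \<in> Dstar l q" and g: "g \<in> Dstar l q"
  shows "(LINT x|half_line l. diff_expr l q f x * g x - f x * diff_expr l q g x) = D1 l f l * g l - f l * D1 l g l"
proof -
  have "integrable (half_line l) (\<lambda>x. diff_expr l q f x * g x - f x * diff_expr l q g x)"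
    by (intro Bochner_Integration.integrable_diff L2_mult_integrable DstarD[OF f] DstarD[OF g])
  from has_ac_derivative_limit[OF sturm_liouville_wronskian[OF DstarD(1)[OF f] DstarD(1)[OF g]] this]
  have "(f l * D1 l g l - D1 l f l * g l) + (LINT x|half_line l. diff_expr l q f x * g x - f x * diff_expr l q g x) = 0"
    by (rule tendsto_unique[OF trivial_limit_at_top_linorder _ limit_point[OF f g]])
  moreover have "D1 l f l * g l - f l * D1 l g l = - (f l * D1 l g l - D1 l f l * g l)" by simp
  ultimately show ?thesis by (metis add.inverse_unique)
qed

lemma solvable_at_i:
  assumes F: "F \<in> L2 l"
  shows "\<exists>w\<in>Dstar l q. w l = 0 \<and> (AE x in half_line l. diff_expr l q w x = \<i> * w x + F x)"
  using green_op_Dstar[OF F] green_op_l(1)[of F] sturm_liouville_imp_AC2(3)[OF green_op_sl[OF F]] unfolding AE_half_line by blast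

end

section \<open>Green's formula for the Weyl problem\<close>

text \<open>Linear combinations come in pairs because \<open>diff_expr\<close> is linear only almost everywhere; one pass handles
sums, multiples and differences.\<close>

lemma Dstar_comb:
  assumes y: "y \<in> Dstar l q" and z: "z \<in> Dstar l q"
  shows "(\<lambda>x. a * y x + b * z x) \<in> Dstar l q"
    "x \<ge> l \<Longrightarrow> D1 l (\<lambda>x. a * y x + b * z x) x = a * D1 l y x + b * D1 l z x"
    "AE x in half_line l. diff_expr l q (\<lambda>x. a * y x + b * z x) x = a * diff_expr l q y x + b * diff_expr l q z x"
proof -
  note sl = sturm_liouville_add[OF sturm_liouville_cmult[OF DstarD(1)[OF y], of a] sturm_liouville_cmult[OF DstarD(1)[OF z], of b]]
  show "(\<lambda>x. a * y x + b * z x) \<in> Dstar l q"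
    by (rule DstarI[OF sl]) (simp_all add: L2_add L2_cmult DstarD[OF y] DstarD[OF z])
  show "x \<ge> l \<Longrightarrow> D1 l (\<lambda>x. a * y x + b * z x) x = a * D1 l y x + b * D1 l z x"
    by (rule sturm_liouville_imp_AC2(2)[OF sl])
  show "AE x in half_line l. diff_expr l q (\<lambda>x. a * y x + b * z x) x = a * diff_expr l q y x + b * diff_expr l q z x"
    unfolding AE_half_line by (rule sturm_liouville_imp_AC2(3)[OF sl])
qed

lemma Dstar_cnj:
  assumes y: "y \<in> Dstar l q"
  shows "(\<lambda>x. cnj (y x)) \<in> Dstar l q"
    "x \<ge> l \<Longrightarrow> D1 l (\<lambda>x. cnj (y x)) x = cnj (D1 l y x)"
    "AE x in half_line l. diff_expr l q (\<lambda>x. cnj (y x)) x = cnj (diff_expr l q y x)"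
proof -
  note sl = sturm_liouville_cnj[OF DstarD(1)[OF y]]
  show "(\<lambda>x. cnj (y x)) \<in> Dstar l q"
    by (rule DstarI[OF sl]) (simp_all add: DstarD[OF y])
  show "x \<ge> l \<Longrightarrow> D1 l (\<lambda>x. cnj (y x)) x = cnj (D1 l y x)"
    by (rule sturm_liouville_imp_AC2(2)[OF sl])
  show "AE x in half_line l. diff_expr l q (\<lambda>x. cnj (y x)) x = cnj (diff_expr l q y x)"
    unfolding AE_half_line by (rule sturm_liouville_imp_AC2(3)[OF sl])
qed

text \<open>Continuity turns vanishing almost everywhere into vanishing.\<close>

lemma norm_sq_eq_0:
  assumes f: "f \<in> L2 l" "continuous_on {l..} f" and 0: "norm_sq l f = 0" and x: "x \<ge> l"
  shows "f x = 0"
proof -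
  have i: "integrable (half_line l) (\<lambda>x. (cmod (f x))\<^sup>2)" using f(1) by (simp add: L2_iff)
  have "AE x in half_line l. (cmod (f x))\<^sup>2 = 0"
    using 0 integral_nonneg_eq_0_iff_AE[OF i] by (simp add: norm_sq_def)
  then have ae: "AE x in lebesgue. x \<ge> l \<longrightarrow> (cmod (f x))\<^sup>2 = 0" unfolding AE_half_line .
  then obtain N where N: "negligible N" "{x. \<not> (x \<ge> l \<longrightarrow> (cmod (f x))\<^sup>2 = 0)} \<subseteq> N"
    by (auto simp: eventually_ae_filter_negligible)
  have "integral {l..x+1} (\<lambda>x. (cmod (f x))\<^sup>2) = integral {l..x+1} (\<lambda>x. 0)"
    by (rule integral_spike[OF N(1)]) (use N(2) in auto)
  then have z: "integral {l..x+1} (\<lambda>x. (cmod (f x))\<^sup>2) = 0" by simp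
  have c: "continuous_on {l..x+1} (\<lambda>x. (cmod (f x))\<^sup>2)"
    by (intro continuous_intros continuous_on_subset[OF f(2)]) auto
  have "\<forall>t\<in>{l..x+1}. (cmod (f t))\<^sup>2 = 0"
    using integral_eq_0_iff[OF c] z x by auto
  then show ?thesis using x by auto
qed

lemma inner_integrable: "f \<in> L2 l \<Longrightarrow> g \<in> L2 l \<Longrightarrow> integrable (half_line l) (\<lambda>x. f x * cnj (g x))"
  by (rule L2_mult_integrable) simp_all

lemma inner_L2_self: "f \<in> L2 l \<Longrightarrow> inner_L2 l f f = of_real (norm_sq l f)"
  unfolding inner_L2_eq norm_sq_def complex_norm_square[symmetric] by (rule integral_of_real) (simp add: L2_iff)

lemma inner_L2_commute: "inner_L2 l g f = cnj (inner_L2 l f g)"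
proof -
  have "cnj (inner_L2 l f g) = (LINT x|half_line l. cnj (f x * cnj (g x)))"
    unfolding inner_L2_eq by (rule Bochner_Integration.integral_cnj[symmetric])
  then show ?thesis by (simp add: inner_L2_eq mult.commute)
qed

lemma inner_L2_cong_AE:
  assumes "f \<in> L2 l" "f' \<in> L2 l" "g \<in> L2 l" "AE x in half_line l. f x = f' x"
  shows "inner_L2 l f g = inner_L2 l f' g"
  unfolding inner_L2_eq
proof (rule integral_cong_AE)
  show "AE x in half_line l. f x * cnj (g x) = f' x * cnj (g x)"
    using assms(4) by eventually_elim simp
qed (use borel_measurable_integrable[OF inner_integrable] assms in auto)

lemma inner_L2_comb:
  assumes "f \<in> L2 l" "g \<in> L2 l" "h \<in> L2 l"
  shows "inner_L2 l (\<lambda>x. a * f x + b * g x) h = a * inner_L2 l f h + b * inner_L2 l g h"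
proof -
  have "inner_L2 l (\<lambda>x. a * f x + b * g x) h = (LINT x|half_line l. a * (f x * cnj (h x)) + b * (g x * cnj (h x)))"
    unfolding inner_L2_eq by (simp add: algebra_simps)
  also have "\<dots> = (LINT x|half_line l. a * (f x * cnj (h x))) + (LINT x|half_line l. b * (g x * cnj (h x)))"
    by (intro Bochner_Integration.integral_add integrable_mult_right inner_integrable assms)
  finally show ?thesis by (simp only: integral_mult_right_zero inner_L2_eq)
qed

text \<open>The hypotheses of the theorem. The Weyl function is given only pointwise, through the existence of
solutions; its uniqueness, symmetry and analyticity are consequences.\<close>

locale weyl_problem =
  fixes l :: real and q :: "real \<Rightarrow> real" and m :: "complex \<Rightarrow> complex"
  assumes q_summable: "locally_summable l q" and indices: "deficiency_indices_1_1 l q"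
    and weyl: "weyl_function l q m"
begin

lemma solves_sturm_liouville:
  assumes "solves l q \<zeta> y"
  shows "sturm_liouville l q y (D1 l y) (\<lambda>x. \<zeta> * y x)"
  by (rule sturm_liouville_cong[OF AC2_imp_sturm_liouville]) (use assms in \<open>auto simp: solves_def\<close>)

lemma weyl_solutions:
  assumes "Im \<zeta> \<noteq> 0"
  obtains \<gamma> \<gamma>1 \<phi> \<phi>1 where
    "sturm_liouville l q \<gamma> \<gamma>1 (\<lambda>x. \<zeta> * \<gamma> x)" "\<gamma> \<in> L2 l" "\<gamma> l = 1" "\<gamma>1 l = - m \<zeta>"
    "sturm_liouville l q \<phi> \<phi>1 (\<lambda>x. \<zeta> * \<phi> x)" "\<phi> l = 0" "\<phi>1 l = 1"
proof -
  obtain \<phi>1 \<phi>2 where \<phi>: "solves l q \<zeta> \<phi>1" "\<phi>1 l = 0" "D1 l \<phi>1 l = 1"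
     "solves l q \<zeta> \<phi>2" "\<phi>2 l = -1" "D1 l \<phi>2 l = 0" "(\<lambda>x. \<phi>2 x + m \<zeta> * \<phi>1 x) \<in> L2 l"
    using weyl assms unfolding weyl_function_def by blast
  have sl: "sturm_liouville l q (\<lambda>x. (-1) * (\<phi>2 x + m \<zeta> * \<phi>1 x)) (\<lambda>x. (-1) * (D1 l \<phi>2 x + m \<zeta> * D1 l \<phi>1 x))
      (\<lambda>x. (-1) * (\<zeta> * \<phi>2 x + m \<zeta> * (\<zeta> * \<phi>1 x)))"
    by (intro sturm_liouville_cmult sturm_liouville_add solves_sturm_liouville \<phi>)
  have "sturm_liouville l q (\<lambda>x. (-1) * (\<phi>2 x + m \<zeta> * \<phi>1 x)) (\<lambda>x. (-1) * (D1 l \<phi>2 x + m \<zeta> * D1 l \<phi>1 x))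
      (\<lambda>x. \<zeta> * ((-1) * (\<phi>2 x + m \<zeta> * \<phi>1 x)))"
    by (rule sturm_liouville_cong[OF sl]) (auto simp: algebra_simps)
  from that[OF this L2_cmult[OF \<phi>(7)] _ _ solves_sturm_liouville[OF \<phi>(1)]] show ?thesis
    using \<phi> by simp
qed

text \<open>The defect number being 1 is used in the form that any two square integrable solutions at \<open>\<i>\<close> are
multiples of one function.\<close>

lemma defect_dependent:
  assumes u: "sturm_liouville l q u u1 (\<lambda>x. \<i> * u x)" "u \<in> L2 l" and v: "sturm_liouville l q v v1 (\<lambda>x. \<i> * v x)" "v \<in> L2 l"
  shows "\<exists>b \<alpha> \<beta>. \<forall>x\<ge>l. u x = \<alpha> * b x \<and> v x = \<beta> * b x"
proof -
  define N where "N = {y \<in> Dstar l q. solves l q \<i> y}"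
  interpret V: vector_space "\<lambda>(c::complex) (f::real \<Rightarrow> complex) x. c * f x"
    by unfold_locales (auto simp: algebra_simps fun_eq_iff)
  have "V.dim N = 1"
    using indices unfolding deficiency_indices_1_1_def defect_number_def N_def by simp
  then obtain B where B: "B \<subseteq> N" "N \<subseteq> V.span B" "card B = 1"
    using V.basis_exists[of N] by metis
  then obtain b where b: "B = {b}" by (auto simp: card_1_singleton_iff)
  have cut: "\<exists>\<alpha>. \<forall>x\<ge>l. y x = \<alpha> * b x" if y: "sturm_liouville l q y y1 (\<lambda>x. \<i> * y x)" "y \<in> L2 l" for y y1
  proof -
    let ?y = "\<lambda>x. if x < l then 0 else y x"
    have sl: "sturm_liouville l q ?y y1 (\<lambda>x. \<i> * ?y x)"
      by (rule sturm_liouville_cong[OF y(1)]) auto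
    have L2: "?y \<in> L2 l" by (rule L2_cong_AE[OF y(2)]) (auto simp: AE_half_line)
    have "?y \<in> N" unfolding N_def
      using DstarI[OF sl L2 L2_cmult[OF L2]] sturm_liouville_imp_AC2(1,3)[OF sl] by (simp add: solves_def)
    then have "?y \<in> V.span {b}" using B b by auto
    then obtain \<alpha> where "?y = (\<lambda>x. \<alpha> * b x)" unfolding V.span_singleton by auto
    then have "y x = \<alpha> * b x" if "x \<ge> l" for x
      using that by (metis linorder_not_less)
    then show ?thesis by blast
  qed
  show ?thesis using cut[OF u] cut[OF v] by blast
qed

text \<open>If \<open>\<phi>\<close> were square integrable it would be proportional to \<open>\<gamma>\<close>, against \<open>\<phi>(l) = 0\<close>, \<open>\<phi>'(l) = 1\<close> and
\<open>\<gamma>(l) = 1\<close>.\<close>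

lemma limit_point_exists: "\<exists>\<gamma> \<gamma>1 \<phi> \<phi>1. limit_point_at l q \<gamma> \<gamma>1 \<phi> \<phi>1"
proof -
  obtain \<gamma> \<gamma>1 \<phi> \<phi>1 where s:
    "sturm_liouville l q \<gamma> \<gamma>1 (\<lambda>x. \<i> * \<gamma> x)" "\<gamma> \<in> L2 l" "\<gamma> l = 1" "\<gamma>1 l = - m \<i>"
    "sturm_liouville l q \<phi> \<phi>1 (\<lambda>x. \<i> * \<phi> x)" "\<phi> l = 0" "\<phi>1 l = 1"
    by (rule weyl_solutions[of \<i>]) auto
  have "\<phi> \<notin> L2 l"
  proof
    assume "\<phi> \<in> L2 l"
    then obtain b \<alpha> \<beta> where b: "\<And>x. x \<ge> l \<Longrightarrow> \<gamma> x = \<alpha> * b x \<and> \<phi> x = \<beta> * b x"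
      using defect_dependent[OF s(1,2,5)] by blast
    have "\<beta> = 0" using b[of l] s(3,6) by auto
    then have "\<phi> x = 0" if "x \<ge> l" for x using b[OF that] by simp
    then have "has_ac_derivative l \<phi> (\<lambda>x. 0)"
      by (intro has_ac_derivative_cong[OF has_ac_derivative_const[of l 0]]) auto
    then have "D1 l \<phi> l = 0"
      by (rule has_ac_derivative_vector_derivative(2)) auto
    moreover have "D1 l \<phi> l = 1"
      using sturm_liouville_imp_AC2(2)[OF s(5), of l] s(7) by simp
    ultimately show False by simp
  qed
  with s have "limit_point_at l q \<gamma> \<gamma>1 \<phi> \<phi>1" by unfold_locales
  then show ?thesis by blast
qed

lemma Green_formula:
  assumes "y \<in> Dstar l q" "w \<in> Dstar l q"
  shows "inner_L2 l (diff_expr l q y) w - inner_L2 l y (diff_expr l q w) = D1 l y l * cnj (w l) - y l * cnj (D1 l w l)"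
proof -
  obtain \<gamma> \<gamma>1 \<phi> \<phi>1 where "limit_point_at l q \<gamma> \<gamma>1 \<phi> \<phi>1" using limit_point_exists by blast
  then interpret limit_point_at l q \<gamma> \<gamma>1 \<phi> \<phi>1 .
  note yD = DstarD[OF assms(1)] and wD = DstarD[OF assms(2)] and wc = Dstar_cnj[OF assms(2)]
  have "AE x in half_line l. diff_expr l q y x * cnj (w x) - y x * cnj (diff_expr l q w x) =
      diff_expr l q y x * cnj (w x) - y x * diff_expr l q (\<lambda>x. cnj (w x)) x"
    using wc(3) by eventually_elim simp
  then have "(LINT x|half_line l. diff_expr l q y x * cnj (w x) - y x * cnj (diff_expr l q w x)) =
     (LINT x|half_line l. diff_expr l q y x * cnj (w x) - y x * diff_expr l q (\<lambda>x. cnj (w x)) x)"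
    by (intro integral_cong_AE borel_measurable_integrable Bochner_Integration.integrable_diff inner_integrable L2_mult_integrable
        yD wD DstarD[OF wc(1)])
  also have "\<dots> = D1 l y l * cnj (w l) - y l * cnj (D1 l w l)"
    using Green[OF assms(1) wc(1)] wc(2)[of l] by simp
  finally show ?thesis
    using Bochner_Integration.integral_diff[OF inner_integrable[OF yD(3) wD(2)] inner_integrable[OF yD(2) wD(3)]]
    by (simp only: inner_L2_eq)
qed

lemma solvable:
  assumes F: "F \<in> L2 l"
  obtains w where "w \<in> Dstar l q" "w l = 0" "AE x in half_line l. diff_expr l q w x = \<i> * w x + F x"
proof -
  obtain \<gamma> \<gamma>1 \<phi> \<phi>1 where "limit_point_at l q \<gamma> \<gamma>1 \<phi> \<phi>1" using limit_point_exists by blast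
  then interpret limit_point_at l q \<gamma> \<gamma>1 \<phi> \<phi>1 .
  show ?thesis using solvable_at_i[OF F] that by blast
qed

section \<open>Weyl solutions\<close>

text \<open>The solution is minus \<open>\<phi>\<^sub>2 + m \<phi>\<^sub>1\<close>, normalized to the value 1 at \<open>l\<close>, so that \<open>- m\<close> is its
logarithmic derivative there.\<close>

definition is_weyl_sol :: "complex \<Rightarrow> (real \<Rightarrow> complex) \<Rightarrow> bool" where
  "is_weyl_sol \<zeta> y \<longleftrightarrow> y \<in> Dstar l q \<and> sturm_liouville l q y (D1 l y) (\<lambda>x. \<zeta> * y x) \<and>
     (AE x in half_line l. diff_expr l q y x = \<zeta> * y x) \<and> y l = 1 \<and> D1 l y l = - m \<zeta>"

definition weyl_solution :: "complex \<Rightarrow> real \<Rightarrow> complex" where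
  "weyl_solution \<zeta> = (SOME y. is_weyl_sol \<zeta> y)"

lemma weyl_solution:
  assumes "Im \<zeta> \<noteq> 0"
  shows "weyl_solution \<zeta> \<in> Dstar l q" "sturm_liouville l q (weyl_solution \<zeta>) (D1 l (weyl_solution \<zeta>)) (\<lambda>x. \<zeta> * weyl_solution \<zeta> x)"
    "AE x in half_line l. diff_expr l q (weyl_solution \<zeta>) x = \<zeta> * weyl_solution \<zeta> x"
    "weyl_solution \<zeta> l = 1" "D1 l (weyl_solution \<zeta>) l = - m \<zeta>" "weyl_solution \<zeta> \<in> L2 l"
proof -
  obtain \<gamma> \<gamma>1 \<phi> \<phi>1 where s:
    "sturm_liouville l q \<gamma> \<gamma>1 (\<lambda>x. \<zeta> * \<gamma> x)" "\<gamma> \<in> L2 l" "\<gamma> l = 1" "\<gamma>1 l = - m \<zeta>"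
    "sturm_liouville l q \<phi> \<phi>1 (\<lambda>x. \<zeta> * \<phi> x)" "\<phi> l = 0" "\<phi>1 l = 1"
    by (rule weyl_solutions[OF assms])
  let ?y = "\<lambda>x. if x < l then 0 else \<gamma> x"
  have sl: "sturm_liouville l q ?y \<gamma>1 (\<lambda>x. \<zeta> * ?y x)"
    by (rule sturm_liouville_cong[OF s(1)]) auto
  have L2: "?y \<in> L2 l" by (rule L2_cong_AE[OF s(2)]) (auto simp: AE_half_line)
  have "is_weyl_sol \<zeta> ?y"
    unfolding is_weyl_sol_def
  proof (intro conjI)
    show "?y \<in> Dstar l q" by (rule DstarI[OF sl L2 L2_cmult[OF L2]]) simp
    show "sturm_liouville l q ?y (D1 l ?y) (\<lambda>x. \<zeta> * ?y x)"
      by (rule sturm_liouville_cong[OF sl]) (simp_all add: sturm_liouville_imp_AC2(2)[OF sl])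
    show "AE x in half_line l. diff_expr l q ?y x = \<zeta> * ?y x"
      unfolding AE_half_line by (rule sturm_liouville_imp_AC2(3)[OF sl])
    show "D1 l ?y l = - m \<zeta>" using sturm_liouville_imp_AC2(2)[OF sl, of l] s(4) by simp
  qed (simp add: s(3))
  then have "is_weyl_sol \<zeta> (weyl_solution \<zeta>)" unfolding weyl_solution_def by (rule someI[where P="is_weyl_sol \<zeta>"])
  then show "weyl_solution \<zeta> \<in> Dstar l q" "sturm_liouville l q (weyl_solution \<zeta>) (D1 l (weyl_solution \<zeta>)) (\<lambda>x. \<zeta> * weyl_solution \<zeta> x)"
    "AE x in half_line l. diff_expr l q (weyl_solution \<zeta>) x = \<zeta> * weyl_solution \<zeta> x"
    "weyl_solution \<zeta> l = 1" "D1 l (weyl_solution \<zeta>) l = - m \<zeta>" "weyl_solution \<zeta> \<in> L2 l"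
    using DstarD(2) by (auto simp: is_weyl_sol_def)
qed

lemma inner_eigen:
  assumes y: "y \<in> Dstar l q" "AE x in half_line l. diff_expr l q y x = \<zeta> * y x" and w: "w \<in> L2 l"
  shows "inner_L2 l (diff_expr l q y) w = \<zeta> * inner_L2 l y w"
proof -
  have "inner_L2 l (diff_expr l q y) w = inner_L2 l (\<lambda>x. \<zeta> * y x) w"
    by (rule inner_L2_cong_AE) (use y w DstarD[OF y(1)] in \<open>auto intro: L2_cmult\<close>)
  then show ?thesis by (simp add: inner_L2_eq mult.assoc)
qed

text \<open>The difference from the Weyl solution with the same value at \<open>l\<close> satisfies the Dirichlet condition, so Green's
formula makes the number \<open>\<zeta> \<parallel>v\<parallel>\<^sup>2\<close> real.\<close>

lemma eigen_unique:
  assumes y: "y \<in> Dstar l q" "AE x in half_line l. diff_expr l q y x = \<zeta> * y x" and \<zeta>: "Im \<zeta> \<noteq> 0"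
  shows "y x = y l * weyl_solution \<zeta> x"
proof (cases "x < l")
  case True
  then show ?thesis using DstarD(4)[OF y(1)] DstarD(4)[OF weyl_solution(1)[OF \<zeta>]] by simp
next
  case False
  define v where "v = (\<lambda>x. 1 * y x + (- y l) * weyl_solution \<zeta> x)"
  note c = Dstar_comb[OF y(1) weyl_solution(1)[OF \<zeta>], where a=1 and b="- y l", folded v_def]
  have vl: "v l = 0" by (simp add: v_def weyl_solution(4)[OF \<zeta>])
  have ve: "AE x in half_line l. diff_expr l q v x = \<zeta> * v x"
    using c(3) y(2) weyl_solution(3)[OF \<zeta>] by eventually_elim (simp add: v_def algebra_simps)
  note vD = DstarD[OF c(1)]
  have "inner_L2 l (diff_expr l q v) v - inner_L2 l v (diff_expr l q v) = 0"
    using Green_formula[OF c(1) c(1)] vl by simp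
  moreover have "inner_L2 l (diff_expr l q v) v = \<zeta> * of_real (norm_sq l v)"
    using inner_eigen[OF c(1) ve vD(2)] inner_L2_self[OF vD(2)] by simp
  moreover have "inner_L2 l v (diff_expr l q v) = cnj (\<zeta> * of_real (norm_sq l v))"
    using inner_L2_commute[of l v "diff_expr l q v"] \<open>inner_L2 l (diff_expr l q v) v = _\<close> by simp
  ultimately have "Im (\<zeta> * of_real (norm_sq l v)) = 0" by (simp add: complex_eq_iff)
  then have "norm_sq l v = 0" using \<zeta> by simp
  from norm_sq_eq_0[OF vD(2) sturm_liouvilleD(3)[OF vD(1)] this, of x] False
  show ?thesis by (simp add: v_def)
qed

text \<open>Green's formula for two Weyl solutions: the boundary term is \<open>- m(z) + cnj (m(w))\<close>. Symmetry of \<open>m\<close> (take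
\<open>w = cnj z\<close>) and the sign of its imaginary part (take \<open>w = z\<close>) are special cases.\<close>

lemma weyl_kernel:
  assumes z: "Im z \<noteq> 0" "Im w \<noteq> 0"
  shows "(z - cnj w) * inner_L2 l (weyl_solution z) (weyl_solution w) = cnj (m w) - m z"
proof -
  have a: "inner_L2 l (diff_expr l q (weyl_solution z)) (weyl_solution w) = z * inner_L2 l (weyl_solution z) (weyl_solution w)"
    by (rule inner_eigen) (rule weyl_solution[OF z(1)] weyl_solution[OF z(2)])+
  have "inner_L2 l (diff_expr l q (weyl_solution w)) (weyl_solution z) = w * inner_L2 l (weyl_solution w) (weyl_solution z)"
    by (rule inner_eigen) (rule weyl_solution[OF z(1)] weyl_solution[OF z(2)])+
  then have b: "inner_L2 l (weyl_solution z) (diff_expr l q (weyl_solution w)) = cnj w * inner_L2 l (weyl_solution z) (weyl_solution w)"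
    using inner_L2_commute[of l "weyl_solution z" "diff_expr l q (weyl_solution w)"] inner_L2_commute[of l "weyl_solution z" "weyl_solution w"] by simp
  show ?thesis
    using Green_formula[OF weyl_solution(1)[OF z(1)] weyl_solution(1)[OF z(2)]] unfolding a b weyl_solution(4,5)[OF z(1)] weyl_solution(4,5)[OF z(2)]
    by (simp add: algebra_simps)
qed

lemma m_cnj: "Im z \<noteq> 0 \<Longrightarrow> m (cnj z) = cnj (m z)"
  using weyl_kernel[of z "cnj z"] by (simp add: complex_eq_iff)

lemma Im_m: "Im z \<noteq> 0 \<Longrightarrow> - Im (m z) = Im z * norm_sq l (weyl_solution z)"
  using weyl_kernel[of z z] inner_L2_self[OF weyl_solution(6), of z] by (simp add: complex_eq_iff)

lemma norm_sq_weyl_solution_pos: "Im z \<noteq> 0 \<Longrightarrow> norm_sq l (weyl_solution z) > 0"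
proof -
  assume z: "Im z \<noteq> 0"
  have "norm_sq l (weyl_solution z) \<noteq> 0"
    using norm_sq_eq_0[OF weyl_solution(6)[OF z] sturm_liouvilleD(3)[OF weyl_solution(2)[OF z]], of l] weyl_solution(4)[OF z] by auto
  then show ?thesis using norm_sq_nonneg[of l "weyl_solution z"] by simp
qed

lemma Im_m_nonzero: "Im z \<noteq> 0 \<Longrightarrow> Im (m z) \<noteq> 0"
  using Im_m[of z] norm_sq_weyl_solution_pos[of z] by auto

lemma Im_m_neg: "Im z > 0 \<Longrightarrow> Im (m z) < 0"
  using Im_m[of z] norm_sq_weyl_solution_pos[of z] mult_pos_pos[of "Im z" "norm_sq l (weyl_solution z)"] by linarith

section \<open>Resolvents of rank-one boundary perturbations\<close>

text \<open>The functions in \<open>Dstar\<close> with a real boundary condition at \<open>l\<close> are dense: if \<open>F\<close> is orthogonal to all of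
them, solve \<open>- w'' + q w - \<i> w = F\<close> under this condition. Then \<open>- w'' + q w\<close> pairs with \<open>w\<close> to
\<open>\<i> \<parallel>w\<parallel>\<^sup>2\<close>, whereas the symmetric boundary condition makes the pairing real. The right-hand
side with the factor \<open>c\<close> covers, in one statement, the functionals that arise from the boundary term of the operators.\<close>

lemma boundary_condition_dense:
  fixes e0 e1 :: real
  assumes F: "F \<in> L2 l" and e: "e0 \<noteq> 0 \<or> e1 \<noteq> 0"
    and orth: "\<And>w. w \<in> Dstar l q \<Longrightarrow> inner_L2 l F w = c * cnj (of_real e0 * w l + of_real e1 * D1 l w l)"
  shows "AE x in half_line l. F x = 0" "c = 0"
proof -
  have mi: "Im (m \<i>) \<noteq> 0" by (rule Im_m_nonzero) simp
  have ne: "of_real e0 - of_real e1 * m \<i> \<noteq> 0"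
    using e mi by (auto simp: complex_eq_iff)
  have i: "Im \<i> \<noteq> 0" by simp
  obtain w0 where w0: "w0 \<in> Dstar l q" "w0 l = 0" "AE x in half_line l. diff_expr l q w0 x = \<i> * w0 x + F x"
    by (rule solvable[OF F])
  \<comment> \<open>this multiple of the Weyl solution restores the boundary condition; it is defined since \<open>m(\<i>)\<close> is not real\<close>
  define s where "s = - (of_real e1 * D1 l w0 l) / (of_real e0 - of_real e1 * m \<i>)"
  define w where "w = (\<lambda>x. 1 * w0 x + s * weyl_solution \<i> x)"
  note cb = Dstar_comb[OF w0(1) weyl_solution(1)[OF i], where a=1 and b=s, folded w_def]
  note wD = DstarD[OF cb(1)]
  have ew: "of_real e0 * w l + of_real e1 * D1 l w l = 0"
    unfolding w_def[symmetric] cb(2)[OF order_refl] using ne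
    by (simp add: w_def w0(2) weyl_solution[OF i] s_def field_simps)
  have lw: "AE x in half_line l. diff_expr l q w x = \<i> * w x + 1 * F x"
    using cb(3) w0(3) weyl_solution(3)[OF i] by eventually_elim (simp add: w_def algebra_simps)
  have "inner_L2 l (diff_expr l q w) w = inner_L2 l (\<lambda>x. \<i> * w x + 1 * F x) w"
    by (rule inner_L2_cong_AE[OF wD(3) _ wD(2) lw]) (intro L2_add L2_cmult wD F)
  also have "\<dots> = \<i> * of_real (norm_sq l w)"
    unfolding inner_L2_comb[OF wD(2) F wD(2)] inner_L2_self[OF wD(2)] orth[OF cb(1)] ew by simp
  finally have 1: "inner_L2 l (diff_expr l q w) w = \<i> * of_real (norm_sq l w)" .
  have 2: "inner_L2 l w (diff_expr l q w) = - \<i> * of_real (norm_sq l w)"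
    using inner_L2_commute[of l w "diff_expr l q w"] 1 by simp
  have 3: "D1 l w l * cnj (w l) - w l * cnj (D1 l w l) = 0"
  proof (cases "e1 = 0")
    case True
    then show ?thesis using ew e by simp
  next
    case False
    then have "D1 l w l = of_real (- e0 / e1) * w l" using ew by (simp add: field_simps eq_neg_iff_add_eq_0)
    then show ?thesis by simp
  qed
  have "2 * \<i> * of_real (norm_sq l w) = 0"
    using Green_formula[OF cb(1) cb(1)] unfolding 1 2 3 by simp
  then have "norm_sq l w = 0" by simp
  then have w_0: "w x = 0" if "x \<ge> l" for x
    using norm_sq_eq_0[OF wD(2) sturm_liouvilleD(3)[OF wD(1)]] that by simp
  have "has_ac_derivative l w (\<lambda>x. 0)"
    by (rule has_ac_derivative_cong[OF has_ac_derivative_const[of l 0]]) (auto simp: w_0)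
  then have D1_0: "D1 l w x = 0" if "x \<ge> l" for x
    by (rule has_ac_derivative_vector_derivative(2)) (use that in auto)
  have "has_ac_derivative l (D1 l w) (\<lambda>x. 0)"
    by (rule has_ac_derivative_cong[OF has_ac_derivative_const[of l 0]]) (auto simp: D1_0)
  from has_ac_derivative_unique[OF this sturm_liouvilleD(2)[OF wD(1)]]
  have "AE x in half_line l. 0 = of_real (q x) * w x - diff_expr l q w x" unfolding AE_half_line .
  then have "AE x in lebesgue. x \<ge> l \<longrightarrow> F x = 0"
    using lw unfolding AE_half_line by eventually_elim (auto simp: w_0)
  then show F0: "AE x in half_line l. F x = 0" unfolding AE_half_line .
  have "inner_L2 l F (weyl_solution \<i>) = inner_L2 l (\<lambda>x. 0) (weyl_solution \<i>)"
    by (rule inner_L2_cong_AE[OF F _ weyl_solution(6)[OF i] F0]) (simp add: L2_iff)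
  then have "c * cnj (of_real e0 - of_real e1 * m \<i>) = 0"
    using orth[OF weyl_solution(1)[OF i]] by (simp add: inner_L2_eq weyl_solution[OF i])
  then show "c = 0" using ne by (metis complex_cnj_zero_iff mult_eq_0_iff)
qed

text \<open>Both the state-space operator and its real part have the shape assumed here. By density the functional
equation splits into the differential equation, which leaves only multiples of the Weyl solution, and one scalar
equation for the multiple.\<close>

lemma rank_one_resolvent:
  fixes e0 e1 :: real
  assumes z: "Im z \<noteq> 0" and e: "e0 \<noteq> 0 \<or> e1 \<noteq> 0" and ne: "b0 - b1 * m z \<noteq> 0"
    and H: "Hplus \<Theta> = Dstar l q" "Hinner \<Theta> = inner_L2 l"
    and B: "\<And>y w. y \<in> Dstar l q \<Longrightarrow> w \<in> Dstar l q \<Longrightarrow> B y w = inner_L2 l (diff_expr l q y) w -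
      (b0 * y l + b1 * D1 l y l) * cnj (of_real e0 * w l + of_real e1 * D1 l w l)"
    and f: "\<And>w. w \<in> Dstar l q \<Longrightarrow> f w = k * cnj (of_real e0 * w l + of_real e1 * D1 l w l)"
  shows "resolvent \<Theta> B z f = (\<lambda>x. - k / (b0 - b1 * m z) * weyl_solution z x)"
  unfolding resolvent_def H
proof (rule the_equality)
  let ?x = "\<lambda>x. - k / (b0 - b1 * m z) * weyl_solution z x + 0 * weyl_solution z x"
  note cb = Dstar_comb[OF weyl_solution(1)[OF z] weyl_solution(1)[OF z], where a="- k / (b0 - b1 * m z)" and b=0]
  have ae: "AE x in half_line l. diff_expr l q ?x x = z * ?x x"
    using cb(3) weyl_solution(3)[OF z] by eventually_elim simp
  have bx: "b0 * ?x l + b1 * D1 l ?x l = - k"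
  proof -
    have "s * (b0 - b1 * m z) = - k \<Longrightarrow> b0 * s - b1 * (s * m z) = - k" for s
      by (simp add: algebra_simps)
    from this[of "- k / (b0 - b1 * m z)"] show ?thesis
      unfolding cb(2)[OF order_refl] using ne by (simp add: weyl_solution[OF z])
  qed
  have "?x \<in> Dstar l q \<and> (\<forall>w\<in>Dstar l q. B ?x w - z * inner_L2 l ?x w = f w)"
  proof (intro conjI ballI cb(1))
    fix w assume w: "w \<in> Dstar l q"
    show "B ?x w - z * inner_L2 l ?x w = f w"
      unfolding B[OF cb(1) w] f[OF w] bx inner_eigen[OF cb(1) ae DstarD(2)[OF w]] by simp
  qed
  then show "(\<lambda>x. - k / (b0 - b1 * m z) * weyl_solution z x) \<in> Dstar l q \<and>
     (\<forall>w\<in>Dstar l q. B (\<lambda>x. - k / (b0 - b1 * m z) * weyl_solution z x) w - z * inner_L2 l (\<lambda>x. - k / (b0 - b1 * m z) * weyl_solution z x) w = f w)"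
    by simp
next
  fix x assume x: "x \<in> Dstar l q \<and> (\<forall>w\<in>Dstar l q. B x w - z * inner_L2 l x w = f w)"
  note xD = DstarD[of x, OF conjunct1[OF x]]
  define F where "F = (\<lambda>t. 1 * diff_expr l q x t + (- z) * x t)"
  define c where "c = k + (b0 * x l + b1 * D1 l x l)"
  have F: "F \<in> L2 l" unfolding F_def by (intro L2_add L2_cmult xD)
  have orth: "inner_L2 l F w = c * cnj (of_real e0 * w l + of_real e1 * D1 l w l)" if w: "w \<in> Dstar l q" for w
  proof -
    have "B x w - z * inner_L2 l x w = f w" using x w by blast
    then have "inner_L2 l (diff_expr l q x) w - z * inner_L2 l x w = c * cnj (of_real e0 * w l + of_real e1 * D1 l w l)"
      unfolding B[OF conjunct1[OF x] w] f[OF w] c_def by (simp add: algebra_simps)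
    then show ?thesis unfolding F_def inner_L2_comb[OF xD(3) xD(2) DstarD(2)[OF w]] by simp
  qed
  have d: "AE t in half_line l. F t = 0" "c = 0"
    using boundary_condition_dense[OF F e, of c] orth by blast+
  have ae: "AE t in half_line l. diff_expr l q x t = z * x t"
    using d(1) by eventually_elim (simp add: F_def)
  have xe: "x = (\<lambda>t. x l * weyl_solution z t)"
    by (rule ext) (rule eigen_unique[OF conjunct1[OF x] ae z])
  have "D1 l (\<lambda>t. x l * weyl_solution z t + 0 * weyl_solution z t) l = x l * - m z"
    unfolding Dstar_comb(2)[OF weyl_solution(1)[OF z] weyl_solution(1)[OF z] order_refl] by (simp add: weyl_solution[OF z])
  then have "D1 l x l = x l * - m z" by (subst xe) simp
  then have "x l * (b0 - b1 * m z) = - k" using d(2) by (simp add: c_def algebra_simps add_eq_0_iff)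
  then have "x l = - k / (b0 - b1 * m z)" using ne by (metis nonzero_mult_div_cancel_right)
  then show "x = (\<lambda>t. - k / (b0 - b1 * m z) * weyl_solution z t)" using xe by simp
qed

lemma weyl_solution_cmult:
  assumes z: "Im z \<noteq> 0"
  shows "D1 l (\<lambda>x. c * weyl_solution z x) l = - (c * m z)"
  using Dstar_comb(2)[OF weyl_solution(1)[OF z] weyl_solution(1)[OF z] order_refl, of c 0] by (simp add: weyl_solution[OF z])

lemma channel_response:
  fixes e0 e1 k :: real
  assumes z: "Im z \<noteq> 0" and e: "e0 \<noteq> 0 \<or> e1 \<noteq> 0" and ne: "b0 - b1 * m z \<noteq> 0"
    and H: "Hplus \<Theta> = Dstar l q" "Hinner \<Theta> = inner_L2 l"
    and B: "\<And>y w. y \<in> Dstar l q \<Longrightarrow> w \<in> Dstar l q \<Longrightarrow> B y w = inner_L2 l (diff_expr l q y) w -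
      (b0 * y l + b1 * D1 l y l) * cnj (of_real e0 * w l + of_real e1 * D1 l w l)"
    and f: "\<And>w. channel \<Theta> 1 w = of_real k * cnj (of_real e0 * w l + of_real e1 * D1 l w l)"
  shows "channel_adj \<Theta> (resolvent \<Theta> B z (channel \<Theta> 1)) =
    - of_real (k\<^sup>2) * (of_real e0 - of_real e1 * m z) / (b0 - b1 * m z)"
proof -
  define s where "s = - of_real k / (b0 - b1 * m z)"
  have r: "resolvent \<Theta> B z (channel \<Theta> 1) = (\<lambda>x. s * weyl_solution z x)"
    unfolding s_def by (rule rank_one_resolvent[OF z e ne H B f])
  have "channel_adj \<Theta> (resolvent \<Theta> B z (channel \<Theta> 1)) = of_real k * (of_real e0 * s - of_real e1 * (s * m z))"
    unfolding r channel_adj_def unfolding f weyl_solution_cmult[OF z] by (simp add: weyl_solution[OF z])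
  also have "\<dots> = of_real k * s * (of_real e0 - of_real e1 * m z)" by (simp add: algebra_simps)
  finally show ?thesis by (simp add: s_def power2_eq_square)
qed

lemma frac_cancel: "d \<noteq> 0 \<Longrightarrow> a / (d * e) * b / (c / d) = a * b / (e * (c :: complex))"
  by (cases "c = 0"; cases "e = 0") (simp_all add: field_simps)

lemma minus_cancel: "- a * b / (- c) = a * b / (c :: complex)"
  by simp

section \<open>Transfer and impedance functions\<close>

lemma transfer_function_Fin:
  assumes h: "Im h > 0" and z: "Im z \<noteq> 0" and ne: "m z + h \<noteq> 0"
  shows "transfer_function (S_system l q (Fin_mu \<mu>) h) z =
    (of_real \<mu> - h) / (of_real \<mu> - cnj h) * ((m z + cnj h) / (m z + h))"
proof -
  let ?\<Theta> = "S_system l q (Fin_mu \<mu>) h" and ?d = "of_real \<mu> - h" and ?k = "sqrt (Im h) / cmod (of_real \<mu> - h)"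
  have d: "?d \<noteq> 0" "cnj ?d \<noteq> 0" "of_real \<mu> - cnj h \<noteq> 0" using h by (auto simp: complex_eq_iff)
  have k2: "of_real (?k\<^sup>2) = of_real (Im h) / (?d * (of_real \<mu> - cnj h))"
    using h complex_norm_square[of ?d] by (simp add: power_divide)
  have beq: "- h / ?d - 1 / ?d * m z = - ((m z + h) / ?d)" by (simp add: add_divide_distrib)
  have bne: "- h / ?d - 1 / ?d * m z \<noteq> 0"
    unfolding beq using d(1) ne by (simp only: neg_equal_0_iff_equal divide_eq_0_iff) simp
  have "channel_adj ?\<Theta> (resolvent ?\<Theta> (state_op ?\<Theta>) z (channel ?\<Theta> 1)) =
     - of_real (?k\<^sup>2) * (of_real \<mu> - of_real (-1) * m z) / (- h / ?d - 1 / ?d * m z)"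
  proof (rule channel_response[OF z _ bne])
    show "state_op ?\<Theta> y w = inner_L2 l (diff_expr l q y) w - (- h / ?d * y l + 1 / ?d * D1 l y l) * cnj (of_real \<mu> * w l + of_real (-1) * D1 l w l)" for y w
      by (simp add: S_system_def delta_def delta'_def diff_divide_distrib algebra_simps)
  qed (simp_all add: S_system_def delta_def delta'_def)
  also have "\<dots> = of_real (Im h) * (of_real \<mu> + m z) / ((of_real \<mu> - cnj h) * (m z + h))"
    unfolding k2 beq minus_cancel frac_cancel[OF d(1)] by simp
  finally have "transfer_function ?\<Theta> z = 1 - 2 * \<i> * of_real (Im h) * (of_real \<mu> + m z) / ((of_real \<mu> - cnj h) * (m z + h))"
    unfolding transfer_function_def by simp
  also have "2 * \<i> * of_real (Im h) = h - cnj h" by (simp add: complex_eq_iff)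
  also have "1 - (h - cnj h) * (of_real \<mu> + m z) / ((of_real \<mu> - cnj h) * (m z + h)) =
     ((of_real \<mu> - cnj h) * (m z + h) - (h - cnj h) * (of_real \<mu> + m z)) / ((of_real \<mu> - cnj h) * (m z + h))"
    using d ne by (simp add: diff_divide_distrib)
  also have "(of_real \<mu> - cnj h) * (m z + h) - (h - cnj h) * (of_real \<mu> + m z) = ?d * (m z + cnj h)"
    by (simp add: algebra_simps)
  finally show ?thesis by simp
qed

lemma transfer_function_Inf:
  assumes h: "Im h > 0" and z: "Im z \<noteq> 0" and ne: "m z + h \<noteq> 0"
  shows "transfer_function (S_system l q Inf_mu h) z = (m z + cnj h) / (m z + h)"
proof -
  let ?\<Theta> = "S_system l q Inf_mu h"
  have beq: "- h - 1 * m z = - (m z + h)" by simp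
  have bne: "- h - 1 * m z \<noteq> 0" unfolding beq using ne by (simp only: neg_equal_0_iff_equal) simp
  have "channel_adj ?\<Theta> (resolvent ?\<Theta> (state_op ?\<Theta>) z (channel ?\<Theta> 1)) =
     - of_real ((sqrt (Im h))\<^sup>2) * (of_real 1 - of_real 0 * m z) / (- h - 1 * m z)"
  proof (rule channel_response[OF z _ bne])
    show "state_op ?\<Theta> y w = inner_L2 l (diff_expr l q y) w - (- h * y l + 1 * D1 l y l) * cnj (of_real 1 * w l + of_real 0 * D1 l w l)" for y w
      by (simp add: S_system_def delta_def algebra_simps)
  qed (simp_all add: S_system_def delta_def)
  also have "\<dots> = of_real (Im h) / (m z + h)"
    unfolding beq minus_cancel using h by simp
  finally have "transfer_function ?\<Theta> z = 1 - 2 * \<i> * of_real (Im h) / (m z + h)"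
    unfolding transfer_function_def by simp
  also have "2 * \<i> * of_real (Im h) = h - cnj h" by (simp add: complex_eq_iff)
  finally show ?thesis using ne by (simp add: field_simps)
qed

text \<open>The boundary terms of the operator, of its adjoint and of Green's formula add up to twice a term in which
\<open>y(l)\<close> and \<open>y'(l)\<close> have real coefficients. \<open>Y\<close>, \<open>Y1\<close> stand for the boundary values of \<open>y\<close>, and \<open>W\<close>, \<open>W1\<close> for
the conjugate boundary values of the test function.\<close>

lemma real_part_scalar_identity:
  fixes \<mu> h Y Y1 W W1 :: complex
  assumes "D = (\<mu> - h) * (\<mu> - hc)" "D \<noteq> 0" "2 * x = h + hc"
  shows "(Y1 * W - Y * W1) + 1 / (\<mu> - h) * (Y1 - h * Y) * (\<mu> * W - W1) + 1 / (\<mu> - hc) * (W1 - hc * W) * (\<mu> * Y - Y1) =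
    2 * (((h * hc - \<mu> * x) / D * Y + (\<mu> - x) / D * Y1) * (\<mu> * W - W1))"
proof -
  have d: "\<mu> - h \<noteq> 0" "\<mu> - hc \<noteq> 0" using assms by auto
  have i: "1 / (\<mu> - h) = (\<mu> - hc) / D" "1 / (\<mu> - hc) = (\<mu> - h) / D" using d assms(1) by auto
  have "D * ((Y1 * W - Y * W1) + (\<mu> - hc) / D * (Y1 - h * Y) * (\<mu> * W - W1) + (\<mu> - h) / D * (W1 - hc * W) * (\<mu> * Y - Y1)) =
     D * (Y1 * W - Y * W1) + (\<mu> - hc) * (Y1 - h * Y) * (\<mu> * W - W1) + (\<mu> - h) * (W1 - hc * W) * (\<mu> * Y - Y1)"
    using assms(2) by (simp add: distrib_left)
  also have "\<dots> = (2 * (h * hc) - \<mu> * (2 * x)) * Y * (\<mu> * W - W1) + (2 * \<mu> - 2 * x) * Y1 * (\<mu> * W - W1)"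
    unfolding assms(1,3) by (simp add: algebra_simps)
  also have "\<dots> = D * (2 * (((h * hc - \<mu> * x) / D * Y + (\<mu> - x) / D * Y1) * (\<mu> * W - W1)))"
  proof -
    have "D * (2 * ((a / D * Y + b / D * Y1) * V)) = 2 * a * Y * V + 2 * b * Y1 * V" for a b V
      using assms(2) by (simp add: field_simps)
    from this[of "h * hc - \<mu> * x" "\<mu> - x" "\<mu> * W - W1"] show ?thesis by (simp add: algebra_simps)
  qed
  finally show ?thesis unfolding i using assms(2) mult_left_cancel by blast
qed

lemma two_real_part_op: "2 * real_part_op B y w = B y w + adjoint_op B y w"
  by (simp add: real_part_op_def)

lemma real_part_Fin:
  assumes h: "Im h > 0" and y: "y \<in> Dstar l q" and w: "w \<in> Dstar l q"
  shows "real_part_op (S_state_op l q (Fin_mu \<mu>) h) y w = inner_L2 l (diff_expr l q y) w -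
    (of_real (((cmod h)\<^sup>2 - \<mu> * Re h) / (cmod (of_real \<mu> - h))\<^sup>2) * y l
      + of_real ((\<mu> - Re h) / (cmod (of_real \<mu> - h))\<^sup>2) * D1 l y l) * cnj (of_real \<mu> * w l + of_real (-1) * D1 l w l)"
proof -
  let ?I = "inner_L2 l (diff_expr l q y) w" and ?Y = "y l" and ?Y1 = "D1 l y l" and ?W = "cnj (w l)" and ?W1 = "cnj (D1 l w l)"
  let ?D = "of_real ((cmod (of_real \<mu> - h))\<^sup>2) :: complex"
  have D: "?D = (of_real \<mu> - h) * (of_real \<mu> - cnj h)" using complex_norm_square[of "of_real \<mu> - h"] by simp
  have D0: "?D \<noteq> 0" using h by (auto simp: complex_eq_iff)
  have x: "2 * of_real (Re h) = h + cnj h" by (simp add: complex_eq_iff)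
  have n: "of_real ((cmod h)\<^sup>2) = h * cnj h" by (rule complex_norm_square)
  have "cnj (inner_L2 l (diff_expr l q w) y) = ?I - (?Y1 * ?W - ?Y * ?W1)"
    using Green_formula[OF y w] inner_L2_commute[of l y "diff_expr l q w"] by (simp add: algebra_simps)
  then have "adjoint_op (S_state_op l q (Fin_mu \<mu>) h) y w = ?I - (?Y1 * ?W - ?Y * ?W1)
     - 1 / (of_real \<mu> - cnj h) * (?W1 - cnj h * ?W) * (of_real \<mu> * ?Y - ?Y1)"
    by (simp add: adjoint_op_def delta_def delta'_def)
  then have "2 * real_part_op (S_state_op l q (Fin_mu \<mu>) h) y w = 2 * ?I - ((?Y1 * ?W - ?Y * ?W1)
     + 1 / (of_real \<mu> - h) * (?Y1 - h * ?Y) * (of_real \<mu> * ?W - ?W1)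
     + 1 / (of_real \<mu> - cnj h) * (?W1 - cnj h * ?W) * (of_real \<mu> * ?Y - ?Y1))"
    unfolding two_real_part_op by (simp add: delta_def delta'_def)
  also have "\<dots> = 2 * ?I - 2 * (((h * cnj h - of_real \<mu> * of_real (Re h)) / ?D * ?Y + (of_real \<mu> - of_real (Re h)) / ?D * ?Y1) * (of_real \<mu> * ?W - ?W1))"
    unfolding real_part_scalar_identity[OF D D0 x] ..
  also have "\<dots> = 2 * (?I - ((h * cnj h - of_real \<mu> * of_real (Re h)) / ?D * ?Y + (of_real \<mu> - of_real (Re h)) / ?D * ?Y1) * (of_real \<mu> * ?W - ?W1))"
    by (simp only: right_diff_distrib)
  finally have "real_part_op (S_state_op l q (Fin_mu \<mu>) h) y w =
     ?I - ((h * cnj h - of_real \<mu> * of_real (Re h)) / ?D * ?Y + (of_real \<mu> - of_real (Re h)) / ?D * ?Y1) * (of_real \<mu> * ?W - ?W1)"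
    by (simp only: mult_cancel_left) simp
  then show ?thesis unfolding n[symmetric] by simp
qed

lemma real_part_Inf:
  assumes y: "y \<in> Dstar l q" and w: "w \<in> Dstar l q"
  shows "real_part_op (S_state_op l q Inf_mu h) y w = inner_L2 l (diff_expr l q y) w -
    (- of_real (Re h) * y l + 1 * D1 l y l) * cnj (of_real 1 * w l + of_real 0 * D1 l w l)"
proof -
  let ?I = "inner_L2 l (diff_expr l q y) w" and ?Y = "y l" and ?Y1 = "D1 l y l" and ?W = "cnj (w l)" and ?W1 = "cnj (D1 l w l)"
  have x: "2 * of_real (Re h) = h + cnj h" by (simp add: complex_eq_iff)
  have "cnj (inner_L2 l (diff_expr l q w) y) = ?I - (?Y1 * ?W - ?Y * ?W1)"
    using Green_formula[OF y w] inner_L2_commute[of l y "diff_expr l q w"] by (simp add: algebra_simps)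
  then have "adjoint_op (S_state_op l q Inf_mu h) y w = ?I - (?Y1 * ?W - ?Y * ?W1) - (?W1 - cnj h * ?W) * ?Y"
    by (simp add: adjoint_op_def delta_def)
  then have "2 * real_part_op (S_state_op l q Inf_mu h) y w = 2 * ?I - (2 * ?Y1 - (h + cnj h) * ?Y) * ?W"
    unfolding two_real_part_op by (simp add: delta_def algebra_simps)
  also have "\<dots> = 2 * (?I - (- of_real (Re h) * y l + 1 * D1 l y l) * ?W)"
    unfolding x[symmetric] by (simp add: algebra_simps)
  finally have "real_part_op (S_state_op l q Inf_mu h) y w = ?I - (- of_real (Re h) * y l + 1 * D1 l y l) * ?W"
    by (simp only: mult_cancel_left) simp
  then show ?thesis by simp
qed

text \<open>The denominator does not vanish: if \<open>\<mu> \<noteq> Re h\<close> its imaginary part is a multiple of that of \<open>m(z)\<close>, and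
otherwise it is \<open>- (Im h)\<^sup>2\<close>.\<close>

lemma impedance_function_Fin:
  assumes h: "Im h > 0" and z: "Im z \<noteq> 0"
  shows "impedance_function (S_system l q (Fin_mu \<mu>) h) z =
    (m z + of_real \<mu>) * of_real (Im h) / (of_real (\<mu> - Re h) * m z + of_real (\<mu> * Re h - (cmod h)\<^sup>2))"
proof -
  let ?\<Theta> = "S_system l q (Fin_mu \<mu>) h" and ?k = "sqrt (Im h) / cmod (of_real \<mu> - h)"
  define D where "D = (cmod (of_real \<mu> - h))\<^sup>2"
  have D: "D > 0" using h by (auto simp: D_def complex_eq_iff)
  have k2: "?k\<^sup>2 = Im h / D" using h by (simp add: power_divide D_def)
  define N where "N = of_real (\<mu> - Re h) * m z + of_real (\<mu> * Re h - (cmod h)\<^sup>2)"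
  have N: "N \<noteq> 0"
  proof (cases "\<mu> = Re h")
    case True
    then have "\<mu> * Re h - (cmod h)\<^sup>2 = - (Im h)\<^sup>2" by (simp add: cmod_power2 flip: power2_eq_square)
    then show ?thesis using True h by (simp add: N_def)
  next
    case False
    then have "Im N \<noteq> 0" using Im_m_nonzero[OF z] by (simp add: N_def)
    then show ?thesis by auto
  qed
  have b: "of_real (((cmod h)\<^sup>2 - \<mu> * Re h) / D) - of_real ((\<mu> - Re h) / D) * m z = - (N / of_real D)"
    unfolding N_def of_real_divide using D by (simp add: field_simps)
  have bne: "of_real (((cmod h)\<^sup>2 - \<mu> * Re h) / D) - of_real ((\<mu> - Re h) / D) * m z \<noteq> 0"
    unfolding b using N D by simp
  have "channel_adj ?\<Theta> (resolvent ?\<Theta> (real_part_op (state_op ?\<Theta>)) z (channel ?\<Theta> 1)) =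
     - of_real (?k\<^sup>2) * (of_real \<mu> - of_real (-1) * m z) /
       (of_real (((cmod h)\<^sup>2 - \<mu> * Re h) / D) - of_real ((\<mu> - Re h) / D) * m z)"
  proof (rule channel_response[OF z _ bne])
    fix y w assume "y \<in> Dstar l q" "w \<in> Dstar l q"
    from real_part_Fin[OF h this, of \<mu>]
    show "real_part_op (state_op ?\<Theta>) y w = inner_L2 l (diff_expr l q y) w -
      (of_real (((cmod h)\<^sup>2 - \<mu> * Re h) / D) * y l + of_real ((\<mu> - Re h) / D) * D1 l y l) * cnj (of_real \<mu> * w l + of_real (-1) * D1 l w l)"
      unfolding D_def by (simp add: S_system_def)
  qed (simp_all add: S_system_def delta_def delta'_def)
  then have "impedance_function ?\<Theta> z = of_real (Im h) / (of_real D * 1) * (of_real \<mu> - of_real (-1) * m z) / (N / of_real D)"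
    unfolding impedance_function_def b k2 minus_cancel by simp
  also have "\<dots> = of_real (Im h) * (of_real \<mu> - of_real (-1) * m z) / (1 * N)"
    using D by (intro frac_cancel) simp
  finally show ?thesis by (simp add: N_def algebra_simps)
qed

lemma impedance_function_Inf:
  assumes h: "Im h > 0" and z: "Im z \<noteq> 0"
  shows "impedance_function (S_system l q Inf_mu h) z = of_real (Im h) / (m z + of_real (Re h))"
proof -
  let ?\<Theta> = "S_system l q Inf_mu h"
  have N: "m z + of_real (Re h) \<noteq> 0"
    using Im_m_nonzero[OF z] by (auto simp: complex_eq_iff)
  have b: "- of_real (Re h) - 1 * m z = - (m z + of_real (Re h))" by simp
  have bne: "- of_real (Re h) - 1 * m z \<noteq> 0" unfolding b using N by (simp only: neg_equal_0_iff_equal) simp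
  have "channel_adj ?\<Theta> (resolvent ?\<Theta> (real_part_op (state_op ?\<Theta>)) z (channel ?\<Theta> 1)) =
     - of_real ((sqrt (Im h))\<^sup>2) * (of_real 1 - of_real 0 * m z) / (- of_real (Re h) - 1 * m z)"
  proof (rule channel_response[OF z _ bne])
    fix y w assume "y \<in> Dstar l q" "w \<in> Dstar l q"
    from real_part_Inf[OF this, of h]
    show "real_part_op (state_op ?\<Theta>) y w = inner_L2 l (diff_expr l q y) w -
      (- of_real (Re h) * y l + 1 * D1 l y l) * cnj (of_real 1 * w l + of_real 0 * D1 l w l)"
      by (simp add: S_system_def)
  qed (simp_all add: S_system_def delta_def)
  then show ?thesis
    unfolding impedance_function_def b minus_cancel using h by simp
qed

section \<open>The Weyl function is holomorphic\<close>

text \<open>The kernel identity with Cauchy-Schwarz. Both norms are themselves determined by \<open>Im m\<close>, which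
turns this into a self-improving estimate for \<open>m\<close>.\<close>

lemma m_increment_bound:
  assumes z: "Im z \<noteq> 0" "Im w \<noteq> 0"
  shows "(cmod (m w - m z))\<^sup>2 \<le> (cmod (z - w))\<^sup>2 * (norm_sq l (weyl_solution z) * norm_sq l (weyl_solution (cnj w)))"
proof -
  have w': "Im (cnj w) \<noteq> 0" using z by simp
  have "m w - m z = (z - w) * inner_L2 l (weyl_solution z) (weyl_solution (cnj w))"
    using weyl_kernel[OF z(1) w'] m_cnj[OF z(2)] by simp
  then have "(cmod (m w - m z))\<^sup>2 = (cmod (z - w))\<^sup>2 * (cmod (inner_L2 l (weyl_solution z) (weyl_solution (cnj w))))\<^sup>2"
    by (simp add: norm_mult power_mult_distrib)
  also have "(cmod (inner_L2 l (weyl_solution z) (weyl_solution (cnj w))))\<^sup>2 \<le> norm_sq l (weyl_solution z) * norm_sq l (weyl_solution (cnj w))"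
    using L2_Cauchy_Schwarz[OF weyl_solution(6)[OF z(1)], of "\<lambda>x. cnj (weyl_solution (cnj w) x)"] weyl_solution(6)[OF w']
    by (simp add: inner_L2_eq)
  finally show ?thesis by (simp add: mult_left_mono)
qed

lemma norm_sq_weyl_solution: "Im z \<noteq> 0 \<Longrightarrow> norm_sq l (weyl_solution z) = \<bar>Im (m z)\<bar> / \<bar>Im z\<bar>" "Im z \<noteq> 0 \<Longrightarrow> norm_sq l (weyl_solution (cnj z)) = norm_sq l (weyl_solution z)"
proof -
  have *: "norm_sq l (weyl_solution z) = \<bar>Im (m z)\<bar> / \<bar>Im z\<bar>" if "Im z \<noteq> 0" for z
  proof -
    have "Im (m z) = - (Im z * norm_sq l (weyl_solution z))" using Im_m[OF that] by linarith
    then show ?thesis using that norm_sq_nonneg[of l "weyl_solution z"] by (simp add: abs_mult)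
  qed
  show "Im z \<noteq> 0 \<Longrightarrow> norm_sq l (weyl_solution z) = \<bar>Im (m z)\<bar> / \<bar>Im z\<bar>" by (rule *)
  show "Im z \<noteq> 0 \<Longrightarrow> norm_sq l (weyl_solution (cnj z)) = norm_sq l (weyl_solution z)"
    using *[of z] *[of "cnj z"] m_cnj[of z] by simp
qed

text \<open>With \<open>t = |m(w) - m(z)|\<close> and \<open>s = |w - z|\<close> the increment bound reads \<open>t\<^sup>2 \<le> s\<^sup>2 C (|m(z)| + t)\<close>; this quadratic inequality
forces \<open>t = O(s)\<close>.\<close>

lemma m_continuous:
  assumes z: "Im z \<noteq> 0"
  shows "(m \<longlongrightarrow> m z) (at z)"
proof -
  \<comment> \<open>within distance r the imaginary parts stay away from 0\<close>
  define r where "r = \<bar>Im z\<bar> / 2"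
  have r: "r > 0" using z by (simp add: r_def)
  define A where "A = norm_sq l (weyl_solution z)"
  define C where "C = A / r"
  have C: "C \<ge> 0" using r norm_sq_nonneg[of l "weyl_solution z"] by (simp add: C_def A_def)
  have near: "(cmod (m w - m z))\<^sup>2 \<le> (cmod (w - z))\<^sup>2 * (C * (cmod (m z) + cmod (m w - m z)))" if "cmod (w - z) < r" for w
  proof -
    have im: "\<bar>Im w\<bar> \<ge> r" using that abs_Im_le_cmod[of "w - z"] by (simp add: r_def)
    then have w: "Im w \<noteq> 0" using r by auto
    have "norm_sq l (weyl_solution w) = \<bar>Im (m w)\<bar> / \<bar>Im w\<bar>" by (rule norm_sq_weyl_solution(1)[OF w])
    also have "\<dots> \<le> (cmod (m z) + cmod (m w - m z)) / r"
    proof (rule frac_le)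
      have "cmod (m w) \<le> cmod (m z) + cmod (m w - m z)" using norm_triangle_ineq[of "m z" "m w - m z"] by simp
      then show "\<bar>Im (m w)\<bar> \<le> cmod (m z) + cmod (m w - m z)" using abs_Im_le_cmod[of "m w"] by linarith
    qed (use r im in auto)
    finally have "A * norm_sq l (weyl_solution w) \<le> A * ((cmod (m z) + cmod (m w - m z)) / r)"
      by (rule mult_left_mono) (simp add: A_def norm_sq_nonneg)
    then have "(cmod (z - w))\<^sup>2 * (A * norm_sq l (weyl_solution w)) \<le> (cmod (z - w))\<^sup>2 * (C * (cmod (m z) + cmod (m w - m z)))"
      by (intro mult_left_mono) (auto simp: C_def)
    then show ?thesis
      using m_increment_bound[OF z w] norm_sq_weyl_solution(2)[OF w] by (simp add: A_def norm_minus_commute)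
  qed
  have bound: "cmod (m w - m z) \<le> cmod (w - z) * (1 + C * (cmod (m z) + 1) + C)" if w: "cmod (w - z) < min r 1" for w
  proof -
    let ?t = "cmod (m w - m z)" and ?s = "cmod (w - z)"
    let ?K = "1 + C * (cmod (m z) + 1) + C"
    have K: "?K \<ge> 1" using C by simp
    show ?thesis
    proof (rule ccontr)
      assume "\<not> ?t \<le> ?s * ?K"
      then have gt: "?t > ?s * ?K" by simp
      have s0: "?s > 0" using gt by (cases "w = z") auto
      have s1: "?s < 1" using w by simp
      have tp: "?t > 0" using gt mult_pos_pos[OF s0, of ?K] K by linarith
      have "?t * ?t \<le> ?s * ?s * (C * (cmod (m z) + ?t))"
        using near[of w] w by (simp add: power2_eq_square)
      also have "\<dots> = ?s * (?s * C * cmod (m z)) + ?s * ?s * C * ?t" by (simp add: algebra_simps)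
      also have "?s * (?s * C * cmod (m z)) \<le> ?t * (?s * C * cmod (m z))"
      proof (rule mult_right_mono)
        have "?s * 1 \<le> ?s * ?K" using s0 K by (intro mult_left_mono) auto
        then show "?s \<le> ?t" using gt by linarith
      qed (use C s0 in auto)
      also have "?s * ?s * C * ?t \<le> ?s * 1 * C * ?t"
        using s0 s1 C tp by (intro mult_right_mono mult_left_mono) auto
      finally have "?t * ?t \<le> ?t * (?s * (C * cmod (m z) + C))" by (simp add: algebra_simps)
      then have "?t \<le> ?s * (C * cmod (m z) + C)" using tp by simp
      also have "\<dots> \<le> ?s * ?K" using s0 C by (intro mult_left_mono) (auto simp: algebra_simps)
      finally show False using gt by linarith
    qed
  qed
  have "((\<lambda>w. m w - m z) \<longlongrightarrow> 0) (at z)"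
  proof (rule Lim_null_comparison)
    show "eventually (\<lambda>w. cmod (m w - m z) \<le> cmod (w - z) * (1 + C * (cmod (m z) + 1) + C)) (at z)"
      unfolding eventually_at using bound r by (intro exI[of _ "min r 1"]) (auto simp: dist_norm)
    have "((\<lambda>w. cmod (w - z) * (1 + C * (cmod (m z) + 1) + C)) \<longlongrightarrow> cmod (z - z) * (1 + C * (cmod (m z) + 1) + C)) (at z)"
      by (intro tendsto_intros)
    then show "((\<lambda>w. cmod (w - z) * (1 + C * (cmod (m z) + 1) + C)) \<longlongrightarrow> 0) (at z)" by simp
  qed
  then show ?thesis by (simp add: LIM_zero_iff)
qed

lemma weyl_solution_diff_norm_sq:
  assumes z: "Im z \<noteq> 0" and w: "Im w \<noteq> 0"
  shows "of_real (norm_sq l (\<lambda>x. weyl_solution w x - weyl_solution z x)) =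
    inner_L2 l (weyl_solution w) (weyl_solution w) - inner_L2 l (weyl_solution w) (weyl_solution z) - inner_L2 l (weyl_solution z) (weyl_solution w) + inner_L2 l (weyl_solution z) (weyl_solution z)"
proof -
  note L = weyl_solution(6)[OF z] weyl_solution(6)[OF w]
  have d: "(\<lambda>x. 1 * weyl_solution w x + (-1) * weyl_solution z x) \<in> L2 l" by (intro L2_add L2_cmult L)
  let ?d = "\<lambda>x. 1 * weyl_solution w x + (-1) * weyl_solution z x"
  have e: "inner_L2 l f ?d = inner_L2 l f (weyl_solution w) - inner_L2 l f (weyl_solution z)" if "f \<in> L2 l" for f
    using inner_L2_comb[OF L(2) L(1) that, of 1 "-1"] inner_L2_commute[of l f] by simp
  have "of_real (norm_sq l ?d) = inner_L2 l (weyl_solution w) ?d - inner_L2 l (weyl_solution z) ?d"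
    unfolding inner_L2_self[OF d, symmetric] inner_L2_comb[OF L(2) L(1) d, of 1 "-1"] by simp
  then show ?thesis unfolding e[OF L(1)] e[OF L(2)] by simp
qed

text \<open>Continuity of \<open>m\<close> makes the inner products of Weyl solutions continuous, hence the Weyl solutions
themselves in norm. The difference quotient of \<open>m\<close> at \<open>z\<close> is minus the inner product of the solution at \<open>w\<close> with the fixed one
at \<open>cnj z\<close>, so it converges.\<close>

lemma m_field_differentiable:
  assumes z: "Im z \<noteq> 0"
  shows "m field_differentiable (at z)"
proof -
  let ?K = "\<lambda>z w. inner_L2 l (weyl_solution z) (weyl_solution w)"
  have K: "?K u v = (cnj (m v) - m u) / (u - cnj v)" if "Im u \<noteq> 0" "Im v \<noteq> 0" "u \<noteq> cnj v" for u v
    using weyl_kernel[OF that(1,2)] that(3) by (simp add: field_simps)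
  have ev: "eventually (\<lambda>w. Im w \<noteq> 0 \<and> Im w * Im z > 0) (at z)"
  proof -
    have "((\<lambda>w. Im w * Im z) \<longlongrightarrow> Im z * Im z) (at z)" by (intro tendsto_intros)
    then have "eventually (\<lambda>w. Im w * Im z > 0) (at z)"
      by (rule order_tendstoD(1)) (use z in \<open>auto simp: zero_less_mult_iff\<close>)
    then show ?thesis by eventually_elim auto
  qed
  have ne: "u \<noteq> cnj v" if "Im u * Im v > 0" for u v
  proof
    assume "u = cnj v"
    with that have "- (Im v * Im v) > 0" by simp
    moreover have "Im v * Im v \<ge> 0" by simp
    ultimately show False by linarith
  qed
  have zz: "Im z * Im z > 0" using z by (auto simp: zero_less_mult_iff)
  have zne: "z - cnj z \<noteq> 0" using ne[OF zz] by simp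
  have mc: "(m \<longlongrightarrow> m z) (at z)" by (rule m_continuous[OF z])
  have l1: "((\<lambda>w. ?K w w) \<longlongrightarrow> ?K z z) (at z)"
  proof (rule Lim_transform_eventually)
    show "((\<lambda>w. (cnj (m w) - m w) / (w - cnj w)) \<longlongrightarrow> ?K z z) (at z)"
      unfolding K[OF z z ne[OF zz]] by (intro tendsto_intros mc zne)
    show "eventually (\<lambda>w. (cnj (m w) - m w) / (w - cnj w) = ?K w w) (at z)"
      using ev
    proof eventually_elim
      case (elim w)
      have "Im w * Im w > 0" using elim by (auto simp: zero_less_mult_iff)
      from K[OF _ _ ne[OF this]] elim show ?case by simp
    qed
  qed
  have l2: "((\<lambda>w. ?K w z) \<longlongrightarrow> ?K z z) (at z)"
  proof (rule Lim_transform_eventually)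
    show "((\<lambda>w. (cnj (m z) - m w) / (w - cnj z)) \<longlongrightarrow> ?K z z) (at z)"
      unfolding K[OF z z ne[OF zz]] by (intro tendsto_intros mc zne)
    show "eventually (\<lambda>w. (cnj (m z) - m w) / (w - cnj z) = ?K w z) (at z)"
      using ev
    proof eventually_elim
      case (elim w)
      then show ?case using K[OF _ z ne, of w] by simp
    qed
  qed
  have l3: "((\<lambda>w. ?K z w) \<longlongrightarrow> ?K z z) (at z)"
  proof -
    have "(\<lambda>w. cnj (?K w z)) = ?K z" by (rule ext) (rule inner_L2_commute[symmetric])
    moreover have "cnj (?K z z) = ?K z z" by (rule inner_L2_commute[symmetric])
    ultimately show ?thesis using tendsto_cnj[OF l2] by (simp only:)
  qed
  have "((\<lambda>w. ?K w w - ?K w z - ?K z w + ?K z z) \<longlongrightarrow> ?K z z - ?K z z - ?K z z + ?K z z) (at z)"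
    by (intro tendsto_intros l1 l2 l3)
  moreover have "eventually (\<lambda>w. ?K w w - ?K w z - ?K z w + ?K z z = of_real (norm_sq l (\<lambda>x. weyl_solution w x - weyl_solution z x))) (at z)"
    using ev
  proof eventually_elim
    case (elim w)
    then have "Im w \<noteq> 0" by blast
    from weyl_solution_diff_norm_sq[OF z this] show ?case by (rule sym)
  qed
  ultimately have "((\<lambda>w. complex_of_real (norm_sq l (\<lambda>x. weyl_solution w x - weyl_solution z x))) \<longlongrightarrow> ?K z z - ?K z z - ?K z z + ?K z z) (at z)"
    by (rule Lim_transform_eventually)
  then have "((\<lambda>w. complex_of_real (norm_sq l (\<lambda>x. weyl_solution w x - weyl_solution z x))) \<longlongrightarrow> complex_of_real 0) (at z)"
    by simp
  then have n0: "((\<lambda>w. norm_sq l (\<lambda>x. weyl_solution w x - weyl_solution z x)) \<longlongrightarrow> 0) (at z)"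
    by (simp only: tendsto_of_real_iff)
  have zc: "Im (cnj z) \<noteq> 0" using z by simp
  have kz: "((\<lambda>w. ?K w (cnj z)) \<longlongrightarrow> ?K z (cnj z)) (at z)"
  proof -
    have "((\<lambda>w. ?K w (cnj z) - ?K z (cnj z)) \<longlongrightarrow> 0) (at z)"
    proof (rule Lim_null_comparison)
      show "eventually (\<lambda>w. cmod (?K w (cnj z) - ?K z (cnj z)) \<le> sqrt (norm_sq l (\<lambda>x. weyl_solution w x - weyl_solution z x) * norm_sq l (weyl_solution (cnj z)))) (at z)"
        using ev
      proof eventually_elim
        case (elim w)
        then have w: "Im w \<noteq> 0" by simp
        have "?K w (cnj z) - ?K z (cnj z) = (LINT x|half_line l. (weyl_solution w x - weyl_solution z x) * cnj (weyl_solution (cnj z) x))"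
          using inner_L2_comb[OF weyl_solution(6)[OF w] weyl_solution(6)[OF z] weyl_solution(6)[OF zc], of 1 "-1"] by (simp add: inner_L2_eq)
        moreover have "(cmod (LINT x|half_line l. (weyl_solution w x - weyl_solution z x) * cnj (weyl_solution (cnj z) x)))\<^sup>2 \<le>
           norm_sq l (\<lambda>x. weyl_solution w x - weyl_solution z x) * norm_sq l (weyl_solution (cnj z))"
          using L2_Cauchy_Schwarz[OF L2_diff[OF weyl_solution(6)[OF w] weyl_solution(6)[OF z]], of "\<lambda>x. cnj (weyl_solution (cnj z) x)"] weyl_solution(6)[OF zc] by simp
        ultimately show ?case by (metis real_le_rsqrt)
      qed
      have "((\<lambda>w. sqrt (norm_sq l (\<lambda>x. weyl_solution w x - weyl_solution z x) * norm_sq l (weyl_solution (cnj z)))) \<longlongrightarrow> sqrt (0 * norm_sq l (weyl_solution (cnj z)))) (at z)"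
        by (intro tendsto_intros n0)
      then show "((\<lambda>w. sqrt (norm_sq l (\<lambda>x. weyl_solution w x - weyl_solution z x) * norm_sq l (weyl_solution (cnj z)))) \<longlongrightarrow> 0) (at z)" by simp
    qed
    then show ?thesis by (simp add: LIM_zero_iff)
  qed
  have "((\<lambda>w. (m w - m z) / (w - z)) \<longlongrightarrow> - ?K z (cnj z)) (at z)"
  proof (rule Lim_transform_eventually)
    show "((\<lambda>w. - ?K w (cnj z)) \<longlongrightarrow> - ?K z (cnj z)) (at z)" by (intro tendsto_intros kz)
    have "eventually (\<lambda>w. w \<noteq> z) (at z)" by (simp add: eventually_at_filter)
    with ev show "eventually (\<lambda>w. - ?K w (cnj z) = (m w - m z) / (w - z)) (at z)"
    proof eventually_elim
      case (elim w)
      have "(w - z) * ?K w (cnj z) = m z - m w"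
        using weyl_kernel[OF _ zc, of w] elim m_cnj[OF z] by simp
      then show ?case using elim by (simp add: field_simps)
    qed
  qed
  then have "(m has_field_derivative - ?K z (cnj z)) (at z)" by (simp add: has_field_derivative_iff)
  then show ?thesis by (auto simp: field_differentiable_def)
qed

lemma m_holomorphic: "m holomorphic_on {z. Im z > 0}"
  using m_field_differentiable by (auto simp: holomorphic_on_def intro: field_differentiable_at_within)

end

section \<open>The Nevanlinna representation\<close>

definition unit_exp :: "real \<Rightarrow> complex" where
  "unit_exp t = exp (2 * of_real pi * \<i> * of_real t)"

lemma norm_unit_exp [simp]: "cmod (unit_exp t) = 1"
  by (simp add: unit_exp_def norm_exp_eq_Re)

lemma unit_exp_nonzero [simp]: "unit_exp t \<noteq> 0"
  by (simp add: unit_exp_def)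

lemma cnj_unit_exp: "cnj (unit_exp t) = 1 / unit_exp t"
  by (simp add: complex_div_cnj[of 1] )

lemma continuous_unit_exp [continuous_intros]: "continuous_on A unit_exp"
  unfolding unit_exp_def by (intro continuous_intros)

lemma Cauchy_unit_circle:
  assumes "F holomorphic_on cball 0 1" "cmod w < 1"
  shows "((\<lambda>t. F (unit_exp t) * unit_exp t / (unit_exp t - w)) has_integral F w) {0..1}"
proof -
  have "((\<lambda>u. F u / (u - w)) has_contour_integral (2 * of_real pi * \<i> * F w)) (circlepath 0 1)"
    by (rule Cauchy_integral_circlepath_simple) (use assms in auto)
  then have "((\<lambda>x. F (circlepath 0 1 x) / (circlepath 0 1 x - w) * vector_derivative (circlepath 0 1) (at x within {0..1}))
     has_integral (2 * of_real pi * \<i> * F w)) {0..1}"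
    unfolding has_contour_integral_def .
  then have "((\<lambda>x. (2 * of_real pi * \<i>) * (F (unit_exp x) * unit_exp x / (unit_exp x - w))) has_integral (2 * of_real pi * \<i> * F w)) {0..1}"
  proof (rule has_integral_eq[rotated])
    fix x :: real assume "x \<in> {0..1}"
    then have "vector_derivative (circlepath 0 1) (at x within {0..1}) = 2 * of_real pi * \<i> * unit_exp x"
      using vector_derivative_circlepath01[of x 0 1] by (simp add: unit_exp_def)
    moreover have "circlepath 0 1 x = unit_exp x" by (simp add: circlepath unit_exp_def)
    ultimately show "F (circlepath 0 1 x) / (circlepath 0 1 x - w) * vector_derivative (circlepath 0 1) (at x within {0..1}) =
       (2 * of_real pi * \<i>) * (F (unit_exp x) * unit_exp x / (unit_exp x - w))" by simp
  qed
  from has_integral_mult_right[OF this, of "1 / (2 * of_real pi * \<i>)"] show ?thesis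
    by simp
qed

text \<open>A holomorphic function on the disc is recovered from its real part on the circle: add Cauchy's formula
at \<open>w\<close> to the conjugate of the mean value property of \<open>F(\<zeta>) / (1 - cnj w \<zeta>)\<close>.\<close>

lemma Schwarz_formula:
  assumes F: "F holomorphic_on cball 0 1" and w: "cmod w < 1"
  shows "((\<lambda>t. of_real (Re (F (unit_exp t))) * ((unit_exp t + w) / (unit_exp t - w))) has_integral (F w - \<i> * of_real (Im (F 0)))) {0..1}"
proof -
  have I: "((\<lambda>t. F (unit_exp t) * unit_exp t / (unit_exp t - w)) has_integral F w) {0..1}"
    by (rule Cauchy_unit_circle[OF F w])
  have nz: "1 - cnj w * \<zeta> \<noteq> 0" if "cmod \<zeta> \<le> 1" for \<zeta>
  proof
    assume "1 - cnj w * \<zeta> = 0"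
    then have "cmod (cnj w * \<zeta>) = 1" by (simp add: algebra_simps)
    moreover have "cmod (cnj w * \<zeta>) \<le> cmod w * 1" unfolding norm_mult complex_mod_cnj by (intro mult_left_mono that) simp
    ultimately show False using w by simp
  qed
  have G: "(\<lambda>\<zeta>. F \<zeta> / (1 - cnj w * \<zeta>)) holomorphic_on cball 0 1"
    by (intro holomorphic_intros F) (use nz in auto)
  \<comment> \<open>the mean value property of G, then conjugated: on the circle \<open>cnj \<zeta> = 1 / \<zeta>\<close>\<close>
  have "((\<lambda>t. F (unit_exp t) / (1 - cnj w * unit_exp t)) has_integral F 0) {0..1}"
    using Cauchy_unit_circle[OF G, of 0] by simp
  then have "((\<lambda>t. cnj (F (unit_exp t) / (1 - cnj w * unit_exp t))) has_integral cnj (F 0)) {0..1}"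
    by (rule has_integral_linear[OF _ bounded_linear_cnj, unfolded o_def])
  moreover have "cnj (F (unit_exp t) / (1 - cnj w * unit_exp t)) = cnj (F (unit_exp t)) * unit_exp t / (unit_exp t - w)" for t
  proof -
    have "unit_exp t - w \<noteq> 0" using w by auto
    then show ?thesis by (simp add: cnj_unit_exp field_simps)
  qed
  ultimately have II: "((\<lambda>t. cnj (F (unit_exp t)) * unit_exp t / (unit_exp t - w)) has_integral cnj (F 0)) {0..1}"
    by simp
  have "((\<lambda>t. F (unit_exp t)) has_integral F 0) {0..1}"
    using Cauchy_unit_circle[OF F, of 0] by simp
  then have III: "((\<lambda>t. complex_of_real (Re (F (unit_exp t)))) has_integral of_real (Re (F 0))) {0..1}"
    by (intro has_integral_of_real has_integral_linear[OF _ bounded_linear_Re, unfolded o_def])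
  have "((\<lambda>t. F (unit_exp t) * unit_exp t / (unit_exp t - w) + cnj (F (unit_exp t)) * unit_exp t / (unit_exp t - w)
      - of_real (Re (F (unit_exp t)))) has_integral (F w + cnj (F 0) - of_real (Re (F 0)))) {0..1}"
    by (intro has_integral_add has_integral_diff I II III)
  moreover have "F w + cnj (F 0) - of_real (Re (F 0)) = F w - \<i> * of_real (Im (F 0))"
    by (simp add: complex_eq_iff)
  moreover have "F (unit_exp t) * unit_exp t / (unit_exp t - w) + cnj (F (unit_exp t)) * unit_exp t / (unit_exp t - w)
      - of_real (Re (F (unit_exp t))) = of_real (Re (F (unit_exp t))) * ((unit_exp t + w) / (unit_exp t - w))" for t
  proof -
    have nw: "unit_exp t - w \<noteq> 0" using w by auto
    have "F (unit_exp t) * unit_exp t / (unit_exp t - w) + cnj (F (unit_exp t)) * unit_exp t / (unit_exp t - w)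
        = (F (unit_exp t) + cnj (F (unit_exp t))) * unit_exp t / (unit_exp t - w)"
      by (simp add: add_divide_distrib distrib_right)
    also have "F (unit_exp t) + cnj (F (unit_exp t)) = 2 * of_real (Re (F (unit_exp t)))"
      by (simp add: complex_eq_iff)
    finally show ?thesis using nw by (simp add: field_simps)
  qed
  ultimately show ?thesis by simp
qed

text \<open>On circles of radius \<open>r < 1\<close> the normalized real part is a probability density, and all these measures live
on \<open>[0, 1]\<close>. Helly's theorem provides a weak limit, and the Schwarz kernel is bounded and continuous for fixed \<open>w\<close>.\<close>

lemma Herglotz_disc:
  assumes f: "f holomorphic_on ball 0 1" and pos: "\<And>w. cmod w < 1 \<Longrightarrow> Re (f w) > 0"
  shows "\<exists>\<nu>. real_distribution \<nu> \<and> (\<forall>w. cmod w < 1 \<longrightarrow>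
    f w = \<i> * of_real (Im (f 0)) + of_real (Re (f 0)) * (LINT t|\<nu>. (unit_exp t + w) / (unit_exp t - w)))"
proof -
  define c where "c = Re (f 0)"
  have c: "c > 0" using pos[of 0] by (simp add: c_def)
  define r where "r n = 1 - 1 / (2 + real n)" for n
  have r: "0 < r n" "r n < 1" for n by (auto simp: r_def field_simps)
  have F: "(\<lambda>w. f (of_real (r n) * w)) holomorphic_on cball 0 1" for n
  proof -
    have "(\<lambda>w. complex_of_real (r n) * w) ` cball 0 1 \<subseteq> ball 0 1"
    proof (rule image_subsetI)
      fix w :: complex assume "w \<in> cball 0 1"
      then have "r n * cmod w \<le> r n * 1" using r[of n] by (intro mult_left_mono) auto
      then have "r n * cmod w < 1" using r[of n] by linarith
      then show "of_real (r n) * w \<in> ball 0 1" using r[of n] by (simp add: norm_mult)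
    qed
    from holomorphic_on_compose_gen[OF _ f this] show ?thesis
      by (simp add: o_def holomorphic_intros)
  qed
  define g where "g n t = Re (f (of_real (r n) * unit_exp t)) / c" for n t
  have rn: "cmod (of_real (r n) * unit_exp t) < 1" for n t using r[of n] by (simp add: norm_mult)
  have g0: "g n t > 0" for n t using pos[OF rn] c by (simp add: g_def)
  have gc: "continuous_on UNIV (g n)" for n
  proof -
    have "continuous_on UNIV (\<lambda>t. f (of_real (r n) * unit_exp t))"
      by (rule continuous_on_compose2[OF holomorphic_on_imp_continuous_on[OF f]]) (use rn in \<open>auto intro!: continuous_intros\<close>)
    then show ?thesis unfolding g_def using c by (intro continuous_intros) auto
  qed
  have gm[measurable]: "g n \<in> borel_measurable borel" for n
    by (rule borel_measurable_continuous_onI[OF gc])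
  have g1: "(g n has_integral 1) {0..1}" for n
  proof -
    have "((\<lambda>t. complex_of_real (Re (f (of_real (r n) * unit_exp t)))) has_integral of_real c) {0..1}"
    proof -
      have "f 0 - \<i> * of_real (Im (f 0)) = of_real c" by (simp add: c_def complex_eq_iff)
      then show ?thesis using Schwarz_formula[OF F[of n], of 0] by simp
    qed
    from has_integral_linear[OF this bounded_linear_Re] have "((\<lambda>t. Re (f (of_real (r n) * unit_exp t))) has_integral c) {0..1}"
      by (simp add: o_def)
    moreover have "g n = (\<lambda>t. Re (f (of_real (r n) * unit_exp t)) / c)" by (rule ext) (simp add: g_def)
    ultimately show ?thesis using has_integral_divide[of _ c "{0..1}" c] c by simp
  qed
  define \<mu> where "\<mu> n = density lborel (\<lambda>t. ennreal (indicator {0..1} t * g n t))" for n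
  have mass: "emeasure (\<mu> n) A = 1" if "A \<in> sets borel" "{0..1} \<subseteq> A" for n A
  proof -
    have "emeasure (\<mu> n) A = (\<integral>\<^sup>+t. ennreal (indicator {0..1} t * g n t) * indicator A t \<partial>lborel)"
      unfolding \<mu>_def by (rule emeasure_density) (use that in auto)
    also have "\<dots> = (\<integral>\<^sup>+t. ennreal (indicator {0..1} t * g n t) \<partial>lborel)"
      by (rule nn_integral_cong) (use that in \<open>auto simp: indicator_def\<close>)
    also have "\<dots> = ennreal 1"
      by (rule nn_integral_has_integral_lebesgue[OF _ g1]) (use g0 in \<open>auto intro: less_imp_le\<close>)
    finally show ?thesis by simp
  qed
  have dist: "real_distribution (\<mu> n)" for n
  proof -
    interpret prob_space "\<mu> n"
      by (rule prob_spaceI) (use mass[of UNIV n] in \<open>simp add: \<mu>_def\<close>)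
    show ?thesis by unfold_locales (simp add: \<mu>_def)
  qed
  have "tight \<mu>"
    unfolding tight_def
  proof (intro conjI allI impI dist)
    fix \<epsilon> :: real assume "\<epsilon> > 0"
    have "measure (\<mu> n) {-1<..1} = 1" for n using mass[of "{-1<..1}" n] by (simp add: measure_def subset_iff)
    then show "\<exists>a b. a < b \<and> (\<forall>n. 1 - \<epsilon> < measure (\<mu> n) {a<..b})"
      using \<open>\<epsilon> > 0\<close> by (intro exI[of _ "-1"] exI[of _ 1]) simp
  qed
  from tight_imp_convergent_subsubsequence[OF this strict_mono_id] obtain \<rho> \<nu> where
    \<rho>: "strict_mono \<rho>" and \<nu>: "real_distribution \<nu>" and conv: "weak_conv_m (\<mu> \<circ> \<rho>) \<nu>"
    by (auto simp: comp_def id_def)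
  have "f w = \<i> * of_real (Im (f 0)) + of_real c * (LINT t|\<nu>. (unit_exp t + w) / (unit_exp t - w))" if w: "cmod w < 1" for w
  proof -
    let ?k = "\<lambda>t. (unit_exp t + w) / (unit_exp t - w)"
    have nw: "unit_exp t - w \<noteq> 0" for t using w by auto
    have kc: "continuous_on UNIV ?k" by (intro continuous_intros) (use nw in auto)
    have kb: "norm (?k t) \<le> 2 / (1 - cmod w)" for t
    proof -
      have "cmod (unit_exp t + w) \<le> 2" using norm_triangle_ineq[of "unit_exp t" w] w by simp
      moreover have "cmod (unit_exp t - w) \<ge> 1 - cmod w" using norm_triangle_ineq2[of "unit_exp t" w] by simp
      ultimately show ?thesis using w by (simp add: norm_divide frac_le)
    qed
    have km[measurable]: "?k \<in> borel_measurable borel" by (rule borel_measurable_continuous_onI[OF kc])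
    have "(\<lambda>n. integral\<^sup>L ((\<mu> \<circ> \<rho>) n) ?k) \<longlonglongrightarrow> integral\<^sup>L \<nu> ?k"
      by (rule weak_conv_imp_integral_bdd_continuous_conv[OF _ \<nu> conv _ kb])
         (use dist kc in \<open>auto simp: continuous_on_eq_continuous_at\<close>)
    then have "(\<lambda>n. \<i> * of_real (Im (f 0)) + of_real c * integral\<^sup>L (\<mu> (\<rho> n)) ?k) \<longlonglongrightarrow> \<i> * of_real (Im (f 0)) + of_real c * integral\<^sup>L \<nu> ?k"
      by (intro tendsto_intros) (simp add: o_def)
    moreover have "\<i> * of_real (Im (f 0)) + of_real c * integral\<^sup>L (\<mu> n) ?k = f (of_real (r n) * w)" for n
    proof -
      have "integral\<^sup>L (\<mu> n) ?k = (LINT t|lborel. (indicator {0..1} t * g n t) *\<^sub>R ?k t)"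
        unfolding \<mu>_def by (rule integral_density) (use less_imp_le[OF g0] in \<open>auto simp: indicator_def\<close>)
      also have "\<dots> = (LINT t:{0..1}|lborel. of_real (g n t) * ?k t)"
        unfolding set_lebesgue_integral_def by (rule Bochner_Integration.integral_cong) (auto simp: indicator_def scaleR_conv_of_real)
      also have "\<dots> = integral {0..1} (\<lambda>t. of_real (g n t) * ?k t)"
      proof (rule set_borel_integral_eq_integral(2)[OF borel_integrable_atLeastAtMost'])
        have "continuous_on {0..1} (g n)" "continuous_on {0..1} ?k"
          using continuous_on_subset[OF gc] continuous_on_subset[OF kc] by auto
        then show "continuous_on {0..1} (\<lambda>t. of_real (g n t) * ?k t)"
          by (intro continuous_on_mult continuous_on_of_real)
      qed
      also have "\<dots> = (f (of_real (r n) * w) - \<i> * of_real (Im (f 0))) / of_real c"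
      proof (rule integral_unique)
        have e: "(\<lambda>t. of_real (g n t) * ?k t) = (\<lambda>t. of_real (Re (f (of_real (r n) * unit_exp t))) * ?k t / of_real c)"
          by (rule ext) (simp add: g_def)
        show "((\<lambda>t. of_real (g n t) * ?k t) has_integral ((f (of_real (r n) * w) - \<i> * of_real (Im (f 0))) / of_real c)) {0..1}"
          unfolding e using has_integral_divide[OF Schwarz_formula[OF F[of n] w], of "of_real c"] by simp
      qed
      finally show ?thesis using c by simp
    qed
    moreover have "(\<lambda>n. f (of_real (r (\<rho> n)) * w)) \<longlonglongrightarrow> f (of_real 1 * w)"
    proof (rule continuous_on_tendsto_compose[OF holomorphic_on_imp_continuous_on[OF f]])
      have "(\<lambda>n. 1 / (2 + real n)) \<longlonglongrightarrow> 0"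
        by (intro tendsto_divide_0[OF tendsto_const] filterlim_at_top_imp_at_infinity
            filterlim_tendsto_add_at_top[OF tendsto_const filterlim_real_sequentially])
      then have "r \<longlonglongrightarrow> 1 - 0" unfolding r_def by (intro tendsto_intros)
      then have "(\<lambda>n. r (\<rho> n)) \<longlonglongrightarrow> 1" using LIMSEQ_subseq_LIMSEQ[OF _ \<rho>] by (fastforce simp: o_def)
      then show "(\<lambda>n. of_real (r (\<rho> n)) * w) \<longlonglongrightarrow> of_real 1 * w" by (intro tendsto_intros)
      show "eventually (\<lambda>n. of_real (r (\<rho> n)) * w \<in> ball 0 1) sequentially"
      proof (rule always_eventually, rule allI)
        fix n
        have "r (\<rho> n) * cmod w \<le> 1 * cmod w" using r[of "\<rho> n"] by (intro mult_right_mono) auto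
        then show "of_real (r (\<rho> n)) * w \<in> ball 0 1" using w r[of "\<rho> n"] by (simp add: norm_mult)
      qed
    qed (use w in simp)
    ultimately show ?thesis using LIMSEQ_unique by fastforce
  qed
  with \<nu> show ?thesis unfolding c_def by blast
qed

lemma cayley_disc: "Im z > 0 \<Longrightarrow> cmod ((z - \<i>) / (z + \<i>)) < 1"
proof -
  assume z: "Im z > 0"
  have "(cmod (z - \<i>))\<^sup>2 < (cmod (z + \<i>))\<^sup>2"
    unfolding cmod_power2 using z by (simp add: power2_eq_square algebra_simps)
  then have lt: "cmod (z - \<i>) < cmod (z + \<i>)" by (rule power2_less_imp_less) simp
  moreover from this have "cmod (z + \<i>) > 0" using norm_ge_zero[of "z - \<i>"] by linarith
  ultimately show ?thesis by (simp add: norm_divide)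
qed

text \<open>The Herglotz representation carried over by the Cayley transform. The points of the circle other than 1
correspond to real numbers \<open>\<tau>\<close>, and the Schwarz kernel becomes \<open>(1 + \<tau> z) / (\<tau> - z)\<close> up to a factor \<open>- \<i>\<close>; the mass at 1,
the image of infinity, becomes the linear term. The measure is kept finite here: the customary one is
\<open>(1 + t\<^sup>2) d\<rho>\<close>.\<close>

theorem Nevanlinna_representation:
  assumes M: "M holomorphic_on {z. Im z > 0}" and pos: "\<And>z. Im z > 0 \<Longrightarrow> Im (M z) > 0"
  shows "\<exists>p \<rho>. p \<ge> 0 \<and> finite_measure \<rho> \<and> sets \<rho> = sets borel \<and> (\<forall>z. Im z > 0 \<longrightarrow>
    M z = of_real (Re (M \<i>)) + of_real p * z + (LINT t|\<rho>. (1 + of_real t * z) / (of_real t - z)))"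
proof -
  define C where "C = (\<lambda>w. \<i> * (1 + w) / (1 - w))"
  define f where "f w = - \<i> * M (C w)" for w
  have w1: "1 - w \<noteq> 0" if "cmod w < 1" for w :: complex using that by auto
  have C_pos: "Im (C w) > 0" if w: "cmod w < 1" for w
  proof -
    have "C w = \<i> * ((1 + w) * cnj (1 - w)) / of_real ((cmod (1 - w))\<^sup>2)"
      unfolding C_def using w1[OF w] by (simp add: complex_norm_square del: of_real_power)
    then have "Im (C w) = Re ((1 + w) * cnj (1 - w)) / (cmod (1 - w))\<^sup>2"
      by (simp del: of_real_power)
    also have "Re ((1 + w) * cnj (1 - w)) = 1 - (cmod w)\<^sup>2"
      by (simp add: cmod_power2) (simp add: power2_eq_square algebra_simps)
    finally show ?thesis using w w1[OF w] by (simp add: power_less_one_iff abs_square_less_1)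
  qed
  have f_hol: "f holomorphic_on ball 0 1"
    unfolding f_def
  proof (intro holomorphic_intros holomorphic_on_compose_gen[OF _ M, unfolded o_def])
    show "C holomorphic_on ball 0 1" unfolding C_def by (intro holomorphic_intros) (use w1 in auto)
    show "C ` ball 0 1 \<subseteq> {z. 0 < Im z}" using C_pos by auto
  qed
  have f_pos: "Re (f w) > 0" if "cmod w < 1" for w
    using pos[OF C_pos[OF that]] by (simp add: f_def)
  obtain \<nu> where \<nu>: "real_distribution \<nu>" and rep: "\<And>w. cmod w < 1 \<Longrightarrow>
    f w = \<i> * of_real (Im (f 0)) + of_real (Re (f 0)) * (LINT t|\<nu>. (unit_exp t + w) / (unit_exp t - w))"
    using Herglotz_disc[OF f_hol f_pos] by blast
  interpret real_distribution \<nu> by (rule \<nu>)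
  define c where "c = Im (M \<i>)"
  have c: "c > 0" using pos[of \<i>] by (simp add: c_def)
  have f0: "f 0 = - \<i> * M \<i>" by (simp add: f_def C_def)
  have [measurable]: "unit_exp \<in> borel_measurable borel"
    by (rule borel_measurable_continuous_onI) (rule continuous_unit_exp)
  \<comment> \<open>the parameters that the Cayley transform sends to infinity\<close>
  define N where "N = {t. unit_exp t = 1}"
  have N[measurable]: "N \<in> sets borel" unfolding N_def by measurable
  define \<tau> where "\<tau> t = Re (\<i> * (1 + unit_exp t) / (1 - unit_exp t))" for t
  have [measurable]: "\<tau> \<in> borel_measurable borel" unfolding \<tau>_def by measurable
  define \<nu>' where "\<nu>' = density \<nu> (\<lambda>t. ennreal (c * indicator (- N) t))"
  define \<rho> where "\<rho> = distr \<nu>' borel \<tau>"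
  define p where "p = c * measure \<nu> N"
  have s': "sets \<nu>' = sets borel" by (simp add: \<nu>'_def)
  have mt: "\<tau> \<in> measurable \<nu>' borel" by (simp add: measurable_cong_sets[OF s' refl])
  have fin': "finite_measure \<nu>'"
  proof (rule finite_measureI)
    have "emeasure \<nu>' (space \<nu>') = (\<integral>\<^sup>+t. ennreal (c * indicator (- N) t) * indicator (space \<nu>) t \<partial>\<nu>)"
      unfolding \<nu>'_def by (subst emeasure_density) auto
    also have "\<dots> \<le> (\<integral>\<^sup>+t. ennreal c \<partial>\<nu>)"
      using c by (intro nn_integral_mono) (auto simp: indicator_def)
    also have "\<dots> = ennreal c" by (simp add: emeasure_space_1[simplified])
    finally show "emeasure \<nu>' (space \<nu>') \<noteq> \<infinity>" by (auto simp: top_unique)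
  qed
  have fin: "finite_measure \<rho>"
    unfolding \<rho>_def using finite_measure.finite_measure_distr[OF fin' mt] .
  have main: "M z = of_real (Re (M \<i>)) + of_real p * z + (LINT t|\<rho>. (1 + of_real t * z) / (of_real t - z))" if z: "Im z > 0" for z
  proof -
    let ?w = "(z - \<i>) / (z + \<i>)"
    let ?k = "\<lambda>t. (unit_exp t + ?w) / (unit_exp t - ?w)"
    let ?h = "\<lambda>t. (1 + of_real t * z) / (of_real t - z)"
    have zi: "z + \<i> \<noteq> 0" using z by (auto simp: complex_eq_iff)
    note w = cayley_disc[OF z]
    have Cw: "C ?w = z"
    proof -
      have e: "1 + ?w = 2 * z / (z + \<i>)" "1 - ?w = 2 * \<i> / (z + \<i>)" using zi by (auto simp: field_simps)
      have "\<i> * (2 * z / d) / (2 * \<i> / d) = z" if "d \<noteq> 0" for d using that by simp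
      from this[OF zi] show ?thesis unfolding C_def e .
    qed
    have nw: "unit_exp t - ?w \<noteq> 0" for t
    proof
      assume "unit_exp t - ?w = 0"
      then have "cmod ?w = 1" using norm_unit_exp[of t] by simp
      with w show False by simp
    qed
    have kin: "\<i> * ?k t = z" if "t \<in> N" for t
    proof -
      have "\<i> * ?k t = C ?w" using that unfolding N_def C_def by simp
      then show ?thesis using Cw by simp
    qed
    have kout: "\<i> * ?k t = ?h (\<tau> t)" if "t \<notin> N" for t
    proof -
      let ?e = "unit_exp t"
      have e: "1 - ?e \<noteq> 0" using that by (simp add: N_def)
      have "cnj (\<i> * (1 + ?e) / (1 - ?e)) = \<i> * (1 + ?e) / (1 - ?e)"
        using e by (simp add: cnj_unit_exp field_simps)
      then have "\<i> * (1 + ?e) / (1 - ?e) \<in> \<real>" by (simp add: Reals_cnj_iff)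
      then have T: "of_real (\<tau> t) = \<i> * (1 + ?e) / (1 - ?e)" unfolding \<tau>_def by (rule of_real_Re)
      have h1: "1 + of_real (\<tau> t) * z = ((1 - ?e) + \<i> * z * (1 + ?e)) / (1 - ?e)"
        unfolding T using e by (simp add: field_simps)
      have h2: "of_real (\<tau> t) - z = (\<i> * (1 + ?e) - z * (1 - ?e)) / (1 - ?e)"
        unfolding T using e by (simp add: field_simps)
      have k1: "?e + ?w = (?e * (z + \<i>) + (z - \<i>)) / (z + \<i>)" using zi by (simp add: field_simps)
      have k2: "?e - ?w = (?e * (z + \<i>) - (z - \<i>)) / (z + \<i>)" using zi by (simp add: field_simps)
      have "\<i> * ?k t = \<i> * (?e * (z + \<i>) + (z - \<i>)) / (?e * (z + \<i>) - (z - \<i>))"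
        unfolding k1 k2 using zi by simp
      also have "\<dots> = ((1 - ?e) + \<i> * z * (1 + ?e)) / (\<i> * (1 + ?e) - z * (1 - ?e))"
        by (simp add: algebra_simps)
      also have "\<dots> = ?h (\<tau> t)" unfolding h1 h2 using e by simp
      finally show ?thesis .
    qed
    have hm: "?h \<in> borel_measurable borel" by measurable
    have kc: "continuous_on UNIV ?k" by (intro continuous_intros) (use nw in auto)
    have km: "?k \<in> borel_measurable borel" by (rule borel_measurable_continuous_onI[OF kc])
    have kb: "norm (?k t) \<le> 2 / (1 - cmod ?w)" for t
    proof -
      have "cmod (unit_exp t + ?w) \<le> 2" using norm_triangle_ineq[of "unit_exp t" ?w] w by simp
      moreover have "cmod (unit_exp t - ?w) \<ge> 1 - cmod ?w" using norm_triangle_ineq2[of "unit_exp t" ?w] by simp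
      ultimately show ?thesis using w unfolding norm_divide[of "unit_exp t + ?w"] by (intro frac_le) auto
    qed
    have ki: "integrable \<nu> ?k"
      by (rule integrable_const_bound[of _ "2 / (1 - cmod ?w)"]) (use kb km in auto)
    have "(LINT t|\<rho>. ?h t) = (LINT t|\<nu>'. ?h (\<tau> t))"
      unfolding \<rho>_def by (rule integral_distr[OF mt hm])
    also have "\<dots> = (LINT t|\<nu>. (c * indicator (- N) t) *\<^sub>R ?h (\<tau> t))"
      unfolding \<nu>'_def by (rule integral_density) (use c in auto)
    also have "\<dots> = (LINT t|\<nu>. of_real c * \<i> * ?k t - indicator N t *\<^sub>R (of_real c * z))"
    proof (rule Bochner_Integration.integral_cong[OF refl])
      fix t
      show "(c * indicator (- N) t) *\<^sub>R ?h (\<tau> t) = of_real c * \<i> * ?k t - indicator N t *\<^sub>R (of_real c * z)"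
      proof -
        have e: "of_real c * \<i> * ?k t = of_real c * (\<i> * ?k t)" by (simp only: mult.assoc)
        show ?thesis
        proof (cases "t \<in> N")
          case True
          then show ?thesis unfolding e kin[OF True] by (simp add: scaleR_conv_of_real)
        next
          case False
          then show ?thesis unfolding e kout[OF False] by (simp add: scaleR_conv_of_real)
        qed
      qed
    qed
    also have "\<dots> = (LINT t|\<nu>. of_real c * \<i> * ?k t) - (LINT t|\<nu>. indicator N t *\<^sub>R (of_real c * z))"
      by (intro Bochner_Integration.integral_diff integrable_mult_right ki)
         (rule integrable_const_bound[of _ "cmod (of_real c * z)"]; auto simp: indicator_def)
    also have "(LINT t|\<nu>. of_real c * \<i> * ?k t) = of_real c * \<i> * (LINT t|\<nu>. ?k t)"
      by (rule integral_mult_right_zero)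
    also have "(LINT t|\<nu>. indicator N t *\<^sub>R (of_real c * z)) = of_real p * z"
      by (simp add: p_def scaleR_conv_of_real)
    finally have "of_real c * \<i> * (LINT t|\<nu>. ?k t) = of_real p * z + (LINT t|\<rho>. ?h t)" by simp
    moreover have "M z = \<i> * f ?w" by (simp add: f_def Cw)
    moreover have "Im (f 0) = - Re (M \<i>)" "Re (f 0) = c" by (auto simp: f0 c_def)
    ultimately show ?thesis
      unfolding rep[OF w] by (simp add: algebra_simps)
  qed
  show ?thesis
  proof (intro exI conjI allI impI)
    show "0 \<le> p" using c by (simp add: p_def)
    show "finite_measure \<rho>" by (rule fin)
    show "sets \<rho> = sets borel" by (simp add: \<rho>_def)
  qed (rule main)
qed

section \<open>Behaviour of Weyl solutions near the endpoint\<close>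

lemma absorb_half: "N \<le> e + (X + a) \<Longrightarrow> X \<le> 1/2 * N \<Longrightarrow> N \<le> 2 * (e + a)" for N :: real
  by (simp add: field_simps)

lemma norm_sq_lower_bound:
  assumes f: "f \<in> L2 l" "continuous_on {l..} f" and ab: "l \<le> a" "a \<le> b"
    and K: "K \<ge> 0" "\<And>x. x \<in> {a..b} \<Longrightarrow> K \<le> cmod (f x)"
  shows "K\<^sup>2 * (b - a) \<le> norm_sq l f"
proof -
  have i: "integrable (half_line l) (\<lambda>x. (cmod (f x))\<^sup>2)" using f(1) by (simp add: L2_iff)
  have ai: "(\<lambda>x. (cmod (f x))\<^sup>2) absolutely_integrable_on {l..}"
    using i by (simp add: set_integrable_def integrable_restrict_space)
  have "K\<^sup>2 * (b - a) = integral {a..b} (\<lambda>x. K\<^sup>2)" using ab by simp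
  also have "\<dots> \<le> integral {a..b} (\<lambda>x. (cmod (f x))\<^sup>2)"
    by (intro integral_le integrable_continuous_real continuous_intros continuous_on_subset[OF f(2)])
       (use ab K in \<open>auto intro: power_mono\<close>)
  also have "\<dots> \<le> integral {l..} (\<lambda>x. (cmod (f x))\<^sup>2)"
    by (intro integral_subset_le integrable_continuous_real continuous_intros continuous_on_subset[OF f(2)]
        set_lebesgue_integral_eq_integral(1)[OF ai]) (use ab in auto)
  also have "\<dots> = norm_sq l f"
    using set_lebesgue_integral_eq_integral(2)[OF ai]
    by (simp add: norm_sq_def set_lebesgue_integral_def integral_restrict_space)
  finally show ?thesis .
qed

text \<open>Cauchy-Schwarz on a short interval; the small factor \<open>s\<close> compensates the factor \<open>|z|\<close> in
the equation.\<close>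

lemma L1_bound_by_norm_sq:
  assumes f: "f \<in> L2 l" "continuous_on {l..} f" and t: "l \<le> t" "t \<le> l + s"
  shows "integral {l..t} (\<lambda>x. cmod (f x)) \<le> sqrt (s * norm_sq l f)"
proof -
  let ?f = "\<lambda>x. complex_of_real (cmod (f x))" and ?g = "\<lambda>x. indicator {l..t} x *\<^sub>R (1 :: complex)"
  have fL: "?f \<in> L2 l"
  proof -
    have "?f \<in> borel_measurable (half_line l)"
      by (intro continuous_measurable_half_line continuous_intros f(2))
    then show ?thesis using f(1) by (simp add: L2_iff)
  qed
  have nf: "norm_sq l ?f = norm_sq l f" by (simp add: norm_sq_def)
  have ai1: "(\<lambda>x. 1 :: real) absolutely_integrable_on {l..t}"
    by (intro absolutely_integrable_continuous_real continuous_intros)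
  have e1: "(\<lambda>x. indicator {l..} x *\<^sub>R (cmod (?g x))\<^sup>2) = (\<lambda>x. indicator {l..t} x *\<^sub>R (1 :: real))"
    by (auto simp: indicator_def fun_eq_iff)
  have gm: "?g \<in> borel_measurable (half_line l)"
    by (intro borel_measurable_scaleR borel_measurable_const measurable_restrict_space1 borel_measurable_indicator) simp
  have gi: "integrable (half_line l) (\<lambda>x. (cmod (?g x))\<^sup>2)"
    using integrable_restrict_space[of "{l..}" lebesgue "\<lambda>x. (cmod (?g x))\<^sup>2"] ai1
    unfolding set_integrable_def e1 by simp
  have gL: "?g \<in> L2 l" using gm gi unfolding L2_iff by blast
  have ng: "norm_sq l ?g = t - l"
    using integral_restrict_space[of "{l..}" lebesgue "\<lambda>x. (cmod (?g x))\<^sup>2"] set_lebesgue_integral_eq_integral(2)[OF ai1] t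
    unfolding norm_sq_def set_lebesgue_integral_def e1 by simp
  have ai: "?f absolutely_integrable_on {l..t}"
    by (intro absolutely_integrable_continuous_real continuous_intros continuous_on_subset[OF f(2)]) auto
  have e2: "(\<lambda>x. indicator {l..} x *\<^sub>R (?f x * ?g x)) = (\<lambda>x. indicator {l..t} x *\<^sub>R ?f x)"
    by (auto simp: indicator_def fun_eq_iff)
  have "(LINT x|half_line l. ?f x * ?g x) = integral {l..t} ?f"
    using integral_restrict_space[of "{l..}" lebesgue "\<lambda>x. ?f x * ?g x"] set_lebesgue_integral_eq_integral(2)[OF ai]
    unfolding set_lebesgue_integral_def e2 by simp
  also have "integral {l..t} ?f = of_real (integral {l..t} (\<lambda>x. cmod (f x)))"
    by (intro integral_unique has_integral_of_real integrable_integral integrable_continuous_real continuous_intros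
        continuous_on_subset[OF f(2)]) auto
  finally have e3: "(LINT x|half_line l. ?f x * ?g x) = of_real (integral {l..t} (\<lambda>x. cmod (f x)))" .
  have "(integral {l..t} (\<lambda>x. cmod (f x)))\<^sup>2 \<le> norm_sq l f * (t - l)"
    using L2_Cauchy_Schwarz[OF fL gL] unfolding e3 nf ng by simp
  also have "\<dots> \<le> norm_sq l f * s" using t norm_sq_nonneg by (intro mult_left_mono) auto
  finally show ?thesis by (simp add: real_le_rsqrt mult.commute)
qed

context weyl_problem
begin

text \<open>Near \<open>l\<close> the Weyl solution is its linearization \<open>1 - m(z) (x - l)\<close>, with an error that stays under control for large
\<open>|z|\<close>: the term \<open>z \<gamma>\<close> of the equation is estimated through the norm of \<open>\<gamma>\<close>, and the term \<open>q \<gamma>\<close> through the maximum \<open>N\<close> of \<open>|\<gamma>|\<close>,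
which the same estimate bounds in turn.\<close>

lemma weyl_solution_near_endpoint:
  assumes z: "Im z \<noteq> 0" and s: "0 < s" "s * Q \<le> 1/2" and Q: "integral {l..l+s} (\<lambda>x. \<bar>q x\<bar>) \<le> Q"
    and x: "x \<in> {l..l+s}"
  defines "a \<equiv> cmod z * s * sqrt (s * norm_sq l (weyl_solution z))"
  shows "cmod (weyl_solution z x - 1 + m z * of_real (x - l)) \<le> 2 * s * Q * (1 + cmod (m z) * s + a) + a"
proof -
  let ?y = "weyl_solution z"
  note sl = weyl_solution(2)[OF z] and L2 = weyl_solution(6)[OF z]
  note c = sturm_liouvilleD(3)[OF sl] sturm_liouvilleD(4)[OF sl]
  have qi: "(\<lambda>x. \<bar>q x\<bar>) absolutely_integrable_on {l..b}" for b
    using q_summable set_integrable_abs[of lebesgue "{l..b}" q] unfolding locally_summable_def by blast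
  note qi' = set_lebesgue_integral_eq_integral(1)[OF qi]
  obtain x0 where x0: "x0 \<in> {l..l+s}" "\<And>x. x \<in> {l..l+s} \<Longrightarrow> cmod (?y x) \<le> cmod (?y x0)"
    using continuous_attains_sup[of "{l..l+s}" "\<lambda>x. cmod (?y x)"] s
      continuous_on_norm[OF continuous_on_subset[OF c(1), of "{l..l+s}"]] by auto
  define N where "N = cmod (?y x0)"
  have N0: "N \<ge> 0" by (simp add: N_def)
  have Q0: "Q \<ge> 0" using Q integral_nonneg[OF qi', of "l+s"] by simp
  define B where "B = Q * N + cmod z * sqrt (s * norm_sq l ?y)"
  have y1: "cmod (D1 l ?y t + m z) \<le> B" if t: "t \<in> {l..l+s}" for t
  proof -
    let ?r = "\<lambda>x. of_real (q x) * ?y x - z * ?y x"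
    have ci: "(\<lambda>x. cmod (?y x)) integrable_on {l..t}"
      by (intro integrable_continuous_real continuous_intros continuous_on_subset[OF c(1)]) auto
    have "D1 l ?y t = D1 l ?y l + integral {l..t} ?r"
      by (rule has_ac_derivative_integral(2)[OF sturm_liouvilleD(2)[OF sl]]) (use t in auto)
    then have "cmod (D1 l ?y t + m z) = cmod (integral {l..t} ?r)" by (simp add: weyl_solution[OF z])
    also have "\<dots> \<le> integral {l..t} (\<lambda>x. \<bar>q x\<bar> * N + cmod z * cmod (?y x))"
    proof (rule integral_norm_bound_integral)
      show "?r integrable_on {l..t}"
        by (rule set_lebesgue_integral_eq_integral(1)[OF has_ac_derivative_integral(1)[OF sturm_liouvilleD(2)[OF sl]]])
      show "(\<lambda>x. \<bar>q x\<bar> * N + cmod z * cmod (?y x)) integrable_on {l..t}"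
        by (intro Henstock_Kurzweil_Integration.integrable_add integrable_on_mult_left integrable_on_mult_right qi' ci)
      fix x assume "x \<in> {l..t}"
      then have "cmod (?y x) \<le> N" using x0(2)[of x] t by (auto simp: N_def)
      then have "\<bar>q x\<bar> * cmod (?y x) \<le> \<bar>q x\<bar> * N" by (intro mult_left_mono) auto
      then show "cmod (?r x) \<le> \<bar>q x\<bar> * N + cmod z * cmod (?y x)"
        using norm_triangle_ineq4[of "of_real (q x) * ?y x" "z * ?y x"] by (simp add: norm_mult)
    qed
    also have "\<dots> = integral {l..t} (\<lambda>x. \<bar>q x\<bar>) * N + cmod z * integral {l..t} (\<lambda>x. cmod (?y x))"
      by (subst Henstock_Kurzweil_Integration.integral_add)
         (auto intro: integrable_on_mult_left integrable_on_mult_right qi' ci)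
    also have "\<dots> \<le> B"
      unfolding B_def
    proof (intro add_mono mult_right_mono mult_left_mono)
      have "integral {l..t} (\<lambda>x. \<bar>q x\<bar>) \<le> integral {l..l+s} (\<lambda>x. \<bar>q x\<bar>)"
        by (rule integral_subset_le) (use t qi' in auto)
      then show "integral {l..t} (\<lambda>x. \<bar>q x\<bar>) \<le> Q" using Q by simp
      show "integral {l..t} (\<lambda>x. cmod (?y x)) \<le> sqrt (s * norm_sq l ?y)"
        by (rule L1_bound_by_norm_sq[OF L2 c(1)]) (use t in auto)
    qed (use N0 in auto)
    finally show ?thesis .
  qed
  have B0: "B \<ge> 0" using order_trans[OF norm_ge_zero y1[of l]] s by simp
  have main: "cmod (?y t - 1 + m z * of_real (t - l)) \<le> s * B" if t: "t \<in> {l..l+s}" for t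
  proof -
    have di: "D1 l ?y integrable_on {l..t}"
      by (intro integrable_continuous_real continuous_on_subset[OF c(2)]) auto
    have "?y t = 1 + integral {l..t} (D1 l ?y)"
      using has_ac_derivative_integral(2)[OF sturm_liouvilleD(1)[OF sl], of t] t by (simp only: weyl_solution(4)[OF z]) simp
    moreover have "integral {l..t} (\<lambda>x. D1 l ?y x + m z) = integral {l..t} (D1 l ?y) + m z * of_real (t - l)"
    proof -
      have "integral {l..t} (\<lambda>x. m z) = m z * of_real (t - l)"
        using t by (simp add: scaleR_conv_of_real mult.commute)
      then show ?thesis using Henstock_Kurzweil_Integration.integral_add[OF di, of "\<lambda>x. m z"] by (simp only: integrable_const_ivl)
    qed
    ultimately have "?y t - 1 + m z * of_real (t - l) = integral {l..t} (\<lambda>x. D1 l ?y x + m z)" by simp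
    also have "cmod \<dots> \<le> B * (t - l)"
      by (rule integral_bound) (use t y1 in \<open>auto intro!: continuous_intros continuous_on_subset[OF c(2)]\<close>)
    also have "\<dots> \<le> B * s" using t B0 by (intro mult_left_mono) auto
    finally show ?thesis by (simp add: mult.commute)
  qed
  have sB: "s * B = s * Q * N + a" by (simp add: B_def a_def algebra_simps)
  have "N \<le> 1 + cmod (m z) * s + s * B"
  proof -
    have "N = cmod ((?y x0 - 1 + m z * of_real (x0 - l)) + 1 - m z * of_real (x0 - l))" by (simp add: N_def)
    also have "\<dots> \<le> cmod (?y x0 - 1 + m z * of_real (x0 - l)) + 1 + cmod (m z) * (x0 - l)"
      using norm_triangle_ineq4[of "(?y x0 - 1 + m z * of_real (x0 - l)) + 1" "m z * of_real (x0 - l)"]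
        norm_triangle_ineq[of "?y x0 - 1 + m z * of_real (x0 - l)" 1] x0(1)
      by (simp add: norm_mult del: of_real_diff)
    also have "cmod (m z) * (x0 - l) \<le> cmod (m z) * s" using x0(1) by (intro mult_left_mono) auto
    finally show ?thesis using main[OF x0(1)] by linarith
  qed
  moreover have "s * Q * N \<le> 1/2 * N" using s N0 by (intro mult_right_mono) auto
  ultimately have "N \<le> 2 * (1 + cmod (m z) * s + a)" unfolding sB by (rule absorb_half)
  then have "s * Q * N \<le> s * Q * (2 * (1 + cmod (m z) * s + a))"
    using s Q0 by (intro mult_left_mono) auto
  then show ?thesis using main[OF x] unfolding sB by (simp add: algebra_simps)
qed

text \<open>Bounds the integral of \<open>|q|\<close> over all intervals \<open>[l, l + s]\<close> with \<open>s \<le> 1\<close> at once, so that \<open>s\<close> may be chosen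
after it.\<close>

definition potential_mass where "potential_mass = integral {l..l+1} (\<lambda>x. \<bar>q x\<bar>)"

lemma potential_mass_nonneg: "0 \<le> potential_mass"
proof -
  have "(\<lambda>x. \<bar>q x\<bar>) absolutely_integrable_on {l..b}" for b
    using q_summable set_integrable_abs[of lebesgue "{l..b}" q] unfolding locally_summable_def by blast
  from set_lebesgue_integral_eq_integral(1)[OF this]
  show ?thesis unfolding potential_mass_def by (intro Henstock_Kurzweil_Integration.integral_nonneg) auto
qed

lemma potential_mass_bound: "s \<le> 1 \<Longrightarrow> integral {l..l+s} (\<lambda>x. \<bar>q x\<bar>) \<le> potential_mass"
proof -
  have "(\<lambda>x. \<bar>q x\<bar>) absolutely_integrable_on {l..b}" for b
    using q_summable set_integrable_abs[of lebesgue "{l..b}" q] unfolding locally_summable_def by blast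
  from set_lebesgue_integral_eq_integral(1)[OF this]
  show "s \<le> 1 \<Longrightarrow> integral {l..l+s} (\<lambda>x. \<bar>q x\<bar>) \<le> potential_mass"
    unfolding potential_mass_def by (intro integral_subset_le) auto
qed

section \<open>The measure of the Weyl function\<close>

text \<open>With norms bounded above, the error in the linearization at \<open>\<i> y\<close> is a small multiple of \<open>s y\<close> on \<open>[l, l + s]\<close>, whereas the
linear term has size at least \<open>p y s / 2\<close> on the right half of this interval. For large \<open>y\<close> the solution is large there,
and so is its norm.\<close>

lemma no_linear_growth:
  assumes p: "p > 0" and lo: "\<And>y. y \<ge> 1 \<Longrightarrow> p \<le> norm_sq l (weyl_solution (\<i> * of_real y))"
    and hi: "\<And>y. y \<ge> 1 \<Longrightarrow> norm_sq l (weyl_solution (\<i> * of_real y)) \<le> c"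
    and C: "\<And>y. y \<ge> 1 \<Longrightarrow> cmod (m (\<i> * of_real y)) \<le> C * y"
  shows False
proof -
  let ?Q = potential_mass
  have c: "c > 0" using p lo[of 1] hi[of 1] by simp
  have Q0: "?Q \<ge> 0" by (rule potential_mass_nonneg)
  \<comment> \<open>fix s so small that the error, apart from a bounded part, is at most \<open>y s p / 4\<close>, half of the linear term\<close>
  have "((\<lambda>s. 2 * ?Q * (C * s + s * sqrt (s * c)) + sqrt (s * c)) \<longlongrightarrow> 2 * ?Q * (C * 0 + 0 * sqrt (0 * c)) + sqrt (0 * c)) (at_right 0)"
    by (intro tendsto_intros)
  then have "eventually (\<lambda>s. 2 * ?Q * (C * s + s * sqrt (s * c)) + sqrt (s * c) < p / 4) (at_right 0)"
    by (rule order_tendstoD(2)) (use p in simp)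
  moreover have "((\<lambda>s. s * ?Q) \<longlongrightarrow> 0 * ?Q) (at_right 0)" by (intro tendsto_intros)
  then have "eventually (\<lambda>s. s * ?Q < 1/2) (at_right 0)" by (rule order_tendstoD(2)) simp
  moreover have "eventually (\<lambda>s. s > (0::real)) (at_right 0)" by (rule eventually_at_right_less)
  moreover have "eventually (\<lambda>s. s < (1::real)) (at_right 0)"
    by (rule order_tendstoD(2)[OF tendsto_ident_at]) simp
  ultimately have "eventually (\<lambda>s. 2 * ?Q * (C * s + s * sqrt (s * c)) + sqrt (s * c) < p / 4 \<and> s * ?Q < 1/2 \<and> s > 0 \<and> s < 1) (at_right 0)"
    by eventually_elim auto
  then obtain s where s: "2 * ?Q * (C * s + s * sqrt (s * c)) + sqrt (s * c) < p / 4" "s * ?Q < 1/2" "s > 0" "s < 1"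
    using eventually_happens by (metis (no_types, lifting) trivial_limit_at_right_real)
  \<comment> \<open>a lower bound K on an interval of length \<open>s / 2\<close> would make the squared norm exceed c\<close>
  define K where "K = sqrt (2 * c / s) + 1"
  have K: "K > 0" using c s by (simp add: K_def add_nonneg_pos)
  have K2: "K\<^sup>2 * (s / 2) > c"
  proof -
    have "K\<^sup>2 > (sqrt (2 * c / s))\<^sup>2" unfolding K_def using c s by (intro power_strict_mono) auto
    then have "K\<^sup>2 > 2 * c / s" using c s by simp
    then show ?thesis using s by (simp add: field_simps)
  qed
  define y where "y = max 1 ((K + 2) * 4 / (s * p))"
  have y: "y \<ge> 1" "y * s * p / 4 \<ge> K + 2"
  proof -
    have "y \<ge> (K + 2) * 4 / (s * p)" by (simp add: y_def)
    then show "y * s * p / 4 \<ge> K + 2" using s p by (simp add: field_simps)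
  qed (simp add: y_def)
  let ?z = "\<i> * of_real y"
  have z: "Im ?z \<noteq> 0" using y by simp
  define a where "a = cmod ?z * s * sqrt (s * norm_sq l (weyl_solution ?z))"
  have a: "a \<le> y * s * sqrt (s * c)"
    unfolding a_def using hi[OF y(1)] y(1) s by (simp add: norm_mult)
  have lower: "K \<le> cmod (weyl_solution ?z x)" if x: "x \<in> {l + s/2..l + s}" for x
  proof -
    let ?d = "weyl_solution ?z x - 1 + m ?z * of_real (x - l)"
    have "cmod ?d \<le> 2 * s * ?Q * (1 + cmod (m ?z) * s + a) + a"
      unfolding a_def by (rule weyl_solution_near_endpoint[OF z s(3) _ potential_mass_bound]) (use s x in auto)
    also have "\<dots> \<le> 2 * s * ?Q * (1 + C * y * s + y * s * sqrt (s * c)) + y * s * sqrt (s * c)"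
      by (intro add_mono mult_left_mono mult_right_mono order_refl a C[OF y(1)]) (use s Q0 in auto)
    also have "\<dots> = 2 * (s * ?Q) + y * s * (2 * ?Q * (C * s + s * sqrt (s * c)) + sqrt (s * c))"
      by (simp add: algebra_simps)
    also have "\<dots> \<le> 2 * (1/2) + y * s * (p / 4)"
      using s y by (intro add_mono mult_left_mono) auto
    finally have d: "cmod ?d \<le> 1 + y * s * p / 4" by simp
    have "p * y * (s / 2) \<le> cmod (m ?z) * (x - l)"
    proof (rule mult_mono)
      have "y * p \<le> y * norm_sq l (weyl_solution ?z)" using lo[OF y(1)] y(1) by (intro mult_left_mono) auto
      also have "\<dots> = - Im (m ?z)" using Im_m[OF z] by simp
      also have "\<dots> \<le> cmod (m ?z)" using abs_Im_le_cmod[of "m ?z"] by linarith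
      finally show "p * y \<le> cmod (m ?z)" by (simp add: mult.commute)
    qed (use x s in auto)
    also have "\<dots> = cmod (m ?z * of_real (x - l))" using x s by (simp add: norm_mult del: of_real_diff)
    also have "m ?z * of_real (x - l) = ?d - weyl_solution ?z x + 1" by simp
    also have "cmod \<dots> \<le> cmod ?d + cmod (weyl_solution ?z x) + 1"
      using norm_triangle_ineq[of "?d - weyl_solution ?z x" 1] norm_triangle_ineq4[of ?d "weyl_solution ?z x"] by simp
    finally have "p * y * (s / 2) \<le> 1 + y * s * p / 4 + cmod (weyl_solution ?z x) + 1" using d by linarith
    moreover have "p * y * (s / 2) = 2 * (y * s * p / 4)" by (simp add: algebra_simps)
    ultimately show ?thesis using y(2) by linarith
  qed
  have "K\<^sup>2 * ((l + s) - (l + s/2)) \<le> norm_sq l (weyl_solution ?z)"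
    by (rule norm_sq_lower_bound[OF weyl_solution(6)[OF z] sturm_liouvilleD(3)[OF weyl_solution(2)[OF z]] _ _ less_imp_le[OF K] lower])
       (use s in auto)
  then show False using K2 hi[OF y(1)] by (simp add: algebra_simps)
qed

text \<open>If \<open>m\<close> is bounded and the norm is \<open>O(1/y)\<close> along the imaginary axis, the linearization error is small uniformly in
\<open>y\<close>. So the solution stays above \<open>1/2\<close> on a fixed interval, and its norm cannot decay.\<close>

lemma no_fast_decay:
  assumes C: "\<And>y. y \<ge> 1 \<Longrightarrow> cmod (m (\<i> * of_real y)) \<le> C"
    and K0: "\<And>y. y \<ge> 1 \<Longrightarrow> y\<^sup>2 * norm_sq l (weyl_solution (\<i> * of_real y)) \<le> K"
  shows False
proof -
  let ?Q = potential_mass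
  have C0: "C \<ge> 0" using C[of 1] norm_ge_zero[of "m (\<i> * of_real 1)"] by (simp del: norm_ge_zero)
  have K: "K \<ge> 0" using K0[of 1] norm_sq_nonneg[of l "weyl_solution \<i>"] by simp
  have Q0: "?Q \<ge> 0" by (rule potential_mass_nonneg)
  have "((\<lambda>s. C * s + 2 * s * ?Q * (1 + C * s + s * sqrt (s * K)) + s * sqrt (s * K)) \<longlongrightarrow>
      C * 0 + 2 * 0 * ?Q * (1 + C * 0 + 0 * sqrt (0 * K)) + 0 * sqrt (0 * K)) (at_right 0)"
    by (intro tendsto_intros)
  then have "eventually (\<lambda>s. C * s + 2 * s * ?Q * (1 + C * s + s * sqrt (s * K)) + s * sqrt (s * K) < 1 / 2) (at_right 0)"
    by (rule order_tendstoD(2)) simp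
  moreover have "((\<lambda>s. s * ?Q) \<longlongrightarrow> 0 * ?Q) (at_right 0)" by (intro tendsto_intros)
  then have "eventually (\<lambda>s. s * ?Q < 1/2) (at_right 0)" by (rule order_tendstoD(2)) simp
  moreover have "eventually (\<lambda>s. s > (0::real)) (at_right 0)" by (rule eventually_at_right_less)
  moreover have "eventually (\<lambda>s. s < (1::real)) (at_right 0)"
    by (rule order_tendstoD(2)[OF tendsto_ident_at]) simp
  ultimately have "eventually (\<lambda>s. C * s + 2 * s * ?Q * (1 + C * s + s * sqrt (s * K)) + s * sqrt (s * K) < 1 / 2 \<and> s * ?Q < 1/2 \<and> s > 0 \<and> s < 1) (at_right 0)"
    by eventually_elim auto
  then obtain s where s: "C * s + 2 * s * ?Q * (1 + C * s + s * sqrt (s * K)) + s * sqrt (s * K) < 1 / 2" "s * ?Q < 1/2" "s > 0" "s < 1"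
    using eventually_happens by (metis (no_types, lifting) trivial_limit_at_right_real)
  define y where "y = max 1 (4 * K / s + 1)"
  have y: "y \<ge> 1" "y > 4 * K / s" by (auto simp: y_def max_def)
  let ?z = "\<i> * of_real y"
  have z: "Im ?z \<noteq> 0" using y by simp
  define a where "a = cmod ?z * s * sqrt (s * norm_sq l (weyl_solution ?z))"
  have a: "a \<le> s * sqrt (s * K)"
  proof -
    have "a = s * sqrt (s * (y\<^sup>2 * norm_sq l (weyl_solution ?z)))"
      unfolding a_def using y(1) by (simp add: norm_mult real_sqrt_mult)
    also have "\<dots> \<le> s * sqrt (s * K)" using K0[OF y(1)] s by simp
    finally show ?thesis .
  qed
  have lower: "1/2 \<le> cmod (weyl_solution ?z x)" if x: "x \<in> {l..l + s}" for x
  proof -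
    let ?d = "weyl_solution ?z x - 1 + m ?z * of_real (x - l)"
    have "cmod ?d \<le> 2 * s * ?Q * (1 + cmod (m ?z) * s + a) + a"
      unfolding a_def by (rule weyl_solution_near_endpoint[OF z s(3) _ potential_mass_bound]) (use s x in auto)
    also have "\<dots> \<le> 2 * s * ?Q * (1 + C * s + s * sqrt (s * K)) + s * sqrt (s * K)"
      by (intro add_mono mult_left_mono mult_right_mono order_refl a C[OF y(1)]) (use s Q0 in auto)
    finally have d: "cmod ?d \<le> 2 * s * ?Q * (1 + C * s + s * sqrt (s * K)) + s * sqrt (s * K)" .
    have "cmod (m ?z * of_real (x - l)) \<le> C * s"
      unfolding norm_mult by (rule mult_mono) (use x s C[OF y(1)] C0 in \<open>auto simp del: of_real_diff\<close>)
    moreover have "cmod (?d - weyl_solution ?z x - m ?z * of_real (x - l)) = 1" by simp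
    moreover have "cmod (?d - weyl_solution ?z x - m ?z * of_real (x - l)) \<le> cmod ?d + cmod (weyl_solution ?z x) + cmod (m ?z * of_real (x - l))"
      using norm_triangle_ineq4[of "?d - weyl_solution ?z x" "m ?z * of_real (x - l)"] norm_triangle_ineq4[of ?d "weyl_solution ?z x"] by linarith
    ultimately show ?thesis using d s(1) by linarith
  qed
  have "(1/2)\<^sup>2 * ((l + s) - l) \<le> norm_sq l (weyl_solution ?z)"
    by (rule norm_sq_lower_bound[OF weyl_solution(6)[OF z] sturm_liouvilleD(3)[OF weyl_solution(2)[OF z]] _ _ _ lower]) (use s in auto)
  then have "s / 4 \<le> norm_sq l (weyl_solution ?z)" by (simp add: power2_eq_square)
  then have "y\<^sup>2 * (s / 4) \<le> y\<^sup>2 * norm_sq l (weyl_solution ?z)" by (rule mult_left_mono) simp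
  then have "y\<^sup>2 * (s / 4) \<le> K" using K0[OF y(1)] by linarith
  moreover have "y * (s/4) \<le> y\<^sup>2 * (s / 4)" using y s by (intro mult_right_mono) (auto simp: power2_eq_square)
  moreover have "y * (s / 4) > K" using y(2) s by (simp add: field_simps)
  ultimately show False by linarith
qed

text \<open>Along the imaginary axis the squared norm of the Weyl solution is \<open>p + J(y)\<close>, where \<open>p\<close> is the coefficient of the linear term and
\<open>J(y)\<close> the integral of \<open>(1 + t\<^sup>2) / (t\<^sup>2 + y\<^sup>2)\<close>. If \<open>p > 0\<close> the hypotheses of \<open>no_linear_growth\<close> hold, and if the integral
of \<open>1 + t\<^sup>2\<close> is finite those of \<open>no_fast_decay\<close>.\<close>

theorem weyl_measure:
  obtains \<rho> :: "real measure" where "finite_measure \<rho>" "sets \<rho> = sets borel" "measure \<rho> UNIV = - Im (m \<i>)"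
    "(\<integral>\<^sup>+t. ennreal (1 + t\<^sup>2) \<partial>\<rho>) = \<infinity>"
    "\<And>z. Im z > 0 \<Longrightarrow> Re (m \<i>) - m z = (LINT t|\<rho>. (1 + of_real t * z) / (of_real t - z))"
proof -
  have "(\<lambda>z. - m z) holomorphic_on {z. Im z > 0}" by (intro holomorphic_intros m_holomorphic)
  moreover have "Im (- m z) > 0" if "Im z > 0" for z using Im_m_neg[OF that] by simp
  ultimately obtain p and \<rho> :: "real measure" where p: "p \<ge> 0" and fin: "finite_measure \<rho>" and sets: "sets \<rho> = sets borel"
    and rep: "\<And>z. Im z > 0 \<Longrightarrow> - m z = of_real (Re (- m \<i>)) + of_real p * z + (LINT t|\<rho>. (1 + of_real t * z) / (of_real t - z))"
    using Nevanlinna_representation[of "\<lambda>z. - m z"] by blast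
  interpret finite_measure \<rho> by (rule fin)
  note [measurable_cong] = sets
  have sp: "space \<rho> = UNIV" using sets_eq_imp_space_eq[OF sets] by simp
  let ?h = "\<lambda>y t. (1 + of_real t * (\<i> * of_real y)) / (of_real t - \<i> * of_real y) :: complex"
  have hm[measurable]: "?h y \<in> borel_measurable \<rho>" for y by measurable
  have hsq: "(cmod (?h y t))\<^sup>2 = (1 + t\<^sup>2 * y\<^sup>2) / (t\<^sup>2 + y\<^sup>2)" for y t
    by (simp add: norm_divide power_divide cmod_power2 power_mult_distrib)
  have hb: "cmod (?h y t) \<le> y" if "y \<ge> 1" for y t
  proof (rule power2_le_imp_le)
    have "1 \<le> y\<^sup>2 * y\<^sup>2" using that mult_mono[of 1 "y\<^sup>2" 1 "y\<^sup>2"] by simp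
    then have "1 + t\<^sup>2 * y\<^sup>2 \<le> y\<^sup>2 * (t\<^sup>2 + y\<^sup>2)" by (simp add: algebra_simps)
    moreover have "t\<^sup>2 + y\<^sup>2 > 0" using that by (intro add_nonneg_pos) auto
    ultimately show "(cmod (?h y t))\<^sup>2 \<le> y\<^sup>2" unfolding hsq by (simp add: divide_le_eq)
  qed (use that in simp)
  have hi: "integrable \<rho> (?h y)" if "y \<ge> 1" for y
    by (rule integrable_const_bound[of _ y]) (use hb[OF that] in auto)
  have hIm: "Im (?h y t) = y * ((1 + t\<^sup>2) / (t\<^sup>2 + y\<^sup>2))" for y t
    by (simp add: Im_divide power2_eq_square algebra_simps)
  define J where "J y = (LINT t|\<rho>. (1 + t\<^sup>2) / (t\<^sup>2 + y\<^sup>2))" for y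
  have Jb: "0 \<le> (1 + t\<^sup>2) / (t\<^sup>2 + y\<^sup>2)" "(1 + t\<^sup>2) / (t\<^sup>2 + y\<^sup>2) \<le> 1" if "y \<ge> 1" for y t :: real
  proof -
    have "1 \<le> y\<^sup>2" using that by simp
    moreover have "t\<^sup>2 + y\<^sup>2 > 0" using that by (intro add_nonneg_pos) auto
    ultimately show "(1 + t\<^sup>2) / (t\<^sup>2 + y\<^sup>2) \<le> 1" by (simp add: divide_le_eq)
  qed (simp add: add_nonneg_nonneg)
  have Ji: "integrable \<rho> (\<lambda>t. (1 + t\<^sup>2) / (t\<^sup>2 + y\<^sup>2))" if "y \<ge> 1" for y
    by (rule integrable_const_bound[of _ 1]) (use Jb[OF that] in auto)
  have ImI: "Im (LINT t|\<rho>. ?h y t) = y * J y" if "y \<ge> 1" for y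
  proof -
    have "Im (LINT t|\<rho>. ?h y t) = (LINT t|\<rho>. Im (?h y t))" by (rule integral_Im[symmetric, OF hi[OF that]])
    then show ?thesis unfolding hIm J_def by (simp only: integral_mult_right_zero)
  qed
  have nI: "cmod (LINT t|\<rho>. ?h y t) \<le> y * measure \<rho> UNIV" if "y \<ge> 1" for y
  proof -
    have "cmod (LINT t|\<rho>. ?h y t) \<le> (LINT t|\<rho>. cmod (?h y t))" by (rule integral_norm_bound)
    also have "\<dots> \<le> (LINT t|\<rho>. y)" by (rule integral_mono) (use hi[OF that] hb[OF that] in auto)
    finally show ?thesis by (simp add: sp mult.commute)
  qed
  have norm_sq_y: "norm_sq l (weyl_solution (\<i> * of_real y)) = p + J y" if "y \<ge> 1" for y
  proof -
    let ?z = "\<i> * of_real y"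
    have z: "Im ?z > 0" using that by simp
    have "Im (- m ?z) = p * y + y * J y" unfolding rep[OF z] using ImI[OF that] by simp
    then have "y * norm_sq l (weyl_solution ?z) = y * (p + J y)" using Im_m[of ?z] z by (simp add: algebra_simps)
    then show ?thesis using that by simp
  qed
  have J_bounds: "0 \<le> J y" "J y \<le> measure \<rho> UNIV" if "y \<ge> 1" for y
  proof -
    show "0 \<le> J y" unfolding J_def by (rule Bochner_Integration.integral_nonneg) (rule Jb[OF that])
    have "J y \<le> (LINT t|\<rho>. 1)" unfolding J_def by (rule integral_mono) (use Ji[OF that] Jb[OF that] in auto)
    then show "J y \<le> measure \<rho> UNIV" by (simp add: sp)
  qed
  have m_eq: "cmod (m (\<i> * of_real y)) \<le> \<bar>Re (m \<i>)\<bar> + p * y + cmod (LINT t|\<rho>. ?h y t)" if "y \<ge> 1" for y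
  proof -
    let ?z = "\<i> * of_real y" let ?I = "LINT t|\<rho>. ?h y t"
    have z: "Im ?z > 0" using that by simp
    have "cmod (m ?z) = cmod (of_real (Re (- m \<i>)) + of_real p * ?z + ?I)"
      unfolding rep[OF z, symmetric] by simp
    also have "\<dots> \<le> cmod (of_real (Re (- m \<i>)) + of_real p * ?z) + cmod ?I" by (rule norm_triangle_ineq)
    also have "cmod (of_real (Re (- m \<i>)) + of_real p * ?z) \<le> cmod (of_real (Re (- m \<i>))) + cmod (of_real p * ?z)"
      by (rule norm_triangle_ineq)
    finally show ?thesis using p that by (simp add: norm_mult)
  qed
  have p0: "p = 0"
  proof (rule ccontr)
    assume "p \<noteq> 0"
    show False
    proof (rule no_linear_growth[of p "p + measure \<rho> UNIV" "\<bar>Re (m \<i>)\<bar> + p + measure \<rho> UNIV"])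
      fix y :: real assume y: "y \<ge> 1"
      have "\<bar>Re (m \<i>)\<bar> * 1 \<le> \<bar>Re (m \<i>)\<bar> * y" using y by (intro mult_left_mono) auto
      then show "cmod (m (\<i> * of_real y)) \<le> (\<bar>Re (m \<i>)\<bar> + p + measure \<rho> UNIV) * y"
        using m_eq[OF y] nI[OF y] by (simp add: algebra_simps)
    qed (use p \<open>p \<noteq> 0\<close> norm_sq_y J_bounds in auto)
  qed
  have inf: "(\<integral>\<^sup>+t. ennreal (1 + t\<^sup>2) \<partial>\<rho>) = \<infinity>"
  proof (rule ccontr)
    assume "(\<integral>\<^sup>+t. ennreal (1 + t\<^sup>2) \<partial>\<rho>) \<noteq> \<infinity>"
    then have i2: "integrable \<rho> (\<lambda>t. 1 + t\<^sup>2)"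
      by (intro integrableI_bounded) (auto simp: top.not_eq_extremum)
    let ?K = "LINT t|\<rho>. 1 + t\<^sup>2"
    show False
    proof (rule no_fast_decay[of "\<bar>Re (m \<i>)\<bar> + ?K" ?K])
      fix y :: real assume y: "y \<ge> 1"
      have hb2: "cmod (?h y t) \<le> 1 + t\<^sup>2" for t
      proof (rule power2_le_imp_le)
        have pos: "t\<^sup>2 + y\<^sup>2 > 0" using y by (intro add_nonneg_pos) auto
        have y2: "1 \<le> y\<^sup>2" using y by simp
        have "1 + t\<^sup>2 * y\<^sup>2 \<le> (1 + t\<^sup>2) * y\<^sup>2" using y2 by (simp add: algebra_simps)
        also have "\<dots> \<le> (1 + t\<^sup>2) * (t\<^sup>2 + y\<^sup>2)" by (intro mult_left_mono) auto
        finally have le1: "(1 + t\<^sup>2 * y\<^sup>2) / (t\<^sup>2 + y\<^sup>2) \<le> 1 + t\<^sup>2" using pos by (simp add: divide_le_eq)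
        have "(1 + t\<^sup>2) * 1 \<le> (1 + t\<^sup>2) * (1 + t\<^sup>2)" by (intro mult_left_mono) auto
        then have "1 + t\<^sup>2 \<le> (1 + t\<^sup>2)\<^sup>2" by (simp only: power2_eq_square[of "1 + t\<^sup>2"] mult_1_right)
        with le1 show "(cmod (?h y t))\<^sup>2 \<le> (1 + t\<^sup>2)\<^sup>2" unfolding hsq by (rule order_trans)
      qed simp
      have "cmod (LINT t|\<rho>. ?h y t) \<le> (LINT t|\<rho>. cmod (?h y t))" by (rule integral_norm_bound)
      also have "\<dots> \<le> ?K" by (rule integral_mono) (use hi[OF y] i2 hb2 in auto)
      finally show "cmod (m (\<i> * of_real y)) \<le> \<bar>Re (m \<i>)\<bar> + ?K" using m_eq[OF y] p0 by simp
      have "y\<^sup>2 * J y = (LINT t|\<rho>. y\<^sup>2 * ((1 + t\<^sup>2) / (t\<^sup>2 + y\<^sup>2)))" unfolding J_def by (simp only: integral_mult_right_zero)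
      also have "\<dots> \<le> ?K"
      proof (rule integral_mono)
        show "integrable \<rho> (\<lambda>t. y\<^sup>2 * ((1 + t\<^sup>2) / (t\<^sup>2 + y\<^sup>2)))" by (intro integrable_mult_right Ji[OF y])
        fix t
        have pos: "t\<^sup>2 + y\<^sup>2 > 0" using y by (intro add_nonneg_pos) auto
        have "y\<^sup>2 * (1 + t\<^sup>2) \<le> (t\<^sup>2 + y\<^sup>2) * (1 + t\<^sup>2)" by (intro mult_right_mono) auto
        then show "y\<^sup>2 * ((1 + t\<^sup>2) / (t\<^sup>2 + y\<^sup>2)) \<le> 1 + t\<^sup>2" using pos by (simp add: divide_le_eq mult.commute)
      qed (rule i2)
      finally show "y\<^sup>2 * norm_sq l (weyl_solution (\<i> * of_real y)) \<le> ?K" using norm_sq_y[OF y] p0 by simp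
    qed
  qed
  have "- Im (m \<i>) = 1 * J 1" using rep[of \<i>] ImI[of 1] p0 by (simp add: complex_eq_iff)
  moreover have "J 1 = measure \<rho> UNIV"
  proof -
    have "(1 + t\<^sup>2) / (t\<^sup>2 + 1\<^sup>2) = 1" for t :: real
      using add_pos_nonneg[of 1 "t\<^sup>2"] by (simp add: add.commute)
    then have "J 1 = (LINT t|\<rho>. 1)" unfolding J_def by (simp only:)
    then show ?thesis by (simp add: sp)
  qed
  ultimately have "measure \<rho> UNIV = - Im (m \<i>)" by simp
  moreover have "Re (m \<i>) - m z = (LINT t|\<rho>. (1 + of_real t * z) / (of_real t - z))" if "Im z > 0" for z
  proof -
    have "Re (m \<i>) - m z = of_real (Re (m \<i>)) + (- m z)" by simp
    also have "\<dots> = (LINT t|\<rho>. (1 + of_real t * z) / (of_real t - z))"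
      unfolding rep[OF that] p0 by simp
    finally show ?thesis .
  qed
  ultimately show ?thesis using that[of \<rho>] fin sets inf by blast
qed

end

section \<open>The extremal problem\<close>

text \<open>At \<open>\<i>\<close> the integrand of the representation is \<open>\<i> / (1 + t\<^sup>2)\<close>.\<close>

lemma gen_donoghue_inv_at_i:
  assumes "M \<in> gen_donoghue_inv \<kappa>"
  shows "M \<i> = \<i> * of_real ((1 + \<kappa>) / (1 - \<kappa>))"
proof -
  from assms obtain \<sigma> :: "real measure" where \<kappa>: "0 \<le> \<kappa>" "\<kappa> < 1" and s: "sets \<sigma> = sets borel"
    and mass: "(\<integral>\<^sup>+ t. ennreal (1 / (1 + t\<^sup>2)) \<partial>\<sigma>) = ennreal ((1 + \<kappa>) / (1 - \<kappa>))"
    and rep: "\<And>z. Im z \<noteq> 0 \<Longrightarrow> M z = (LINT t|\<sigma>. 1 / (of_real t - z) - of_real (t / (1 + t\<^sup>2)))"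
    unfolding gen_donoghue_inv_def by blast
  note [measurable_cong] = s
  have "M \<i> = (LINT t|\<sigma>. 1 / (of_real t - \<i>) - of_real (t / (1 + t\<^sup>2)))" by (rule rep) simp
  also have "\<dots> = (LINT t|\<sigma>. \<i> * of_real (1 / (1 + t\<^sup>2)))"
  proof (rule Bochner_Integration.integral_cong[OF refl])
    fix t :: real
    have "1 + t\<^sup>2 \<noteq> 0" using add_pos_nonneg[of 1 "t\<^sup>2"] by simp
    then show "1 / (of_real t - \<i>) - of_real (t / (1 + t\<^sup>2)) = \<i> * of_real (1 / (1 + t\<^sup>2))"
      by (simp add: complex_eq_iff Re_divide Im_divide add.commute) (simp add: power2_eq_square[of "1 + t\<^sup>2"])
  qed
  also have "\<dots> = \<i> * of_real (LINT t|\<sigma>. 1 / (1 + t\<^sup>2))"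
    by (simp only: integral_mult_right_zero integral_complex_of_real)
  also have "(LINT t|\<sigma>. 1 / (1 + t\<^sup>2)) = (1 + \<kappa>) / (1 - \<kappa>)"
    by (subst integral_eq_nn_integral) (use mass \<kappa> in \<open>auto simp: add_nonneg_nonneg\<close>)
  finally show ?thesis .
qed

text \<open>Here \<open>u\<close> is the square of the distance of \<open>h\<close> from the axis of the circle and \<open>y\<close> its height. The equation of the circle
says that the product of the signed distances of \<open>y\<close> from the lowest and the highest point is a nonpositive
multiple of \<open>u\<close>.\<close>

lemma entropy_circle:
  fixes u y c \<kappa> :: real
  assumes \<kappa>: "0 < \<kappa>" "\<kappa> < 1" and c: "c > 0" and y: "y > 0" and u: "u \<ge> 0"
    and eq: "u + (y - c)\<^sup>2 = \<kappa>\<^sup>2 * (u + (y + c)\<^sup>2)"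
  shows "(1 - \<kappa>) / (1 + \<kappa>) * c \<le> y" "y = (1 - \<kappa>) / (1 + \<kappa>) * c \<Longrightarrow> u = 0"
proof -
  have f: "((1 + \<kappa>) * y - (1 - \<kappa>) * c) * ((1 - \<kappa>) * y - (1 + \<kappa>) * c) = - ((1 - \<kappa>\<^sup>2) * u)"
    using eq by (simp add: power2_eq_square algebra_simps)
  have k2: "1 - \<kappa>\<^sup>2 > 0" using \<kappa> by (simp add: power_less_one_iff abs_square_less_1)
  show "(1 - \<kappa>) / (1 + \<kappa>) * c \<le> y"
  proof (rule ccontr)
    assume "\<not> ?thesis"
    then have lt: "(1 + \<kappa>) * y < (1 - \<kappa>) * c" using \<kappa> by (simp add: field_simps)
    have "(1 - \<kappa>) * y < (1 + \<kappa>) * c"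
    proof -
      have "(1 - \<kappa>) * y \<le> (1 + \<kappa>) * y" using \<kappa> y by (intro mult_right_mono) auto
      moreover have "(1 - \<kappa>) * c \<le> (1 + \<kappa>) * c" using \<kappa> c by (intro mult_right_mono) auto
      ultimately show ?thesis using lt by linarith
    qed
    with lt have "((1 + \<kappa>) * y - (1 - \<kappa>) * c) * ((1 - \<kappa>) * y - (1 + \<kappa>) * c) > 0"
      by (intro mult_neg_neg) auto
    moreover have "(1 - \<kappa>\<^sup>2) * u \<ge> 0" using k2 u by simp
    ultimately show False using f by linarith
  qed
  assume "y = (1 - \<kappa>) / (1 + \<kappa>) * c"
  then have "(1 + \<kappa>) * y - (1 - \<kappa>) * c = 0" using \<kappa> by (simp add: field_simps)
  then have "(1 - \<kappa>\<^sup>2) * u = 0" using f by simp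
  then show "u = 0" using k2 by simp
qed

lemma tanh_half_exp:
  fixes S :: real
  shows "(exp S - 1) / (exp S + 1) = tanh (S / 2)" "(1 - exp (- S)) / (1 + exp (- S)) = tanh (S / 2)"
proof -
  have "(1 - exp (- S)) / (1 + exp (- S)) = tanh (S / 2)"
    using tanh_real_altdef[of "S/2"] by simp
  moreover have "(exp S - 1) / (exp S + 1) = (1 - exp (- S)) / (1 + exp (- S))"
  proof -
    have "1 - exp (- S) = (exp S - 1) / exp S" "1 + exp (- S) = (exp S + 1) / exp S"
      by (simp_all add: exp_minus field_simps)
    then show ?thesis by simp
  qed
  ultimately show "(exp S - 1) / (exp S + 1) = tanh (S / 2)" "(1 - exp (- S)) / (1 + exp (- S)) = tanh (S / 2)" by simp_all
qed

context weyl_problem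
begin

text \<open>The factor of the transfer function that contains \<open>\<mu>\<close> has modulus 1.\<close>

lemma c_entropy_iff:
  assumes h: "Im h > 0"
  shows "c_entropy (S_system l q \<mu> h) = ereal S \<longleftrightarrow>
    (Re (m \<i>) + Re h)\<^sup>2 + (Im h + Im (m \<i>))\<^sup>2 = (exp (- S))\<^sup>2 * ((Re (m \<i>) + Re h)\<^sup>2 + (Im h - Im (m \<i>))\<^sup>2)"
proof -
  have mi: "Im (m \<i>) < 0" by (rule Im_m_neg) simp
  have mm: "m (- \<i>) = cnj (m \<i>)" using m_cnj[of \<i>] by simp
  have z: "Im (- \<i>) \<noteq> 0" by simp
  have ne: "m (- \<i>) + h \<noteq> 0" using mi h by (auto simp: mm complex_eq_iff)
  let ?W = "transfer_function (S_system l q \<mu> h) (- \<i>)"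
  have W: "cmod ?W = cmod (cnj (m \<i>) + cnj h) / cmod (cnj (m \<i>) + h)"
  proof (cases \<mu>)
    case (Fin_mu \<mu>')
    have "of_real \<mu>' - cnj h = cnj (of_real \<mu>' - h)" by simp
    then have "cmod (of_real \<mu>' - cnj h) = cmod (of_real \<mu>' - h)" by (simp only: complex_mod_cnj)
    moreover have "cmod (of_real \<mu>' - h) \<noteq> 0" using h by (auto simp: complex_eq_iff)
    ultimately show ?thesis
      unfolding Fin_mu transfer_function_Fin[OF h z ne] mm norm_mult norm_divide by simp
  next
    case Inf_mu
    show ?thesis unfolding Inf_mu transfer_function_Inf[OF h z ne] mm norm_divide ..
  qed
  let ?N = "(Re (m \<i>) + Re h)\<^sup>2 + (Im h + Im (m \<i>))\<^sup>2" and ?D = "(Re (m \<i>) + Re h)\<^sup>2 + (Im h - Im (m \<i>))\<^sup>2"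
  have D: "?D > 0" using mi h by (intro add_nonneg_pos) auto
  have N: "?N \<ge> 0" by simp
  have W2: "(cmod ?W)\<^sup>2 = ?N / ?D"
    unfolding W power_divide cmod_power2 by (simp add: power2_eq_square algebra_simps)
  have "c_entropy (S_system l q \<mu> h) = ereal S \<longleftrightarrow> cmod ?W = exp (- S)"
  proof (cases "?W = 0")
    case True
    then show ?thesis by (simp add: c_entropy_def)
  next
    case False
    then have "cmod ?W > 0" by simp
    then have "- ln (cmod ?W) = S \<longleftrightarrow> cmod ?W = exp (- S)"
      by (metis exp_ln ln_exp minus_minus)
    then show ?thesis using False by (simp add: c_entropy_def)
  qed
  also have "\<dots> \<longleftrightarrow> (cmod ?W)\<^sup>2 = (exp (- S))\<^sup>2"
    by (simp add: power2_eq_iff_nonneg)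
  also have "\<dots> \<longleftrightarrow> ?N = (exp (- S))\<^sup>2 * ?D"
    unfolding W2 by (rule nonzero_divide_eq_eq) (rule less_imp_neq[OF D, symmetric])
  finally show ?thesis .
qed

lemma entropy_class_bound:
  assumes S: "S > 0" and mem: "(\<mu>, h) \<in> entropy_class l q S"
  shows "- tanh (S / 2) * Im (m \<i>) \<le> Im h"
    "Im h = - tanh (S / 2) * Im (m \<i>) \<Longrightarrow> Re h = - Re (m \<i>)"
proof -
  have h: "Im h > 0" and c: "c_entropy (S_system l q \<mu> h) = ereal S" using mem by (auto simp: entropy_class_def)
  have mi: "- Im (m \<i>) > 0" using Im_m_neg[of \<i>] by simp
  have k: "0 < exp (- S)" "exp (- S) < 1" using S by auto
  have e: "(Re (m \<i>) + Re h)\<^sup>2 + (Im h - (- Im (m \<i>)))\<^sup>2 = (exp (- S))\<^sup>2 * ((Re (m \<i>) + Re h)\<^sup>2 + (Im h + (- Im (m \<i>)))\<^sup>2)"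
    using c unfolding c_entropy_iff[OF h] by simp
  note ec = entropy_circle[OF k mi h _ e, unfolded tanh_half_exp]
  show "- tanh (S / 2) * Im (m \<i>) \<le> Im h" using ec(1) by simp
  assume "Im h = - tanh (S / 2) * Im (m \<i>)"
  then have "(Re (m \<i>) + Re h)\<^sup>2 = 0" by (intro ec(2)) auto
  then show "Re h = - Re (m \<i>)" by simp
qed

text \<open>With \<open>T = tanh (S/2)\<close> and \<open>d = \<mu> + Re m(\<i>)\<close>, the real part of the equation for the impedance at \<open>\<i>\<close> is
\<open>d (T\<^sup>2 - 1) = 0\<close>. For \<open>\<mu> = \<infinity>\<close> the equation would say \<open>T = 1/T\<close>.\<close>

lemma impedance_determines_mu:
  assumes S: "S > 0" and h: "Re h = - Re (m \<i>)" "Im h = - tanh (S / 2) * Im (m \<i>)"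
    and V: "impedance_function (S_system l q \<mu> h) \<i> = \<i> * of_real ((1 + exp (- S)) / (1 - exp (- S)))"
  shows "\<mu> = Fin_mu (- Re (m \<i>))"
proof -
  define c where "c = - Im (m \<i>)"
  define T where "T = tanh (S / 2)"
  have c: "c > 0" using Im_m_neg[of \<i>] by (simp add: c_def)
  have T: "0 < T" "T < 1" using S by (simp_all add: T_def tanh_real_lt_1)
  have T2: "T * T < 1" using mult_strict_mono[of T 1 T 1] T by simp
  have Imh: "Im h = T * c" using h(2) by (simp add: T_def c_def)
  have h0: "Im h > 0" using Imh T c by simp
  have i: "Im \<i> \<noteq> 0" by simp
  have "1 - exp (- S) \<noteq> 0" using S by simp
  then have V': "impedance_function (S_system l q \<mu> h) \<i> = \<i> * of_real (1 / T)"
    using V unfolding T_def tanh_half_exp(2)[symmetric] by simp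
  show ?thesis
  proof (cases \<mu>)
    case (Fin_mu \<mu>')
    define d where "d = \<mu>' + Re (m \<i>)"
    let ?N = "of_real (\<mu>' - Re h) * m \<i> + of_real (\<mu>' * Re h - (cmod h)\<^sup>2)"
    have cm: "(cmod h)\<^sup>2 = (Re (m \<i>))\<^sup>2 + (T * c)\<^sup>2" by (simp add: cmod_power2 h(1) Imh)
    have N: "?N = - of_real ((T * c)\<^sup>2) - \<i> * of_real (c * d)"
      unfolding cm by (simp add: complex_eq_iff h(1) d_def c_def power2_eq_square algebra_simps)
    have "?N \<noteq> 0" unfolding N using T c by (auto simp: complex_eq_iff)
    then have "(m \<i> + of_real \<mu>') * of_real (Im h) = \<i> * of_real (1 / T) * ?N"
      using V' unfolding Fin_mu impedance_function_Fin[OF h0 i] by (simp add: divide_eq_eq)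
    then have "Re ((m \<i> + of_real \<mu>') * of_real (Im h)) = Re (\<i> * of_real (1 / T) * ?N)" by simp
    then have "d * (T * c) = c * d / T" unfolding N by (simp add: Imh d_def add.commute)
    then have "c * d * (T * T - 1) = 0" using T by (simp add: field_simps)
    then have "d = 0" using c T2 by simp
    then show ?thesis by (simp add: Fin_mu d_def eq_neg_iff_add_eq_0)
  next
    case Inf_mu
    have "m \<i> + of_real (Re h) = - \<i> * of_real c" by (simp add: complex_eq_iff h(1) c_def)
    then have "of_real (T * c) / (- \<i> * of_real c) = \<i> * complex_of_real (1 / T)"
      using V' unfolding Inf_mu impedance_function_Inf[OF h0 i] Imh by simp
    moreover have "of_real (T * c) / (- \<i> * of_real c) = \<i> * complex_of_real T"
      using c by (simp add: complex_eq_iff Re_divide Im_divide)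
    ultimately have "T = 1 / T" by (simp add: complex_eq_iff)
    then show ?thesis using T T2 by (simp add: field_simps)
  qed
qed

text \<open>For these parameters the impedance is \<open>(Re m(\<i>) - m(z)) / Im h\<close>, and the measure \<open>(1 + t\<^sup>2) d\<rho> / Im h\<close> represents it in
both half-planes, in the lower one by conjugation.\<close>

lemma minimizer_in_class:
  assumes S: "S > 0"
    and h: "h = - of_real (Re (m \<i>)) - \<i> * of_real (tanh (S / 2)) * of_real (Im (m \<i>))"
  shows "(Fin_mu (- Re (m \<i>)), h) \<in> entropy_class l q S"
proof -
  define a where "a = Re (m \<i>)"
  define c where "c = - Im (m \<i>)"
  define T where "T = tanh (S / 2)"
  define \<kappa> where "\<kappa> = exp (- S)"
  have c: "c > 0" using Im_m_neg[of \<i>] by (simp add: c_def)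
  have T: "0 < T" "T < 1" using S by (simp_all add: T_def tanh_real_lt_1)
  have \<kappa>: "0 < \<kappa>" "\<kappa> < 1" using S by (auto simp: \<kappa>_def)
  have T\<kappa>: "T = (1 - \<kappa>) / (1 + \<kappa>)" by (simp add: T_def \<kappa>_def tanh_half_exp(2))
  have hR: "Re h = - a" and hI: "Im h = T * c" by (simp_all add: h a_def c_def T_def)
  define D where "D = T * c"
  have D: "D > 0" using T c by (simp add: D_def)
  have h0: "Im h > 0" using hI D by (simp add: D_def)
  have ent: "c_entropy (S_system l q (Fin_mu (- a)) h) = ereal S"
  proof -
    have "(1 + \<kappa>) * T = 1 - \<kappa>" using \<kappa> by (simp add: T\<kappa>)
    then have T1: "T - 1 = - \<kappa> * (T + 1)" by (simp add: algebra_simps)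
    have "T * c - c = (T - 1) * c" by (simp add: algebra_simps)
    then have "T * c - c = - (\<kappa> * (T * c + c))" unfolding T1 by (simp add: algebra_simps)
    then have "(T * c - c)\<^sup>2 = \<kappa>\<^sup>2 * (T * c + c)\<^sup>2" by (simp only: power2_minus power_mult_distrib)
    then show ?thesis
      unfolding c_entropy_iff[OF h0] hI hR a_def[symmetric] \<kappa>_def[symmetric] by (simp add: c_def)
  qed
  obtain \<rho> :: "real measure" where \<rho>: "finite_measure \<rho>" "sets \<rho> = sets borel" "measure \<rho> UNIV = - Im (m \<i>)"
    "(\<integral>\<^sup>+t. ennreal (1 + t\<^sup>2) \<partial>\<rho>) = \<infinity>"
    and rep: "\<And>z. Im z > 0 \<Longrightarrow> Re (m \<i>) - m z = (LINT t|\<rho>. (1 + of_real t * z) / (of_real t - z))"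
    by (rule weyl_measure) blast
  interpret finite_measure \<rho> by (rule \<rho>(1))
  note [measurable_cong] = \<rho>(2)
  have sp: "space \<rho> = UNIV" using sets_eq_imp_space_eq[OF \<rho>(2)] by simp
  have imp: "impedance_function (S_system l q (Fin_mu (- a)) h) z = (of_real a - m z) / of_real D" if "Im z \<noteq> 0" for z
  proof -
    have N: "of_real (- a - Re h) * m z + of_real (- a * Re h - (cmod h)\<^sup>2) = - (of_real D * of_real D)"
    proof -
      have cm: "(cmod h)\<^sup>2 = a * a + D * D" 
        unfolding cmod_power2 by (simp add: hR hI D_def power2_eq_square)
      show ?thesis unfolding cm by (simp add: hR)
    qed
    have "impedance_function (S_system l q (Fin_mu (- a)) h) z = (m z + of_real (- a)) * of_real D / (- (of_real D * of_real D))"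
      unfolding impedance_function_Fin[OF h0 that] N by (simp add: hI D_def)
    also have "\<dots> = (of_real a - m z) / of_real D"
      using D by (simp add: divide_eq_eq) (simp add: field_simps)
    finally show ?thesis .
  qed
  have rep_all: "of_real a - m z = (LINT t|\<rho>. (1 + of_real t * z) / (of_real t - z))" if z: "Im z \<noteq> 0" for z
  proof (cases "Im z > 0")
    case True
    then show ?thesis using rep[OF True] by (simp add: a_def)
  next
    case False
    then have z': "Im (cnj z) > 0" using z by simp
    have "of_real a - m z = cnj (of_real (Re (m \<i>)) - m (cnj z))" using m_cnj[OF z] by (simp add: a_def)
    also have "\<dots> = (LINT t|\<rho>. cnj ((1 + of_real t * cnj z) / (of_real t - cnj z)))"
      unfolding rep[OF z'] by (rule Bochner_Integration.integral_cnj[symmetric])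
    finally show ?thesis by simp
  qed
  define \<sigma> where "\<sigma> = density \<rho> (\<lambda>t. ennreal ((1 + t\<^sup>2) / D))"
  have wm: "(\<lambda>t. (1 + t\<^sup>2) / D) \<in> borel_measurable \<rho>" by measurable
  have w0: "0 \<le> (1 + t\<^sup>2) / D" for t using D by (simp add: add_nonneg_nonneg)
  have p1: "1 + t\<^sup>2 > 0" for t :: real by (intro add_pos_nonneg) auto
  have "impedance_function (S_system l q (Fin_mu (- a)) h) \<in> gen_donoghue_inv \<kappa>"
    unfolding gen_donoghue_inv_def mem_Collect_eq
  proof (intro conjI exI allI impI)
    show "0 \<le> \<kappa>" "\<kappa> < 1" using \<kappa> by auto
    show "sets \<sigma> = sets borel" by (simp add: \<sigma>_def \<rho>(2))
    have "emeasure \<sigma> UNIV = (\<integral>\<^sup>+t. ennreal ((1 + t\<^sup>2) / D) * indicator UNIV t \<partial>\<rho>)"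
      unfolding \<sigma>_def by (rule emeasure_density) (use wm in \<open>auto simp: \<rho>(2)\<close>)
    also have "\<dots> = (\<integral>\<^sup>+t. ennreal (1 / D) * ennreal (1 + t\<^sup>2) \<partial>\<rho>)"
    proof (rule nn_integral_cong)
      fix t
      have "ennreal (1 / D * (1 + t\<^sup>2)) = ennreal (1 / D) * ennreal (1 + t\<^sup>2)"
        by (rule ennreal_mult') (use D in simp)
      then show "ennreal ((1 + t\<^sup>2) / D) * indicator UNIV t = ennreal (1 / D) * ennreal (1 + t\<^sup>2)" by simp
    qed
    also have "\<dots> = ennreal (1 / D) * (\<integral>\<^sup>+t. ennreal (1 + t\<^sup>2) \<partial>\<rho>)"
      by (rule nn_integral_cmult) measurable
    also have "\<dots> = \<infinity>" unfolding \<rho>(4) using D by (simp add: ennreal_mult_top)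
    finally show "emeasure \<sigma> UNIV = \<infinity>" .
    have "(\<integral>\<^sup>+ t. ennreal (1 / (1 + t\<^sup>2)) \<partial>\<sigma>) = (\<integral>\<^sup>+ t. ennreal ((1 + t\<^sup>2) / D) * ennreal (1 / (1 + t\<^sup>2)) \<partial>\<rho>)"
      unfolding \<sigma>_def by (rule nn_integral_density) (use wm in measurable)
    also have "\<dots> = (\<integral>\<^sup>+ t. ennreal (1 / D) \<partial>\<rho>)"
    proof (rule nn_integral_cong)
      fix t
      show "ennreal ((1 + t\<^sup>2) / D) * ennreal (1 / (1 + t\<^sup>2)) = ennreal (1 / D)"
        unfolding ennreal_mult'[OF w0, symmetric] using p1[of t] by simp
    qed
    also have "\<dots> = ennreal (1 / D * c)"
    proof -
      have "ennreal (1 / D) * emeasure \<rho> UNIV = ennreal (1 / D) * ennreal c"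
        by (simp add: emeasure_eq_measure \<rho>(3) c_def)
      also have "\<dots> = ennreal (1 / D * c)"
        by (rule ennreal_mult'[symmetric]) (use D in simp)
      finally show ?thesis by (simp add: sp)
    qed
    also have "1 / D * c = (1 + \<kappa>) / (1 - \<kappa>)"
      using c \<kappa> by (simp add: D_def T\<kappa> field_simps)
    finally show "(\<integral>\<^sup>+ t. ennreal (1 / (1 + t\<^sup>2)) \<partial>\<sigma>) = ennreal ((1 + \<kappa>) / (1 - \<kappa>))" .
  next
    fix z :: complex assume z: "Im z \<noteq> 0"
    have "(LINT t|\<sigma>. 1 / (of_real t - z) - of_real (t / (1 + t\<^sup>2))) =
      (LINT t|\<rho>. ((1 + t\<^sup>2) / D) *\<^sub>R (1 / (of_real t - z) - of_real (t / (1 + t\<^sup>2))))"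
      unfolding \<sigma>_def by (rule integral_density) (use wm w0 in \<open>auto\<close>)
    also have "\<dots> = (LINT t|\<rho>. (1 + of_real t * z) / (of_real t - z) / of_real D)"
    proof (rule Bochner_Integration.integral_cong[OF refl])
      fix t
      have tz: "of_real t - z \<noteq> 0" using z by (auto simp: complex_eq_iff)
      have pc: "(1 + (of_real t)\<^sup>2 :: complex) \<noteq> 0"
        using p1[of t] by (metis of_real_1 of_real_add of_real_eq_0_iff of_real_power less_irrefl)
      have "(of_real (1 + t\<^sup>2) :: complex) * (1 / (of_real t - z) - of_real (t / (1 + t\<^sup>2))) = (1 + of_real t * z) / (of_real t - z)"
      proof -
        have gen: "P * (1 / d - T / P) = (P - T * d) / d" if "P \<noteq> 0" "d \<noteq> 0" for P d T :: complex
          using that by (simp add: right_diff_distrib diff_divide_distrib)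
        have "(of_real (1 + t\<^sup>2) :: complex) * (1 / (of_real t - z) - of_real t / of_real (1 + t\<^sup>2)) =
            (of_real (1 + t\<^sup>2) - of_real t * (of_real t - z)) / (of_real t - z)"
          by (rule gen) (use pc tz in auto)
        also have "of_real (1 + t\<^sup>2) - of_real t * (of_real t - z) = 1 + of_real t * z"
          by (simp add: power2_eq_square algebra_simps)
        finally show ?thesis by simp
      qed
      then show "((1 + t\<^sup>2) / D) *\<^sub>R (1 / (of_real t - z) - of_real (t / (1 + t\<^sup>2))) = (1 + of_real t * z) / (of_real t - z) / of_real D"
        by (simp add: scaleR_conv_of_real)
    qed
    also have "\<dots> = (LINT t|\<rho>. (1 + of_real t * z) / (of_real t - z)) / of_real D"
      by (rule integral_divide_zero)
    finally show "impedance_function (S_system l q (Fin_mu (- a)) h) z = (LINT t|\<sigma>. 1 / (of_real t - z) - of_real (t / (1 + t\<^sup>2)))"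
      unfolding imp[OF z] rep_all[OF z] by simp
  qed
  then show ?thesis
    using ent h0 by (simp add: entropy_class_def \<kappa>_def a_def)
qed

end

theorem theorem19:
  fixes l :: real and q :: "real \<Rightarrow> real" and m :: "complex \<Rightarrow> complex" and S :: real
  assumes "locally_summable l q"
    and "deficiency_indices_1_1 l q"
    and "weyl_function l q m"
    and "S > 0"
  shows "let Dmin = - ((exp S - 1) / (exp S + 1)) * Im (m \<i>) in
      Dmin \<in> dissipation_coeff ` entropy_class l q S \<and>
      (\<forall>\<theta>\<in>entropy_class l q S. Dmin \<le> dissipation_coeff \<theta>) \<and>
      Dmin = - tanh (S / 2) * Im (m \<i>) \<and>
      (\<forall>\<mu> h. (\<mu>, h) \<in> entropy_class l q S \<and> dissipation_coeff (\<mu>, h) = Dmin \<longleftrightarrow>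
         \<mu> = Fin_mu (- Re (m \<i>)) \<and>
         h = - of_real (Re (m \<i>)) - \<i> * of_real (tanh (S / 2)) * of_real (Im (m \<i>)))"
proof -
  interpret weyl_problem l q m by unfold_locales (use assms in auto)
  note S = \<open>S > 0\<close>
  define D where "D = - tanh (S / 2) * Im (m \<i>)"
  let ?\<mu> = "Fin_mu (- Re (m \<i>))"
  let ?h = "- of_real (Re (m \<i>)) - \<i> * of_real (tanh (S / 2)) * of_real (Im (m \<i>)) :: complex"
  have mem: "(?\<mu>, ?h) \<in> entropy_class l q S" by (rule minimizer_in_class[OF S refl])
  have diss: "dissipation_coeff (?\<mu>, ?h) = D" by (simp add: dissipation_coeff_def D_def)
  have lower: "D \<le> dissipation_coeff \<theta>" if "\<theta> \<in> entropy_class l q S" for \<theta>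
    using entropy_class_bound(1)[OF S, of "fst \<theta>" "snd \<theta>"] that
    by (simp add: dissipation_coeff_def D_def case_prod_beta)
  have unique: "\<mu> = ?\<mu> \<and> h = ?h" if "(\<mu>, h) \<in> entropy_class l q S" "dissipation_coeff (\<mu>, h) = D" for \<mu> h
  proof -
    have Ih: "Im h = - tanh (S / 2) * Im (m \<i>)" using that(2) by (simp add: dissipation_coeff_def D_def)
    have Rh: "Re h = - Re (m \<i>)" by (rule entropy_class_bound(2)[OF S that(1) Ih])
    have "impedance_function (S_system l q \<mu> h) \<in> gen_donoghue_inv (exp (- S))"
      using that(1) by (simp add: entropy_class_def)
    from impedance_determines_mu[OF S Rh Ih gen_donoghue_inv_at_i[OF this]]
    show ?thesis using Rh Ih by (simp add: complex_eq_iff)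
  qed
  have "D \<in> dissipation_coeff ` entropy_class l q S"
    using mem diss by (metis imageI)
  with lower unique mem diss show ?thesis
    unfolding Let_def tanh_half_exp(1) D_def[symmetric] by blast
qed

end
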